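(* Let $G$ be a finite connected graph of minimal degree at least $3$ and maximal degree $D$, let $W:V(G)\to\mathbb{R}$, and let $\psi_\lambda$ be an eigenfunction of $H_G=\mathcal{A}_G+W$ with eigenvalue $\lambda$ in the bulk spectrum and $\|\psi_\lambda\|_2=1$. Then: (1) For every $p>4$, $Z_{p/4,\lambda}(G)<1$ and $\|\psi_\lambda\|_p\le \frac{8D\,z_\lambda(G)^{-5}}{1-Z_{p/4,\lambda}(G)^{2/p}}\cdot\frac{1}{\sqrt{\ell_G}}$. (2) If $\Lambda$ is the support of $\psi_\lambda$ and $M_\lambda:=Z_{2,\lambda}(G)^{-1/4}$, then $M_\lambda>1$ and $|\Lambda|\ge\frac{1}{4D}M_\lambda^{\ell_G}$.
   Context: $\mathcal{A}_G$ is the adjacency matrix; $(\widetilde G,\widetilde W)$ is the universal cover (a tree) of $G$ with lifted potential and $H_{\widetilde G}=\mathcal{A}_{\widetilde G}+\widetilde W$. For a tree with potential and $v\sim w$, $\zeta^\gamma_w(v)=-(H^{(v|w)}-\gamma)^{-1}(v,v)$ for $\Im\gamma>0$, where $H^{(v|w)}$ is the operator restricted to the component containing $v$ of the tree with edge $\{v,w\}$ removed; for an oriented edge $(x,y)$ of $G$, $\zeta^\gamma_y(x):=\zeta^\gamma_{\tilde y}(\tilde x)$ for adjacent lifts $\tilde x\sim\tilde y$, and $\zeta^{\lambda+i0}_y(x)=\lim_{\eta\downarrow0}\zeta^{\lambda+i\eta}_y(x)$. The spectrum $\sigma(H_{\widetilde G})$ is the disjoint union of finitely many open intervals $J_r$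 of absolutely continuous spectrum, a finite set of eigenvalues and the endpoints of the $J_r$; the bulk spectrum is $\bigcup_rJ_r$, on which all $\zeta^{\lambda+i0}_y(x)$ exist with nonzero imaginary part. Define $z_\lambda(G)=\min_{(x,y)}|\Im\zeta^{\lambda+i0}_y(x)|$ over oriented edges, and for $s>1$, $Z_{s,\lambda}(G)=\max_{(x_0,x_1)}\sum_{x_2\in\mathcal N_{x_1}\setminus\{x_0\}}\frac{|\zeta^{\lambda+i0}_{x_0}(x_1)|^{2s}|\Im\zeta^{\lambda+i0}_{x_1}(x_2)|^s}{|\Im\zeta^{\lambda+i0}_{x_0}(x_1)|^s}$, the maximum over oriented edges $(x_0,x_1)$ and $\mathcal N_{x_1}$ the set of neighbours of $x_1$. $\ell_G$ is the largest integer $\ell$ such that every ball $B_G(x,\ell)$ contains at most one cycle. *)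

theory Defs
  imports "HOL-Analysis.Analysis"
begin

text \<open>A finite simple graph is given by a vertex type of class finite and an
adjacency relation E (assumed symmetric and irreflexive in the theorem).\<close>

definition deg :: "('a \<Rightarrow> 'a \<Rightarrow> bool) \<Rightarrow> 'a \<Rightarrow> nat" where
  "deg E x = card {y. E x y}"

definition maxdeg :: "('a::finite \<Rightarrow> 'a \<Rightarrow> bool) \<Rightarrow> nat" where
  "maxdeg E = Max (range (deg E))"

subsection \<open>Universal cover: non-backtracking walks from a fixed base vertex\<close>

definition nb_walk :: "('a \<Rightarrow> 'a \<Rightarrow> bool) \<Rightarrow> 'a list \<Rightarrow> bool" where
  "nb_walk E p \<longleftrightarrow> p \<noteq> [] \<and> hd p = (SOME b. True)
     \<and> (\<forall>i. Suc i < length p \<longrightarrow> E (p ! i) (p ! Suc i))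
     \<and> (\<forall>i. Suc (Suc i) < length p \<longrightarrow> p ! i \<noteq> p ! Suc (Suc i))"

text \<open>Adjacency in the universal cover tree; the covering map is last,
the lifted potential is W o last.\<close>
definition cover_adj :: "('a \<Rightarrow> 'a \<Rightarrow> bool) \<Rightarrow> 'a list \<Rightarrow> 'a list \<Rightarrow> bool" where
  "cover_adj E p q \<longleftrightarrow> nb_walk E p \<and> nb_walk E q
     \<and> ((\<exists>y. q = p @ [y]) \<or> (\<exists>y. p = q @ [y]))"

definition branch :: "('a \<Rightarrow> 'a \<Rightarrow> bool) \<Rightarrow> 'a list \<Rightarrow> 'a list \<Rightarrow> 'a list set" where
  "branch E v w = {u. (\<lambda>a c. cover_adj E a c \<and> {a, c} \<noteq> {v, w})\<^sup>*\<^sup>* v u}"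

text \<open>Diagonal resolvent entry (H^S - gamma)^{-1}(v,v) of the restriction H^S of
the lifted operator to the vertex set S: the value at v of the unique l^2(S)
solution f of (H^S - gamma) f = delta_v.\<close>
definition tree_green ::
  "('a \<Rightarrow> 'a \<Rightarrow> bool) \<Rightarrow> ('a \<Rightarrow> real) \<Rightarrow> 'a list set \<Rightarrow> complex \<Rightarrow> 'a list \<Rightarrow> complex" where
  "tree_green E W S \<gamma> v = (THE g. \<exists>f :: 'a list \<Rightarrow> complex.
      (\<lambda>u. (cmod (f u))\<^sup>2) summable_on S
    \<and> (\<forall>u\<in>S. (\<Sum>u'\<in>{u'\<in>S. cover_adj E u u'}. f u')
               + (complex_of_real (W (last u)) - \<gamma>) * f u = (if u = v then 1 else 0))
    \<and> g = f v)"

text \<open>zeta E W gamma w v is zeta^gamma_w(v) for an oriented edge (v,w) of G,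
computed at adjacent lifts.\<close>
definition zeta :: "('a \<Rightarrow> 'a \<Rightarrow> bool) \<Rightarrow> ('a \<Rightarrow> real) \<Rightarrow> complex \<Rightarrow> 'a \<Rightarrow> 'a \<Rightarrow> complex" where
  "zeta E W \<gamma> w v = (let (a, b) = (SOME (a, b). cover_adj E a b \<and> last a = v \<and> last b = w)
                     in - tree_green E W (branch E a b) \<gamma> a)"

definition zeta0 :: "('a \<Rightarrow> 'a \<Rightarrow> bool) \<Rightarrow> ('a \<Rightarrow> real) \<Rightarrow> real \<Rightarrow> 'a \<Rightarrow> 'a \<Rightarrow> complex" where
  "zeta0 E W lam w v = Lim (at_right 0) (\<lambda>\<eta>::real. zeta E W (Complex lam \<eta>) w v)"

definition bulk_spectrum :: "('a \<Rightarrow> 'a \<Rightarrow> bool) \<Rightarrow> ('a \<Rightarrow> real) \<Rightarrow> real set" where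
  "bulk_spectrum E W = {lam. \<forall>v w. E v w \<longrightarrow>
      (\<exists>L. ((\<lambda>\<eta>::real. zeta E W (Complex lam \<eta>) w v) \<longlongrightarrow> L) (at_right 0) \<and> Im L \<noteq> 0)}"

definition zmin :: "('a \<Rightarrow> 'a \<Rightarrow> bool) \<Rightarrow> ('a \<Rightarrow> real) \<Rightarrow> real \<Rightarrow> real" where
  "zmin E W lam = Min {\<bar>Im (zeta0 E W lam y x)\<bar> | x y. E x y}"

definition Zs :: "('a \<Rightarrow> 'a \<Rightarrow> bool) \<Rightarrow> ('a \<Rightarrow> real) \<Rightarrow> real \<Rightarrow> real \<Rightarrow> real" where
  "Zs E W s lam = Max {(\<Sum>x2\<in>{x2. E x1 x2 \<and> x2 \<noteq> x0}.
        cmod (zeta0 E W lam x0 x1) powr (2 * s) * \<bar>Im (zeta0 E W lam x1 x2)\<bar> powr s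
        / \<bar>Im (zeta0 E W lam x0 x1)\<bar> powr s) | x0 x1. E x0 x1}"

definition ball_G :: "('a \<Rightarrow> 'a \<Rightarrow> bool) \<Rightarrow> 'a \<Rightarrow> nat \<Rightarrow> 'a set" where
  "ball_G E x r = {y. \<exists>n\<le>r. (E ^^ n) x y}"

definition edges_in :: "('a \<Rightarrow> 'a \<Rightarrow> bool) \<Rightarrow> 'a set \<Rightarrow> 'a set set" where
  "edges_in E B = {{x, y} | x y. E x y \<and> x \<in> B \<and> y \<in> B}"

definition is_cycle :: "('a \<Rightarrow> 'a \<Rightarrow> bool) \<Rightarrow> 'a set set \<Rightarrow> bool" where
  "is_cycle E C \<longleftrightarrow> C \<noteq> {} \<and> finite C \<and> (\<forall>e\<in>C. \<exists>x y. e = {x, y} \<and> E x y)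
     \<and> (\<forall>x\<in>\<Union>C. card {e\<in>C. x \<in> e} = 2)
     \<and> (\<forall>x\<in>\<Union>C. \<forall>y\<in>\<Union>C. (\<lambda>a b. {a, b} \<in> C)\<^sup>*\<^sup>* x y)"

definition ellG :: "('a \<Rightarrow> 'a \<Rightarrow> bool) \<Rightarrow> nat" where
  "ellG E = (GREATEST l. \<forall>x. card {C. C \<subseteq> edges_in E (ball_G E x l) \<and> is_cycle E C} \<le> 1)"

definition pnorm :: "('a::finite \<Rightarrow> complex) \<Rightarrow> real \<Rightarrow> real" where
  "pnorm \<psi> p = (\<Sum>x\<in>UNIV. cmod (\<psi> x) powr p) powr (1 / p)"

end

theory Submission
  imports Defs "HOL-Library.Sublist"
begin

text \<open>
  Write \<open>Z x y = zeta0 E W lam x y\<close> and \<open>m x y = \<bar>Im (Z x y)\<bar>\<close>. For \<open>Im \<gamma> > 0\<close> the recursion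
  \<open>Z x y * (\<gamma> - W y - (\<Sum>u. Z y u)) = 1\<close>, with \<open>u\<close> running over the neighbours of \<open>y\<close> other than \<open>x\<close>,
  has a solution in the lower half-plane by Brouwer's theorem, and products of \<open>Z\<close> along geodesics
  of the universal cover solve the resolvent equation in \<open>l\<^sup>2\<close>; since that solution is unique, it is
  the Green function. On the real axis the imaginary part of the recursion says that
  \<open>P((x, y), (y, u)) = (cmod (Z x y))\<^sup>2 * m y u / m x y\<close> is a transition kernel on oriented edges.

  If \<open>\<psi>\<close> is an eigenfunction, then \<open>f x y = \<psi> y - Z x y * \<psi> x\<close> is fixed by the non-backtracking
  operator weighted with \<open>Z\<close>, hence equal to a sum over non-backtracking walks of any length \<open>k\<close>, with
  weights \<open>sqrt P\<close> after normalisation by \<open>m\<close>. In a graph with at most one cycle there are at most three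
  non-backtracking walks of a given length between two vertices. For the support, the maximum of
  \<open>f / sqrt m\<close> is bounded by the number of walks ending in the support of \<open>f\<close> and the fourth moment of
  the weights. For the \<open>l\<^sup>p\<close> bound, \<open>f\<close> is paired with a test function and averaged over the lengths
  up to half of \<open>ellG E\<close>; the square of the adjoint is expanded in pairs of walks with a common end. Such a
  pair is, up to a common final piece whose weights sum to one, a non-backtracking walk joining
  the two starting edges, so Young's inequality and the geometric decay of the \<open>p/4\<close>-th moments give the estimate.
\<close>

subsection \<open>Non-backtracking walks and cycles\<close>

text \<open>The squares of the weights \<open>sqrt P\<close> sum to one, while their plain sum over
  walks of length \<open>k\<close> grows with \<open>k\<close>. So neither the triangle inequality
  nor an \<open>l^2\<close> bound at one fixed length gives decay. What decays are the moments of
  \<open>sqrt P\<close> of order above two, since every row of \<open>P\<close> has at least two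
  positive entries. Young's inequality against a test function in the exponent conjugate to
  \<open>p\<close> asks for the moment of order \<open>p/2\<close> of a kernel made of such weights.
  This is the moment of \<open>P\<close> of order \<open>s = p/4\<close>, which explains the
  condition \<open>p > 4\<close> and the rate \<open>Zs powr (2 / p)\<close>.

  Pairs of walks arriving over the same edge are handled exactly, because \<open>P\<close> is
  stochastic. Passing from one length to the next therefore costs only the pairs that have just
  merged. Joined at the merging vertex, such a pair is a single walk, and it must have at most
  \<open>ellG E\<close> edges to have multiplicity at most three; hence lengths stop at half of
  \<open>ellG E\<close>. The propagated test functions are almost orthogonal, so the mean of
  \<open>n\<close> of them has squared norm of order \<open>1 / n\<close>. That is the source of
  \<open>1 / sqrt (ellG E)\<close>.\<close>

fun nbw :: "('a \<Rightarrow> 'a \<Rightarrow> bool) \<Rightarrow> 'a list \<Rightarrow> bool" where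
  "nbw R [] = True"
| "nbw R [x] = True"
| "nbw R [x, y] = R x y"
| "nbw R (x # y # z # r) = (R x y \<and> x \<noteq> z \<and> nbw R (y # z # r))"

lemma nbw_ConsD: "nbw R (x # r) \<Longrightarrow> nbw R r"
  by (cases "(R, x # r)" rule: nbw.cases) auto

lemma nbw_Cons_adj: "nbw R (x # y # r) \<Longrightarrow> R x y"
  by (cases r) auto

lemma nbw_iff_nth:
  "nbw R r \<longleftrightarrow> (\<forall>i. Suc i < length r \<longrightarrow> R (r ! i) (r ! Suc i))
     \<and> (\<forall>i. Suc (Suc i) < length r \<longrightarrow> r ! i \<noteq> r ! Suc (Suc i))"
proof (induction R r rule: nbw.induct)
  case (4 R x y z r)
  have all_nat: "(\<forall>i. P i) \<longleftrightarrow> P 0 \<and> (\<forall>i. P (Suc i))" for P :: "nat \<Rightarrow> bool"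
    by (metis not0_implies_Suc)
  show ?case
    by (subst all_nat, subst (2) all_nat) (use 4 in auto)
qed auto

lemma nbw_rev:
  assumes "\<And>x y. R x y \<Longrightarrow> R y x" "nbw R r"
  shows "nbw R (rev r)"
  unfolding nbw_iff_nth
proof (intro conjI allI impI)
  fix i assume i: "Suc i < length (rev r)"
  have "R (r ! (length r - Suc (Suc i))) (r ! Suc (length r - Suc (Suc i)))"
    using assms(2) i unfolding nbw_iff_nth by auto
  moreover have "Suc (length r - Suc (Suc i)) = length r - Suc i"
    using i by auto
  ultimately show "R (rev r ! i) (rev r ! Suc i)"
    using assms(1) i by (simp add: rev_nth)
next
  fix i assume i: "Suc (Suc i) < length (rev r)"
  define k where "k = length r - Suc (Suc (Suc i))"
  have k: "length r - Suc i = Suc (Suc k)" "Suc (Suc k) < length r"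
    using i by (auto simp: k_def)
  have "r ! k \<noteq> r ! Suc (Suc k)"
    using assms(2) k(2) unfolding nbw_iff_nth by blast
  then show "rev r ! i \<noteq> rev r ! Suc (Suc i)"
    using i k by (simp add: rev_nth k_def)
qed

lemma nbw_join:
  "nbw R (p @ [y, x]) \<Longrightarrow> nbw R (x # z # q) \<Longrightarrow> y \<noteq> z \<Longrightarrow> nbw R (p @ y # x # z # q)"
proof (induction p rule: induct_list012)
  case (3 a b p)
  then show ?case by (cases p) auto
qed auto

lemma nbw_appendD1: "nbw R (p @ q) \<Longrightarrow> nbw R p"
proof (induction R p rule: nbw.induct)
  case (3 R x y)
  then show ?case by (cases q) auto
qed auto

lemma nbw_appendD2: "nbw R (p @ q) \<Longrightarrow> nbw R q"
  by (induction p) (auto dest: nbw_ConsD)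

lemma is_cycle_edges: "is_cycle R C \<Longrightarrow> e \<in> C \<Longrightarrow> \<exists>x y. e = {x, y} \<and> R x y"
  by (simp add: is_cycle_def)

lemma is_cycle_transfer:
  "is_cycle R C \<Longrightarrow> (\<And>e. e \<in> C \<Longrightarrow> \<exists>x y. e = {x, y} \<and> S x y) \<Longrightarrow> is_cycle S C"
  by (simp add: is_cycle_def)

text \<open>Bridge from a cyclic list of vertices to cycles as edge sets. Length at least three
  keeps the two edges at a vertex distinct.\<close>

lemma cyclic_vertices_is_cycle:
  assumes R: "\<And>x y. R x y \<Longrightarrow> R y x"
    and k: "k \<ge> 3" and inj: "inj_on v {..<k}"
    and adj: "\<And>i. i < k \<Longrightarrow> R (v i) (v (Suc i mod k))"
  shows "is_cycle R ((\<lambda>i. {v i, v (Suc i mod k)}) ` {..<k})"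
proof -
  define C where "C = (\<lambda>i. {v i, v (Suc i mod k)}) ` {..<k}"
  have UC: "\<Union>C = v ` {..<k}"
    using k by (auto simp: C_def)
  have veq: "v i = v j \<longleftrightarrow> i = j" if "i < k" "j < k" for i j
    using inj that by (auto simp: inj_on_def)
  have two: "card {e \<in> C. x \<in> e} = 2" if "x \<in> \<Union>C" for x
  proof -
    from that UC obtain i where i: "i < k" "x = v i" by auto
    \<comment> \<open>\<open>j\<close> is the cyclic predecessor of \<open>i\<close>; the two edges
      at \<open>v i\<close> are those with index \<open>i\<close> and \<open>j\<close>.\<close>
    define j where "j = (if i = 0 then k - 1 else i - 1)"
    have j: "j < k" "Suc j mod k = i" "j \<noteq> i"
      using i k by (auto simp: j_def)
    have jj: "l = j" if "l < k" "Suc l mod k = i" for l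
    proof (cases "Suc l = k")
      case True
      then show ?thesis using that by (auto simp: j_def)
    next
      case False
      then show ?thesis using that by (auto simp: j_def)
    qed
    have "{e \<in> C. x \<in> e} = {{v i, v (Suc i mod k)}, {v j, v (Suc j mod k)}}"
    proof (intro equalityI subsetI)
      fix e assume "e \<in> {e \<in> C. x \<in> e}"
      then obtain l where l: "l < k" "e = {v l, v (Suc l mod k)}" "x = v l \<or> x = v (Suc l mod k)"
        by (auto simp: C_def)
      then have "l = i \<or> Suc l mod k = i"
        using i k veq[of i l] veq[of i "Suc l mod k"] by auto
      then have "l = i \<or> l = j" using jj l(1) by auto
      then show "e \<in> {{v i, v (Suc i mod k)}, {v j, v (Suc j mod k)}}"
        using l(2) by auto
    next
      fix e assume "e \<in> {{v i, v (Suc i mod k)}, {v j, v (Suc j mod k)}}"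
      then show "e \<in> {e \<in> C. x \<in> e}"
        using i j by (auto simp: C_def)
    qed
    moreover have "{v i, v (Suc i mod k)} \<noteq> {v j, v (Suc j mod k)}"
    proof
      assume "{v i, v (Suc i mod k)} = {v j, v (Suc j mod k)}"
      then have "v j = v i \<or> v j = v (Suc i mod k)" by auto
      then have "j = Suc i mod k"
        using veq[of j i] veq[of j "Suc i mod k"] j i k by auto
      then show False
        using i k by (cases "Suc i = k") (auto simp: j_def split: if_splits)
    qed
    ultimately show ?thesis by simp
  qed
  have conn0: "(\<lambda>a b. {a, b} \<in> C)\<^sup>*\<^sup>* (v 0) (v i)" if "i < k" for i
    using that
  proof (induction i)
    case (Suc i)
    have "{v i, v (Suc i)} \<in> C"
      unfolding C_def using Suc.prems by (intro image_eqI[of _ _ i]) auto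
    then show ?case using Suc by (auto intro: rtranclp.rtrancl_into_rtrancl)
  qed auto
  have symC: "symp (\<lambda>a b. {a, b} \<in> C)"
    by (auto simp: symp_def insert_commute)
  have conn: "(\<lambda>a b. {a, b} \<in> C)\<^sup>*\<^sup>* x y" if xy: "x \<in> \<Union>C" "y \<in> \<Union>C" for x y
  proof -
    have "(\<lambda>a b. {a, b} \<in> C)\<^sup>*\<^sup>* (v 0) x" "(\<lambda>a b. {a, b} \<in> C)\<^sup>*\<^sup>* (v 0) y"
      using xy UC conn0 by auto
    then show ?thesis
      using symC by (meson rtranclp_trans symp_rtranclp sympD)
  qed
  show ?thesis
    unfolding is_cycle_def C_def[symmetric]
  proof (intro conjI ballI)
    show "C \<noteq> {}" using k by (auto simp: C_def lessThan_empty_iff)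
    show "finite C" by (auto simp: C_def)
    show "\<exists>x y. e = {x, y} \<and> R x y" if "e \<in> C" for e
      using that adj unfolding C_def by blast
  qed (use two conn in auto)
qed

text \<open>A repetition with the least gap has distinct vertices in between. Gap one would be a
  loop and gap two a reversal, so the gap is at least three. The walk may still reverse at its
  closing point, which is why the cycle is sought inside it.\<close>

lemma closed_nbw_cycle:
  assumes R: "\<And>x y. R x y \<Longrightarrow> R y x" and irr: "\<And>x. \<not> R x x"
    and r: "nbw R r" "length r \<ge> 2" "hd r = last r"
  shows "\<exists>C. is_cycle R C"
proof -
  define P where "P k = (k > 0 \<and> (\<exists>i. i + k < length r \<and> r ! i = r ! (i + k)))" for k
  have "r \<noteq> []" using r(2) by auto
  then have "P (length r - 1)"
    using r unfolding P_def by (auto simp: hd_conv_nth last_conv_nth intro!: exI[of _ 0])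
  then obtain k where Pk: "P k" and least: "\<And>l. l < k \<Longrightarrow> \<not> P l"
    using exists_least_iff[of P] by blast
  from Pk obtain i where i: "i + k < length r" "r ! i = r ! (i + k)" and k0: "k > 0"
    unfolding P_def by auto
  have r1: "\<And>i. Suc i < length r \<Longrightarrow> R (r ! i) (r ! Suc i)"
    and r2: "\<And>i. Suc (Suc i) < length r \<Longrightarrow> r ! i \<noteq> r ! Suc (Suc i)"
    using r(1) unfolding nbw_iff_nth by auto
  have "k \<noteq> 1" using i r1[of i] irr by auto
  moreover have "k \<noteq> 2" using i r2[of i] by auto
  ultimately have k3: "k \<ge> 3" using k0 by auto
  define v where "v t = r ! (i + t)" for t
  have "inj_on v {..<k}"
  proof (rule linorder_inj_onI)
    fix s t assume st: "s < t" "s \<in> {..<k}" "t \<in> {..<k}"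
    then have "\<not> P (t - s)" by (intro least) auto
    then show "v s \<noteq> v t"
      unfolding P_def v_def using st i(1) by (auto simp: not_le dest!: spec[of _ "i + s"])
  qed auto
  moreover have "R (v t) (v (Suc t mod k))" if "t < k" for t
  proof (cases "Suc t = k")
    case True
    then show ?thesis using i r1[of "i + t"] by (auto simp: v_def)
  next
    case False
    then show ?thesis using that i r1[of "i + t"] by (auto simp: v_def)
  qed
  ultimately show ?thesis
    using cyclic_vertices_is_cycle[of R k v] R k3 by blast
qed

text \<open>Where two walks part, one of them reversed and continued by the other does not
  backtrack, and it closes up at the common end, which forces a cycle. If one walk stops first, the
  rest of the other is itself closed.\<close>

lemma acyclic_nbw_unique:
  assumes R: "\<And>x y. R x y \<Longrightarrow> R y x" and irr: "\<And>x. \<not> R x x"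
    and acyc: "\<And>C. \<not> is_cycle R C"
  shows "nbw R p \<Longrightarrow> nbw R q \<Longrightarrow> p \<noteq> [] \<Longrightarrow> q \<noteq> [] \<Longrightarrow> hd p = hd q \<Longrightarrow> last p = last q \<Longrightarrow> p = q"
proof (induction p arbitrary: q)
  case (Cons x p)
  have closed: False if "nbw R r" "length r \<ge> 2" "hd r = last r" for r
    using closed_nbw_cycle[of R r] R irr acyc that by blast
  note prems = \<open>nbw R (x # p)\<close> \<open>nbw R q\<close> \<open>last (x # p) = last q\<close>
  obtain q' where q: "q = x # q'" using Cons.prems(4,5) by (cases q) auto
  consider "p = []" "q' = []" | "p = []" "q' \<noteq> []" | "p \<noteq> []" "q' = []"
    | y p' z q'' where "p = y # p'" "q' = z # q''"
    by (metis neq_Nil_conv)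
  then show ?case
  proof cases
    case 1
    then show ?thesis using q by simp
  next
    case 2
    have "length q \<ge> 2" using q 2 by (cases q') auto
    then show ?thesis using closed[OF prems(2)] prems(3) q 2(1) by simp
  next
    case 3
    have "length (x # p) \<ge> 2" using 3 by (cases p) auto
    then show ?thesis using closed[OF prems(1)] prems(3) q 3 by simp
  next
    case 4
    show ?thesis
    proof (cases "y = z")
      case True
      have "p = q'"
      proof (rule Cons.IH)
        show "nbw R p" using prems(1) by (rule nbw_ConsD)
        show "nbw R q'" using prems(2) unfolding q by (rule nbw_ConsD)
      qed (use 4 True prems(3) q in auto)
      then show ?thesis using q by simp
    next
      case False
      have "nbw R (rev (x # y # p'))"
        using prems(1) R 4 by (intro nbw_rev) auto
      then have "nbw R (rev p' @ y # x # z # q'')"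
        using prems(2) q 4 False by (intro nbw_join) auto
      moreover have "hd (rev p' @ y # x # z # q'') = last (rev p' @ y # x # z # q'')"
      proof -
        have "hd (rev p' @ y # x # z # q'') = last (y # p')"
          by (cases p' rule: rev_cases) auto
        also have "\<dots> = last (z # q'')" using prems(3) q 4 by simp
        finally show ?thesis by simp
      qed
      ultimately show ?thesis using closed[of "rev p' @ y # x # z # q''"] by simp
    qed
  qed
qed auto

section \<open>Walks in a graph from which one edge of the cycle is removed\<close>

definition del_edge :: "('a \<Rightarrow> 'a \<Rightarrow> bool) \<Rightarrow> 'a \<Rightarrow> 'a \<Rightarrow> 'a \<Rightarrow> 'a \<Rightarrow> bool" where
  "del_edge H u v x y \<longleftrightarrow> H x y \<and> {x, y} \<noteq> {u, v}"

text \<open>The cut is made at the first crossing, so only the part before it is known to avoid the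
  edge.\<close>

lemma nbw_split_at_edge:
  assumes "nbw H r" "r \<noteq> []"
  shows "nbw (del_edge H u v) r \<or>
    (\<exists>p q. r = p @ q \<and> p \<noteq> [] \<and> q \<noteq> [] \<and> nbw (del_edge H u v) p \<and> {last p, hd q} = {u, v})"
  using assms
proof (induction r)
  case (Cons x r)
  show ?case
  proof (cases r)
    case r: (Cons y r')
    show ?thesis
    proof (cases "{x, y} = {u, v}")
      case True
      then show ?thesis
        using r by (intro disjI2 exI[of _ "[x]"] exI[of _ r]) auto
    next
      case False
      have Fxy: "del_edge H u v x y"
        using False r Cons.prems(1) nbw_Cons_adj[of H x y r'] by (simp add: del_edge_def)
      have ext: "nbw (del_edge H u v) (x # p)" if prm: "nbw (del_edge H u v) p" "r = p @ q" "p \<noteq> []" for p q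
      proof -
        obtain p' where p: "p = y # p'" using prm r by (cases p) auto
        show ?thesis
        proof (cases p')
          case Nil
          then show ?thesis using Fxy p by simp
        next
          case (Cons w p'')
          then show ?thesis using Fxy p prm(1,2) \<open>nbw H (x # r)\<close> by simp
        qed
      qed
      have "nbw H r" using Cons.prems(1) by (rule nbw_ConsD)
      then consider "nbw (del_edge H u v) r" |
        p q where "r = p @ q" "p \<noteq> []" "q \<noteq> []" "nbw (del_edge H u v) p" "{last p, hd q} = {u, v}"
        using Cons.IH r by blast
      then show ?thesis
      proof cases
        case 1
        then show ?thesis using ext[of r "[]"] r by simp
      next
        case 2
        then show ?thesis using ext[of p q] by (intro disjI2 exI[of _ "x # p"] exI[of _ q]) simp
      qed
    qed
  qed simp
qed simp

context
  fixes H :: "'a \<Rightarrow> 'a \<Rightarrow> bool" and u v :: 'a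
  assumes sym: "\<And>x y. H x y \<Longrightarrow> H y x" and irr: "\<And>x. \<not> H x x"
    and acyc: "\<And>C. \<not> is_cycle (del_edge H u v) C"
begin

lemma del_edge_nbw_unique:
  assumes "nbw (del_edge H u v) p" "nbw (del_edge H u v) q" "p \<noteq> []" "q \<noteq> []" "hd p = hd q" "last p = last q"
  shows "p = q"
  using acyclic_nbw_unique[of "del_edge H u v" p q] assms acyc sym irr
  by (auto simp: del_edge_def insert_commute)

text \<open>A crossing from \<open>v\<close> to \<open>u\<close> would require the walk to be at
  \<open>v\<close> again. In a forest a non-backtracking walk from \<open>v\<close> to
  \<open>v\<close> is trivial, so this would be the very first step, which is excluded. After one
  crossing the cycle is thus always traversed in the same sense.\<close>

lemma nbw_after_crossing:
  assumes r: "nbw H r" "r \<noteq> []" "hd r = v" and uv: "u \<noteq> v"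
    and not_back: "\<And>r'. r \<noteq> v # u # r'"
  shows "nbw (del_edge H u v) r \<or>
    (\<exists>p q. r = p @ q \<and> p \<noteq> [] \<and> q \<noteq> [] \<and> nbw (del_edge H u v) p \<and> last p = u \<and> hd p = v \<and> hd q = v
       \<and> nbw H q \<and> (\<forall>r'. q \<noteq> v # u # r'))"
proof (cases "nbw (del_edge H u v) r")
  case False
  then obtain p q where pq: "r = p @ q" "p \<noteq> []" "q \<noteq> []" "nbw (del_edge H u v) p" "{last p, hd q} = {u, v}"
    using nbw_split_at_edge[OF r(1,2), of u v] by blast
  have hp: "hd p = v" using pq r(3) by simp
  have "last p \<noteq> v"
  proof
    assume lp: "last p = v"
    have "p = [v]"
      using pq hp lp by (intro del_edge_nbw_unique) auto
    moreover have "hd q = u" using pq(5) lp uv by (auto simp: doubleton_eq_iff)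
    ultimately show False using not_back[of "tl q"] pq by (cases q) auto
  qed
  then have lp: "last p = u" and hq: "hd q = v" using pq(5) by (auto simp: doubleton_eq_iff)
  have nq: "nbw H q" using r(1) pq(1) nbw_appendD2 by blast
  have "q \<noteq> v # u # r'" for r'
  proof
    assume q: "q = v # u # r'"
    have "p = butlast p @ [u]" using pq(2) lp by (metis append_butlast_last_id)
    then have "nbw H (butlast p @ [u] @ v # u # r')" using r(1) pq(1) q by (metis append_assoc)
    then have "nbw H (u # v # u # r')" using nbw_appendD2 by fastforce
    then show False by simp
  qed
  then show ?thesis using pq lp hq nq hp by blast
qed blast

text \<open>Each further crossing completes one turn around the cycle. Cutting off all turns leaves
  a walk in the forest, hence the forest walk \<open>p\<close>.\<close>

lemma nbw_after_crossing_length: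
  assumes "nbw H r" "r \<noteq> []" "hd r = v" "u \<noteq> v" "\<And>r'. r \<noteq> v # u # r'"
    and "nbw (del_edge H u v) p" "p \<noteq> []" "hd p = v" "last p = last r"
  shows "length p \<le> length r"
  using assms
proof (induction "length r" arbitrary: r rule: less_induct)
  case less
  show ?case
  proof (cases "nbw (del_edge H u v) r")
    case True
    then have "p = r" using less.prems by (intro del_edge_nbw_unique) auto
    then show ?thesis by simp
  next
    case False
    then obtain p' q where *: "r = p' @ q" "p' \<noteq> []" "q \<noteq> []" "hd q = v" "nbw H q" "\<forall>r'. q \<noteq> v # u # r'"
      using nbw_after_crossing[OF less.prems(1-5)] by blast
    then have "length p \<le> length q"
      using less.prems by (intro less.hyps) auto
    then show ?thesis using * by simp
  qed
qed

text \<open>Every turn repeats the same forest walk from \<open>v\<close> to \<open>u\<close>. A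
  walk is therefore determined by its end and its number of turns, and its length fixes that
  number.\<close>

lemma nbw_after_crossing_unique:
  assumes "u \<noteq> v"
    and "nbw H r" "r \<noteq> []" "hd r = v" "\<And>r'. r \<noteq> v # u # r'"
    and "nbw H s" "s \<noteq> []" "hd s = v" "\<And>r'. s \<noteq> v # u # r'"
    and "last r = last s" "length r = length s"
  shows "r = s"
  using assms(2-)
proof (induction "length r" arbitrary: r s rule: less_induct)
  case less
  \<comment> \<open>The forest walk is no longer than what remains of the other walk after its first
    turn, so the two lengths cannot agree.\<close>
  have mixed: False if prm: "nbw (del_edge H u v) r" "\<not> nbw (del_edge H u v) s"
    "nbw H s" "r \<noteq> []" "s \<noteq> []" "hd r = v" "hd s = v" "\<And>r'. s \<noteq> v # u # r'" "last r = last s" "length r = length s" for r s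
  proof -
    obtain p' q where *: "s = p' @ q" "p' \<noteq> []" "q \<noteq> []" "hd q = v" "nbw H q" "\<forall>r'. q \<noteq> v # u # r'"
      using nbw_after_crossing[OF prm(3,5,7) assms(1) prm(8)] prm(2) by blast
    have "length r \<le> length q"
      using * that assms(1) by (intro nbw_after_crossing_length) auto
    then show False using * that by simp
  qed
  show ?case
  proof (cases "nbw (del_edge H u v) r")
    case True
    then have "nbw (del_edge H u v) s"
      using mixed[OF True _ less.prems(5,2,6,3,7,8,9,10)] by blast
    then show ?thesis using True less.prems by (intro del_edge_nbw_unique) auto
  next
    case False
    then have "\<not> nbw (del_edge H u v) s"
      using mixed[OF _ False less.prems(1,6,2,7,3,4) less.prems(9,10)[symmetric]] by blast
    then obtain p' q' where s: "s = p' @ q'" "p' \<noteq> []" "q' \<noteq> []" "nbw (del_edge H u v) p'" "last p' = u" "hd p' = v" "hd q' = v" "nbw H q'" "\<forall>r'. q' \<noteq> v # u # r'"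
      using nbw_after_crossing[OF less.prems(5-7) assms(1) less.prems(8)] by blast
    obtain p q where r: "r = p @ q" "p \<noteq> []" "q \<noteq> []" "nbw (del_edge H u v) p" "last p = u" "hd p = v" "hd q = v" "nbw H q" "\<forall>r'. q \<noteq> v # u # r'"
      using nbw_after_crossing[OF less.prems(1-3) assms(1) less.prems(4)] False by blast
    have p: "p = p'" using r s by (intro del_edge_nbw_unique) auto
    have "q = q'"
      using r s less.prems p by (intro less.hyps) auto
    then show ?thesis using p r s by simp
  qed
qed

text \<open>Up to the first crossing the walk is the forest walk to \<open>u\<close>. Behind it the
  previous uniqueness applies, because a walk that has just gone from \<open>u\<close> to
  \<open>v\<close> cannot return to \<open>u\<close> at once.\<close>

lemma nbw_crossing_unique:
  assumes "u \<noteq> v"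
    and "nbw H (p @ q)" "nbw (del_edge H u v) p" "p \<noteq> []" "q \<noteq> []" "last p = u" "hd q = v"
    and "nbw H (p' @ q')" "nbw (del_edge H u v) p'" "p' \<noteq> []" "q' \<noteq> []" "last p' = u" "hd q' = v"
    and "hd p = hd p'" "last q = last q'" "length (p @ q) = length (p' @ q')"
  shows "p @ q = p' @ q'"
proof -
  have p: "p = p'" using assms by (intro del_edge_nbw_unique) auto
  have nb: "q \<noteq> v # u # r'" if "nbw H (p @ q)" "p \<noteq> []" "last p = u" for p q r'
  proof
    assume q: "q = v # u # r'"
    have "p = butlast p @ [u]" using that by (metis append_butlast_last_id)
    then have "nbw H (butlast p @ [u] @ v # u # r')" using that(1) q by (metis append_assoc)
    then have "nbw H (u # v # u # r')" using nbw_appendD2 by fastforce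
    then show False by simp
  qed
  have "nbw H q" "nbw H q'" using assms(2,8) nbw_appendD2 by blast+
  then have "q = q'"
    using assms p nb by (intro nbw_after_crossing_unique) auto
  then show ?thesis using p by simp
qed

end

lemma card_le_1I: "finite A \<Longrightarrow> (\<And>x y. x \<in> A \<Longrightarrow> y \<in> A \<Longrightarrow> x = y) \<Longrightarrow> card A \<le> 1"
  by (simp add: card_le_Suc0_iff_eq)

lemma finite_lists_length: "finite {r :: 'a::finite list. P r \<and> length r = n}"
  by (rule finite_subset[OF _ finite_lists_length_eq[of UNIV n]]) auto

text \<open>Fix an edge of the cycle. A walk avoids it, or first crosses it in one direction, or
  first crosses it in the other; each of the three classes has at most one walk of the given length
  and ends.\<close>

lemma card_nbw_unicyclic:
  fixes H :: "'a::finite \<Rightarrow> 'a \<Rightarrow> bool"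
  assumes sym: "\<And>x y. H x y \<Longrightarrow> H y x" and irr: "\<And>x. \<not> H x x"
    and one: "\<And>C C'. is_cycle H C \<Longrightarrow> is_cycle H C' \<Longrightarrow> C = C'"
  shows "card {r. (nbw H r \<and> hd r = x \<and> last r = y) \<and> length r = Suc L} \<le> 3"
proof (cases "\<exists>C. is_cycle H C")
  case False
  have "card {r. (nbw H r \<and> hd r = x \<and> last r = y) \<and> length r = Suc L} \<le> 1"
  proof (rule card_le_1I[OF finite_lists_length])
    fix r s assume "r \<in> {r. (nbw H r \<and> hd r = x \<and> last r = y) \<and> length r = Suc L}"
      "s \<in> {r. (nbw H r \<and> hd r = x \<and> last r = y) \<and> length r = Suc L}"
    then show "r = s" using False acyclic_nbw_unique[of H r s] sym irr by force
  qed
  then show ?thesis by simp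
next
  case True
  then obtain C where C: "is_cycle H C" by blast
  then have "C \<noteq> {}" by (simp add: is_cycle_def)
  then obtain u v where uv: "{u, v} \<in> C" "H u v"
    using is_cycle_edges[OF C] by (metis ex_in_conv)
  have ne: "u \<noteq> v" using uv irr by auto
  have sub: "is_cycle H C' \<and> {u, v} \<notin> C'" if "is_cycle (del_edge H u v) C'" for C'
  proof -
    have C': "\<exists>x y. e = {x, y} \<and> H x y \<and> {x, y} \<noteq> {u, v}" if "e \<in> C'" for e
      using is_cycle_edges[OF \<open>is_cycle (del_edge H u v) C'\<close> that] by (simp add: del_edge_def)
    have "is_cycle H C'"
      using that by (rule is_cycle_transfer) (use C' in blast)
    then show ?thesis using C' by blast
  qed
  \<comment> \<open>A cycle left after the removal would be a second cycle of \<open>H\<close>,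
    since it misses the edge.\<close>
  have acyc: "\<not> is_cycle (del_edge H u v) C'" for C'
    using sub[of C'] one[OF C, of C'] uv(1) by blast
  have acyc': "\<not> is_cycle (del_edge H v u) C'" for C'
  proof -
    have "del_edge H u v = del_edge H v u"
      by (intro ext) (simp add: del_edge_def insert_commute)
    then show ?thesis using acyc[of C'] by simp
  qed
  let ?A = "{r. (nbw H r \<and> hd r = x \<and> last r = y) \<and> length r = Suc L}"
  define A0 where "A0 = {r. (r \<in> ?A \<and> nbw (del_edge H u v) r) \<and> length r = Suc L}"
  define Ac where "Ac u v = {r. (r \<in> ?A \<and> (\<exists>p q. r = p @ q \<and> p \<noteq> [] \<and> q \<noteq> [] \<and> nbw (del_edge H u v) p \<and> last p = u \<and> hd q = v)) \<and> length r = Suc L}" for u v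
  have c0: "card A0 \<le> 1"
    unfolding A0_def
  proof (rule card_le_1I[OF finite_lists_length])
    fix r s assume "r \<in> {r. (r \<in> ?A \<and> nbw (del_edge H u v) r) \<and> length r = Suc L}"
      "s \<in> {r. (r \<in> ?A \<and> nbw (del_edge H u v) r) \<and> length r = Suc L}"
    then show "r = s" using sym irr acyc by (intro del_edge_nbw_unique[of H u v]) auto
  qed
  have c1: "card (Ac u v) \<le> 1" if acyc: "\<And>C'. \<not> is_cycle (del_edge H u v) C'" and ne: "u \<noteq> v" for u v
    unfolding Ac_def
  proof (rule card_le_1I[OF finite_lists_length])
    let ?B = "{r. (r \<in> ?A \<and> (\<exists>p q. r = p @ q \<and> p \<noteq> [] \<and> q \<noteq> [] \<and> nbw (del_edge H u v) p \<and> last p = u \<and> hd q = v)) \<and> length r = Suc L}"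
    fix r s assume rs: "r \<in> ?B" "s \<in> ?B"
    then obtain p q p' q' where *: "r = p @ q" "p \<noteq> []" "q \<noteq> []" "nbw (del_edge H u v) p" "last p = u" "hd q = v"
      "s = p' @ q'" "p' \<noteq> []" "q' \<noteq> []" "nbw (del_edge H u v) p'" "last p' = u" "hd q' = v"
      by blast
    have "p @ q = p' @ q'"
      by (rule nbw_crossing_unique[OF sym irr acyc ne]) (use * rs in auto)
    then show "r = s" using * by simp
  qed
  have "?A \<subseteq> A0 \<union> (Ac u v \<union> Ac v u)"
  proof
    fix r assume r: "r \<in> ?A"
    have eq: "del_edge H u v = del_edge H v u"
      by (intro ext) (simp add: del_edge_def insert_commute)
    have "r \<noteq> []" using r by auto
    then have "nbw (del_edge H u v) r \<or>
      (\<exists>p q. r = p @ q \<and> p \<noteq> [] \<and> q \<noteq> [] \<and> nbw (del_edge H u v) p \<and> {last p, hd q} = {u, v})"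
      using nbw_split_at_edge[of H r u v] r by blast
    then show "r \<in> A0 \<union> (Ac u v \<union> Ac v u)"
    proof (elim disjE exE)
      assume "nbw (del_edge H u v) r"
      then show ?thesis using r unfolding A0_def by blast
    next
      fix p q assume pq: "r = p @ q \<and> p \<noteq> [] \<and> q \<noteq> [] \<and> nbw (del_edge H u v) p \<and> {last p, hd q} = {u, v}"
      then consider "last p = u" "hd q = v" | "last p = v" "hd q = u"
        by (metis doubleton_eq_iff)
      then show ?thesis
      proof cases
        case 1
        then have "r \<in> Ac u v" using r pq unfolding Ac_def by blast
        then show ?thesis by blast
      next
        case 2
        then have "r \<in> Ac v u" using r pq unfolding Ac_def eq by blast
        then show ?thesis by blast
      qed
    qed
  qed
  moreover have "finite A0" "finite (Ac u v)" "finite (Ac v u)"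
    unfolding A0_def Ac_def by (rule finite_lists_length)+
  ultimately have "card ?A \<le> card (A0 \<union> (Ac u v \<union> Ac v u))"
    by (intro card_mono) auto
  also have "\<dots> \<le> card A0 + (card (Ac u v) + card (Ac v u))"
    by (meson add_left_mono card_Un_le order_trans)
  also have "\<dots> \<le> 3" using c0 c1[OF acyc ne] c1[OF acyc' ne[symmetric]] by linarith
  finally show ?thesis .
qed

section \<open>Counting walks within the radius \<open>ellG\<close>\<close>

lemma nbw_in_ball:
  assumes "nbw E r" "i < length r"
  shows "(E ^^ i) (hd r) (r ! i)"
  using assms(2)
proof (induction i)
  case 0
  then show ?case by (cases r) auto
next
  case (Suc i)
  then have "E (r ! i) (r ! Suc i)" using assms(1) unfolding nbw_iff_nth by blast
  then show ?case using Suc by auto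
qed

definition few_cycles :: "('a \<Rightarrow> 'a \<Rightarrow> bool) \<Rightarrow> nat \<Rightarrow> bool" where
  "few_cycles E l \<longleftrightarrow> (\<forall>x. card {C. C \<subseteq> edges_in E (ball_G E x l) \<and> is_cycle E C} \<le> 1)"

text \<open>A walk with \<open>L\<close> edges stays in the ball of radius \<open>l\<close> about
  its start, and the graph induced on that ball has at most one cycle.\<close>

lemma card_nbw_few_cycles:
  fixes E :: "'a::finite \<Rightarrow> 'a \<Rightarrow> bool"
  assumes sym: "\<And>x y. E x y \<Longrightarrow> E y x" and irr: "\<And>x. \<not> E x x"
    and few: "few_cycles E l" and L: "L \<le> l"
  shows "card {r. (nbw E r \<and> hd r = x \<and> last r = y) \<and> length r = Suc L} \<le> 3"
proof -
  define B where "B = ball_G E x l"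
  define H where "H a b \<longleftrightarrow> E a b \<and> a \<in> B \<and> b \<in> B" for a b
  have cyc: "C \<subseteq> edges_in E B \<and> is_cycle E C" if "is_cycle H C" for C
  proof -
    have C: "\<exists>x y. e = {x, y} \<and> E x y \<and> x \<in> B \<and> y \<in> B" if "e \<in> C" for e
      using is_cycle_edges[OF \<open>is_cycle H C\<close> that] by (simp add: H_def)
    have "C \<subseteq> edges_in E B"
      using C unfolding edges_in_def by blast
    moreover have "is_cycle E C"
      using that by (rule is_cycle_transfer) (use C in blast)
    ultimately show ?thesis by blast
  qed
  have one: "C = C'" if "is_cycle H C" "is_cycle H C'" for C C'
  proof -
    have "card {C. C \<subseteq> edges_in E B \<and> is_cycle E C} \<le> Suc 0"
      using few unfolding few_cycles_def B_def by simp
    then show ?thesis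
      using card_le_Suc0_iff_eq[of "{C. C \<subseteq> edges_in E B \<and> is_cycle E C}"] cyc that by auto
  qed
  have "{r. (nbw E r \<and> hd r = x \<and> last r = y) \<and> length r = Suc L} \<subseteq>
    {r. (nbw H r \<and> hd r = x \<and> last r = y) \<and> length r = Suc L}"
  proof safe
    fix r assume r: "nbw E r" "length r = Suc L" "x = hd r" "y = last r"
    have "r ! i \<in> B" if "i < length r" for i
      using nbw_in_ball[OF r(1) that] that L r unfolding B_def ball_G_def
      by (intro CollectI exI[of _ i]) auto
    then show "nbw H r" using r(1) unfolding nbw_iff_nth H_def by auto
  qed
  then have "card {r. (nbw E r \<and> hd r = x \<and> last r = y) \<and> length r = Suc L} \<le>
    card {r. (nbw H r \<and> hd r = x \<and> last r = y) \<and> length r = Suc L}"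
    by (rule card_mono[OF finite_lists_length])
  also have "\<dots> \<le> 3"
    by (rule card_nbw_unicyclic) (use sym irr one in \<open>auto simp: H_def\<close>)
  finally show ?thesis .
qed

text \<open>The walks with \<open>k + 2\<close> vertices, that is, \<open>k\<close> steps on oriented edges.\<close>

definition walks :: "('a \<Rightarrow> 'a \<Rightarrow> bool) \<Rightarrow> nat \<Rightarrow> 'a \<Rightarrow> 'a \<Rightarrow> 'a list set" where
  "walks E k x y = {r. (nbw E r \<and> hd r = x \<and> r ! 1 = y) \<and> length r = k + 2}"

lemma finite_walks: "finite (walks E k x (y::'a::finite))"
  unfolding walks_def by (rule finite_lists_length)

lemma walks_0: "E x y \<Longrightarrow> walks E 0 x y = {[x, y]}"
  unfolding walks_def by (auto simp: length_Suc_conv numeral_2_eq_2)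

lemma walks_form: "r \<in> walks E k x y \<Longrightarrow> \<exists>q. r = x # y # q \<and> length q = k"
  unfolding walks_def by (auto simp: length_Suc_conv numeral_2_eq_2)

lemma walks_adj: "r \<in> walks E k x y \<Longrightarrow> E x y"
  using walks_form[of r E k x y] nbw_Cons_adj unfolding walks_def by auto

lemma walks_Suc:
  assumes "E x y"
  shows "walks E (Suc k) x y = (\<Union>z\<in>{z. E y z \<and> z \<noteq> x}. (#) x ` walks E k y z)"
proof (intro equalityI subsetI)
  fix r assume r: "r \<in> walks E (Suc k) x y"
  then obtain z q where q: "r = x # y # z # q" "length q = k"
    using walks_form[OF r] by (auto simp: length_Suc_conv)
  have "nbw E (y # z # q)" "x \<noteq> z" using r q unfolding walks_def by auto
  then have "y # z # q \<in> walks E k y z" "E y z" "z \<noteq> x"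
    using q nbw_Cons_adj[of E y z q] unfolding walks_def by auto
  then show "r \<in> (\<Union>z\<in>{z. E y z \<and> z \<noteq> x}. (#) x ` walks E k y z)" using q by blast
next
  fix r assume "r \<in> (\<Union>z\<in>{z. E y z \<and> z \<noteq> x}. (#) x ` walks E k y z)"
  then obtain z r' where z: "E y z" "z \<noteq> x" "r = x # r'" "r' \<in> walks E k y z" by blast
  then obtain q where "r' = y # z # q" using walks_form by metis
  then show "r \<in> walks E (Suc k) x y" using z assms unfolding walks_def by auto
qed

lemma sum_walks_Suc:
  fixes x :: "'a::finite"
  assumes "E x y"
  shows "(\<Sum>r\<in>walks E (Suc k) x y. g r) = (\<Sum>z\<in>{z. E y z \<and> z \<noteq> x}. \<Sum>r\<in>walks E k y z. g (x # r))"
proof -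
  have "(\<Sum>r\<in>walks E (Suc k) x y. g r) = (\<Sum>z\<in>{z. E y z \<and> z \<noteq> x}. \<Sum>r\<in>(#) x ` walks E k y z. g r)"
    unfolding walks_Suc[of E, OF assms]
  proof (rule sum.UNION_disjoint)
    show "\<forall>i\<in>{z. E y z \<and> z \<noteq> x}. \<forall>j\<in>{z. E y z \<and> z \<noteq> x}. i \<noteq> j \<longrightarrow>
      (#) x ` walks E k y i \<inter> (#) x ` walks E k y j = {}"
      by (auto simp: walks_def)
  qed (auto simp: finite_walks)
  also have "\<dots> = (\<Sum>z\<in>{z. E y z \<and> z \<noteq> x}. \<Sum>r\<in>walks E k y z. g (x # r))"
    by (simp add: sum.reindex)
  finally show ?thesis .
qed

lemma card_other_neighbours:
  fixes x :: "'a::finite"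
  assumes "\<And>x. deg E x \<ge> 3"
  shows "card {z. E y z \<and> z \<noteq> x} \<ge> 2"
proof -
  have "{z. E y z \<and> z \<noteq> x} = {z. E y z} - {x}" by auto
  then have "card {z. E y z} - 1 \<le> card {z. E y z \<and> z \<noteq> x}"
    by (metis card_Diff1_le diff_card_le_card_Diff card.empty card_insert_if finite.emptyI finite.insertI One_nat_def empty_iff)
  then show ?thesis using assms[of y] unfolding deg_def by linarith
qed

lemma card_walks_ge:
  fixes x :: "'a::finite"
  assumes deg: "\<And>x. deg E x \<ge> 3"
  shows "E x y \<Longrightarrow> card (walks E k x y) \<ge> 2 ^ k"
proof (induction k arbitrary: x y)
  case 0
  then show ?case by (simp add: walks_0)
next
  case (Suc k)
  have "2 ^ Suc k \<le> card {z. E y z \<and> z \<noteq> x} * 2 ^ k"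
    using card_other_neighbours[OF deg, of y x] by simp
  also have "\<dots> = (\<Sum>z\<in>{z. E y z \<and> z \<noteq> x}. 2 ^ k)" by simp
  also have "\<dots> \<le> (\<Sum>z\<in>{z. E y z \<and> z \<noteq> x}. card (walks E k y z))"
    using Suc.IH by (intro sum_mono) auto
  also have "\<dots> = card (walks E (Suc k) x y)"
    using sum_walks_Suc[of E, OF Suc.prems, where k=k and g="\<lambda>_. 1::nat"] by simp
  finally show ?case .
qed

text \<open>\<open>GREATEST\<close> in \<open>ellG\<close> yields a value with the property only if
  the property is bounded. Minimal degree three makes the number of walks from an edge grow
  exponentially, while at most three of a given length reach each vertex.\<close>

lemma few_cycles_bounded:
  fixes E :: "'a::finite \<Rightarrow> 'a \<Rightarrow> bool"
  assumes sym: "\<And>x y. E x y \<Longrightarrow> E y x" and irr: "\<And>x. \<not> E x x"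
    and deg: "\<And>x. deg E x \<ge> 3" and few: "few_cycles E l"
  shows "l \<le> 3 * CARD('a)"
proof (rule ccontr)
  assume l: "\<not> l \<le> 3 * CARD('a)"
  \<comment> \<open>Three walks for each end vertex make a total of at most \<open>k\<close>, which
    is below \<open>2 ^ k\<close>.\<close>
  define k where "k = 3 * CARD('a)"
  have kl: "Suc k \<le> l" using l by (simp add: k_def)
  fix x :: 'a
  have "{y. E x y} \<noteq> {}" using deg[of x] unfolding deg_def by (metis card.empty not_numeral_le_zero)
  then obtain y where y: "E x y" by blast
  have "2 ^ k \<le> card (walks E k x y)" by (rule card_walks_ge[OF deg y])
  also have "\<dots> \<le> card (\<Union>z\<in>UNIV. {r. (nbw E r \<and> hd r = x \<and> last r = z) \<and> length r = Suc (Suc k)})"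
  proof (rule card_mono)
    show "finite (\<Union>z\<in>UNIV. {r. (nbw E r \<and> hd r = x \<and> last r = z) \<and> length r = Suc (Suc k)})"
      by (intro finite_UN_I finite_lists_length) auto
  qed (auto simp: walks_def)
  also have "\<dots> \<le> (\<Sum>z\<in>UNIV. card {r. (nbw E r \<and> hd r = x \<and> last r = z) \<and> length r = Suc (Suc k)})"
    by (rule card_UN_le) auto
  also have "\<dots> \<le> (\<Sum>z\<in>(UNIV::'a set). 3)"
    using card_nbw_few_cycles[OF sym irr few kl] by (intro sum_mono)
  also have "\<dots> = k" by (simp add: k_def)
  finally show False using less_exp[of k] by simp
qed

lemma few_cycles_ellG:
  fixes E :: "'a::finite \<Rightarrow> 'a \<Rightarrow> bool"
  assumes sym: "\<And>x y. E x y \<Longrightarrow> E y x" and irr: "\<And>x. \<not> E x x"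
    and deg: "\<And>x. deg E x \<ge> 3"
  shows "few_cycles E (ellG E)"
proof -
  have "{C. C \<subseteq> edges_in E (ball_G E x 0) \<and> is_cycle E C} = {}" for x
  proof -
    have "edges_in E (ball_G E x 0) = {}"
      using irr by (auto simp: edges_in_def ball_G_def)
    then show ?thesis by (auto simp: is_cycle_def)
  qed
  then have "few_cycles E 0" unfolding few_cycles_def by (metis card.empty zero_le)
  then have "few_cycles E (GREATEST l. few_cycles E l)"
    using few_cycles_bounded[OF sym irr deg] by (rule GreatestI_nat)
  then show ?thesis unfolding ellG_def few_cycles_def .
qed

subsection \<open>Green functions on the universal cover\<close>

fun pw :: "('a \<Rightarrow> 'a \<Rightarrow> 'b::comm_monoid_mult) \<Rightarrow> 'a list \<Rightarrow> 'b" where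
  "pw c [] = 1"
| "pw c [x] = 1"
| "pw c (x # y # r) = c x y * pw c (y # r)"

lemma pw_snoc: "u \<noteq> [] \<Longrightarrow> pw c (u @ [z]) = pw c u * c (last u) z"
  by (induction c u rule: pw.induct) (auto simp: mult.assoc)

lemma nb_walk_iff: "nb_walk E p \<longleftrightarrow> p \<noteq> [] \<and> hd p = (SOME b. True) \<and> nbw E p"
  unfolding nb_walk_def nbw_iff_nth by blast

section \<open>Neighbours in the universal cover\<close>

definition cover_step :: "'a list \<Rightarrow> 'a \<Rightarrow> 'a list" where
  "cover_step u z = (if length u \<ge> 2 \<and> last (butlast u) = z then butlast u else u @ [z])"

lemma last_cover_step: "last (cover_step u z) = z"
  by (auto simp: cover_step_def)

lemma nbw_snoc:
  "nbw E (u @ [x, y]) \<longleftrightarrow> nbw E (u @ [x]) \<and> E x y \<and> (u \<noteq> [] \<longrightarrow> last u \<noteq> y)"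
proof (induction u rule: induct_list012)
  case (3 a b u)
  then show ?case by (cases u) auto
qed auto

lemma nb_walk_cases:
  assumes "nb_walk E u"
  obtains "u = [SOME b. True]" | v x y where "u = v @ [x, y]"
proof (cases u rule: rev_cases)
  case Nil
  then show ?thesis using assms by (simp add: nb_walk_iff)
next
  case (snoc v y)
  then show ?thesis using that assms by (cases v rule: rev_cases) (auto simp: nb_walk_iff)
qed

lemma cover_adj_sym: "cover_adj E p q \<Longrightarrow> cover_adj E q p"
  unfolding cover_adj_def by blast

lemma cover_adj_step:
  assumes sym: "\<And>x y. E x y \<Longrightarrow> E y x" and u: "nb_walk E u" and z: "E (last u) z"
  shows "cover_adj E u (cover_step u z)"
  using u
proof (cases rule: nb_walk_cases)
  case 1
  then show ?thesis using u z by (auto simp: cover_adj_def cover_step_def nb_walk_iff)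
next
  case (2 v x y)
  have u': "nbw E (v @ [x, y])" "hd (v @ [x, y]) = (SOME b. True)" using u 2 by (auto simp: nb_walk_iff)
  show ?thesis
  proof (cases "x = z")
    case True
    then have "cover_step u z = v @ [x]" using 2 by (simp add: cover_step_def butlast_append)
    moreover have "nbw E (v @ [x])" using u'(1) by (simp add: nbw_snoc)
    then have "nb_walk E (v @ [x])"
      using u'(2) unfolding nb_walk_iff by (cases v) auto
    ultimately show ?thesis using u 2 unfolding cover_adj_def by auto
  next
    case False
    then have c: "cover_step u z = u @ [z]" using 2 by (simp add: cover_step_def butlast_append)
    have "nbw E ((v @ [x]) @ [y, z])"
      using iffD2[OF nbw_snoc[of E "v @ [x]" y z]] u' z 2 False by simp
    then have "nb_walk E (u @ [z])" using u' 2 by (cases v) (auto simp: nb_walk_iff)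
    then show ?thesis using u c unfolding cover_adj_def by auto
  qed
qed

lemma cover_adj_imp_step:
  assumes sym: "\<And>x y. E x y \<Longrightarrow> E y x" and uc: "cover_adj E u c"
  shows "E (last u) (last c) \<and> c = cover_step u (last c)"
proof -
  have nb: "nb_walk E u" "nb_walk E c" using uc unfolding cover_adj_def by auto
  consider y where "c = u @ [y]" | y where "u = c @ [y]" using uc unfolding cover_adj_def by blast
  then show ?thesis
  proof cases
    case (1 y)
    obtain v x where u: "u = v @ [x]" using nb(1) by (cases u rule: rev_cases) (auto simp: nb_walk_iff)
    have "nbw E (v @ [x, y])" using nb(2) 1 u by (simp add: nb_walk_iff)
    then have "E x y" "v \<noteq> [] \<longrightarrow> last v \<noteq> y" by (simp_all add: nbw_snoc)
    then show ?thesis using 1 u by (cases v rule: rev_cases) (auto simp: cover_step_def butlast_append)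
  next
    case (2 y)
    obtain v x where c: "c = v @ [x]" using nb(2) by (cases c rule: rev_cases) (auto simp: nb_walk_iff)
    have "nbw E (v @ [x, y])" using nb(1) 2 c by (simp add: nb_walk_iff)
    then have "E y x" using sym by (simp add: nbw_snoc)
    then show ?thesis using 2 c by (simp add: cover_step_def butlast_append)
  qed
qed

text \<open>Cover vertices are reduced walks: a step to the last but one vertex cancels the last
  letter, any other step appends one. Thus \<open>last\<close> matches neighbours in the cover with
  neighbours in the graph.\<close>

lemma cover_nbrs:
  assumes sym: "\<And>x y. E x y \<Longrightarrow> E y x" and u: "nb_walk E u"
  shows "{c. cover_adj E u c} = cover_step u ` {z. E (last u) z}"
proof (intro equalityI subsetI)
  fix c assume "c \<in> {c. cover_adj E u c}"
  then have "E (last u) (last c) \<and> c = cover_step u (last c)"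
    using cover_adj_imp_step[of E u c] sym by blast
  then show "c \<in> cover_step u ` {z. E (last u) z}" by blast
next
  fix c assume "c \<in> cover_step u ` {z. E (last u) z}"
  then show "c \<in> {c. cover_adj E u c}" using cover_adj_step[of E u] sym u by blast
qed

lemma inj_cover_step: "inj_on (cover_step u) A"
  by (metis inj_onI last_cover_step)

text \<open>Product of \<open>Z\<close> along the geodesic from \<open>a\<close> to
  \<open>u\<close>, for walks with the same first vertex. The common prefix is stripped; the
  geodesic climbs from the end of \<open>a\<close> to the branching vertex, hence the swapped weight
  \<open>Z t s\<close>, and then descends to the end of \<open>u\<close>. A step from
  \<open>s\<close> to \<open>t\<close> in the direction of travel has weight
  \<open>Z s t\<close>.\<close>

fun tree_path_weight :: "('a \<Rightarrow> 'a \<Rightarrow> complex) \<Rightarrow> 'a list \<Rightarrow> 'a list \<Rightarrow> complex" where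
  "tree_path_weight Z [] u = 1"
| "tree_path_weight Z [x] u = pw Z u"
| "tree_path_weight Z (x # y # a) [] = 1"
| "tree_path_weight Z (x # y # a) [w] = pw (\<lambda>s t. Z t s) (x # y # a)"
| "tree_path_weight Z (x # y # a) (w # z # u) =
     (if z = y then tree_path_weight Z (y # a) (z # u) else pw (\<lambda>s t. Z t s) (x # y # a) * pw Z (w # z # u))"

abbreviation "tpw \<equiv> tree_path_weight"

lemma tpw_self: "tpw Z a a = 1"
  by (induction a rule: induct_list012) auto

lemma tpw_single: "tpw Z (y # a) [y] = pw (\<lambda>s t. Z t s) (y # a)"
  by (cases a) auto

text \<open>A letter that does not follow \<open>a\<close> leads away from the end of
  \<open>a\<close> and extends the geodesic. The companion lemma for prefixes of \<open>a\<close>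
  treats the letters that lead towards it and shorten the geodesic.\<close>

lemma tpw_snoc:
  "u \<noteq> [] \<Longrightarrow> a \<noteq> [] \<Longrightarrow> hd u = hd a \<Longrightarrow> \<not> prefix (u @ [z]) a \<Longrightarrow> tpw Z a (u @ [z]) = tpw Z a u * Z (last u) z"
  by (induction Z a u rule: tree_path_weight.induct)
    (auto simp: pw_snoc pw_snoc[of "_ # _", simplified] mult.assoc)

lemma tpw_snoc_prefix:
  "u \<noteq> [] \<Longrightarrow> prefix (u @ [z]) a \<Longrightarrow> tpw Z a u = tpw Z a (u @ [z]) * Z z (last u)"
proof (induction Z a u rule: tree_path_weight.induct)
  case (2 Z x u)
  then show ?case by (cases u) auto
qed (auto simp: tpw_single mult.commute)

lemma tpw_step_base:
  assumes "nb_walk E a"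
  shows "tpw Z a (cover_step a z) = Z (last a) z"
  using assms
proof (cases rule: nb_walk_cases)
  case 1
  then show ?thesis by (simp add: cover_step_def)
next
  case (2 v x y)
  show ?thesis
  proof (cases "x = z")
    case True
    then show ?thesis
      using tpw_snoc_prefix[of "v @ [x]" y a Z] 2 tpw_self[of Z a] by (simp add: cover_step_def butlast_append)
  next
    case False
    then show ?thesis
      using tpw_snoc[of a a z Z] 2 tpw_self[of Z a] by (simp add: cover_step_def butlast_append)
  qed
qed

text \<open>In a tree every \<open>u\<close> other than \<open>a\<close> has exactly one neighbour
  nearer to \<open>a\<close>. It lies over the next letter of \<open>a\<close> if \<open>u\<close>
  is a prefix of \<open>a\<close>, and over the last but one letter of \<open>u\<close>
  otherwise.\<close>

lemma tpw_step:
  assumes sym: "\<And>x y. E x y \<Longrightarrow> E y x"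
    and a: "nb_walk E a" and u: "nb_walk E u" and ne: "u \<noteq> a"
  shows "\<exists>p. E (last u) p \<and> tpw Z a u = tpw Z a (cover_step u p) * Z p (last u) \<and>
    (\<forall>z. z \<noteq> p \<longrightarrow> tpw Z a (cover_step u z) = tpw Z a u * Z (last u) z)"
proof -
  have nu: "u \<noteq> []" "a \<noteq> []" "hd u = hd a" using a u by (auto simp: nb_walk_iff)
  have eq_last: "last (butlast u) = x \<and> butlast u = v @ [x]" if "u = v @ [x, y]" for v x y
    using that by (simp add: butlast_append)
  show ?thesis
  proof (cases "prefix u a")
    case True
    then obtain p q where pq: "a = u @ p # q" using ne by (metis append_Nil2 neq_Nil_conv prefix_def)
    have uv: "u = butlast u @ [last u]" using nu by simp
    have "nbw E ((butlast u @ [last u, p]) @ q)" using a pq uv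
      by (metis append_Cons append_Nil append_assoc nb_walk_iff)
    then have nb: "nbw E (butlast u @ [last u, p])" using nbw_appendD1 by blast
    have adj: "E (last u) p" and nbt: "butlast u \<noteq> [] \<longrightarrow> last (butlast u) \<noteq> p" using nb by (auto simp: nbw_snoc)
    have step: "cover_step u p = u @ [p]"
    proof (cases "length u \<ge> 2")
      case True
      then have "butlast u \<noteq> []" by (cases u rule: rev_cases) auto
      then show ?thesis using nbt by (simp add: cover_step_def)
    qed (simp add: cover_step_def)
    have 1: "tpw Z a u = tpw Z a (cover_step u p) * Z p (last u)"
      unfolding step using nu pq by (intro tpw_snoc_prefix) (auto simp: prefix_def)
    have 2: "tpw Z a (cover_step u z) = tpw Z a u * Z (last u) z" if z: "z \<noteq> p" for z
    proof (cases "length u \<ge> 2 \<and> last (butlast u) = z")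
      case True
      then have cs: "cover_step u z = butlast u" by (simp add: cover_step_def)
      have ne: "butlast u \<noteq> []" using True by (cases u rule: rev_cases) auto
      have "tpw Z a (butlast u) = tpw Z a (butlast u @ [last u]) * Z (last u) (last (butlast u))"
        using ne \<open>prefix u a\<close> nu by (intro tpw_snoc_prefix) auto
      then show ?thesis using cs True nu by simp
    next
      case False
      then have cs: "cover_step u z = u @ [z]" by (auto simp: cover_step_def)
      show ?thesis unfolding cs using nu z pq by (intro tpw_snoc) (auto simp: prefix_def)
    qed
    show ?thesis using adj 1 2 by blast
  next
    case False
    have "u \<noteq> [SOME b. True]"
      using False a by (cases a) (auto simp: nb_walk_iff)
    with u obtain v x y where uv: "u = v @ [x, y]" by (cases rule: nb_walk_cases) auto
    have "E x y" using u uv by (simp add: nb_walk_iff nbw_snoc)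
    then have adj: "E (last u) x" using sym uv by simp
    have cs: "cover_step u x = v @ [x]" using uv by (simp add: cover_step_def butlast_append)
    have "hd (v @ [x]) = hd a" using nu(3) uv by (cases v) auto
    then have 1: "tpw Z a u = tpw Z a (cover_step u x) * Z x (last u)"
      using tpw_snoc[of "v @ [x]" a y Z] False nu uv unfolding cs by simp
    have 2: "tpw Z a (cover_step u z) = tpw Z a u * Z (last u) z" if "z \<noteq> x" for z
    proof -
      have "cover_step u z = u @ [z]" using that uv by (simp add: cover_step_def butlast_append)
      moreover have "\<not> prefix (u @ [z]) a" using False by (meson append_prefixD)
      ultimately show ?thesis using tpw_snoc[of u a z Z] nu by simp
    qed
    show ?thesis using adj 1 2 by blast
  qed
qed

section \<open>Branches of the cover and the resolvent equation on them\<close>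

lemma branch_nb_walk: "u \<in> branch E a b \<Longrightarrow> nb_walk E a \<Longrightarrow> nb_walk E u"
proof -
  assume "u \<in> branch E a b" and a: "nb_walk E a"
  then have "(\<lambda>x c. cover_adj E x c \<and> {x, c} \<noteq> {a, b})\<^sup>*\<^sup>* a u" by (simp add: branch_def)
  then show ?thesis by (induction rule: rtranclp_induct) (auto simp: a cover_adj_def)
qed

text \<open>The prefix order separates the two sides. If \<open>b\<close> extends \<open>a\<close>,
  no vertex reached without the edge has \<open>b\<close> as a prefix; if \<open>a\<close> extends
  \<open>b\<close>, all of them have \<open>a\<close> as a prefix.\<close>

lemma branch_not_other_end:
  assumes ab: "cover_adj E a b"
  shows "b \<notin> branch E a b"
proof
  assume "b \<in> branch E a b"
  then have r: "(\<lambda>x c. cover_adj E x c \<and> {x, c} \<noteq> {a, b})\<^sup>*\<^sup>* a b" by (simp add: branch_def)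
  consider y where "b = a @ [y]" | y where "a = b @ [y]" using ab unfolding cover_adj_def by blast
  then show False
  proof cases
    case (1 y)
    have "\<not> prefix b u" if "(\<lambda>x c. cover_adj E x c \<and> {x, c} \<noteq> {a, b})\<^sup>*\<^sup>* a u" for u
      using that
    proof (induction rule: rtranclp_induct)
      case base
      then show ?case using 1 by (auto dest: prefix_length_le)
    next
      case (step u c)
      show ?case
      proof
        assume bc: "prefix b c"
        consider z where "c = u @ [z]" | z where "u = c @ [z]" using step(2) unfolding cover_adj_def by blast
        then show False
        proof cases
          case (1 z)
          then have "b = c" using bc step.IH by auto
          then show False using 1 \<open>b = a @ [y]\<close> step(2) by auto
        next
          case (2 z)
          then show False using bc step.IH by (auto intro: prefix_order.trans)
        qed
      qed
    qed
    then show False using r by blast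
  next
    case (2 y)
    have "prefix a u" if "(\<lambda>x c. cover_adj E x c \<and> {x, c} \<noteq> {a, b})\<^sup>*\<^sup>* a u" for u
      using that
    proof (induction rule: rtranclp_induct)
      case (step u c)
      consider z where "c = u @ [z]" | z where "u = c @ [z]" using step(2) unfolding cover_adj_def by blast
      then show ?case
      proof cases
        case (1 z)
        then show ?thesis using step.IH by (auto intro: prefix_order.trans)
      next
        case (2 z)
        show ?thesis
        proof (rule ccontr)
          assume "\<not> prefix a c"
          then have "a = u" using 2 step.IH by auto
          then show False using 2 \<open>a = b @ [y]\<close> step(2) by auto
        qed
      qed
    qed auto
    then have "prefix a b" using r by blast
    then show False using 2 by (auto dest: prefix_length_le)
  qed
qed

lemma branch_nbrs:
  assumes ab: "cover_adj E a b" and u: "u \<in> branch E a b"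
  shows "{c \<in> branch E a b. cover_adj E u c} = {c. cover_adj E u c} - (if u = a then {b} else {})"
proof -
  have b: "b \<notin> branch E a b" by (rule branch_not_other_end[OF ab])
  have "c \<in> branch E a b" if "cover_adj E u c" "u = a \<longrightarrow> c \<noteq> b" for c
  proof -
    have "{u, c} \<noteq> {a, b}" using that u b by (auto simp: doubleton_eq_iff)
    then show ?thesis using u that unfolding branch_def by (auto intro: rtranclp.rtrancl_into_rtrancl)
  qed
  then show ?thesis using b by auto
qed

text \<open>At \<open>u = a\<close> all neighbours but \<open>b\<close> contribute, and the
  recursion for the edge from \<open>last b\<close> to \<open>last a\<close> gives the one on the
  right. At any other \<open>u\<close>, the recursion for the edge pointing away from
  \<open>a\<close> turns the outward terms and the diagonal term into minus the value one step
  nearer to \<open>a\<close>. The leading minus sign is that of \<open>zeta\<close>.\<close>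

lemma tpw_resolvent_equation:
  fixes E :: "'a::finite \<Rightarrow> 'a \<Rightarrow> bool"
  assumes sym: "\<And>x y. E x y \<Longrightarrow> E y x" and ab: "cover_adj E a b" and u: "u \<in> branch E a b"
    and rec: "\<And>x y. E x y \<Longrightarrow> Z x y * (\<gamma> - complex_of_real (W y) - (\<Sum>z\<in>{z. E y z \<and> z \<noteq> x}. Z y z)) = 1"
  shows "(\<Sum>c\<in>{c \<in> branch E a b. cover_adj E u c}. - Z (last b) (last a) * tpw Z a c)
      + (complex_of_real (W (last u)) - \<gamma>) * (- Z (last b) (last a) * tpw Z a u) = (if u = a then 1 else 0)"
proof -
  have nba: "nb_walk E a" using ab unfolding cover_adj_def by blast
  have nbu: "nb_walk E u" using branch_nb_walk[OF u nba] .
  show ?thesis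
  proof (cases "u = a")
    case True
    have Eb: "E (last a) (last b)" "b = cover_step a (last b)" using cover_adj_imp_step[of E a b] sym ab by blast+
    have "{c \<in> branch E a b. cover_adj E u c} = cover_step a ` {z. E (last a) z} - {cover_step a (last b)}"
      using branch_nbrs[OF ab u] cover_nbrs[of E a] sym nba True Eb(2) by simp
    also have "\<dots> = cover_step a ` {z. E (last a) z \<and> z \<noteq> last b}"
      using inj_cover_step[of a UNIV] by (auto simp: inj_on_def)
    finally have "(\<Sum>c\<in>{c \<in> branch E a b. cover_adj E u c}. - Z (last b) (last a) * tpw Z a c) =
      (\<Sum>z\<in>{z. E (last a) z \<and> z \<noteq> last b}. - Z (last b) (last a) * Z (last a) z)"
      by (simp add: sum.reindex inj_cover_step tpw_step_base[OF nba])
    also have "\<dots> = - Z (last b) (last a) * (\<Sum>z\<in>{z. E (last a) z \<and> z \<noteq> last b}. Z (last a) z)"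
      by (simp add: sum_distrib_left)
    finally show ?thesis
      using rec[OF sym[OF Eb(1)]] True tpw_self[of Z a] by (simp add: algebra_simps)
  next
    case False
    obtain p where p: "E (last u) p" "tpw Z a u = tpw Z a (cover_step u p) * Z p (last u)"
      "\<And>z. z \<noteq> p \<Longrightarrow> tpw Z a (cover_step u z) = tpw Z a u * Z (last u) z"
      using tpw_step[of E a u Z] sym nba nbu False by blast
    have "{c \<in> branch E a b. cover_adj E u c} = cover_step u ` {z. E (last u) z}"
      using branch_nbrs[OF ab u] cover_nbrs[of E u] sym nbu False by simp
    then have "(\<Sum>c\<in>{c \<in> branch E a b. cover_adj E u c}. tpw Z a c) =
      (\<Sum>z\<in>{z. E (last u) z}. tpw Z a (cover_step u z))"
      by (simp add: sum.reindex inj_cover_step)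
    also have "\<dots> = tpw Z a (cover_step u p) + (\<Sum>z\<in>{z. E (last u) z} - {p}. tpw Z a (cover_step u z))"
      using p(1) by (simp add: sum.remove)
    also have "{z. E (last u) z} - {p} = {z. E (last u) z \<and> z \<noteq> p}" by auto
    also have "(\<Sum>z\<in>{z. E (last u) z \<and> z \<noteq> p}. tpw Z a (cover_step u z)) =
      tpw Z a u * (\<Sum>z\<in>{z. E (last u) z \<and> z \<noteq> p}. Z (last u) z)"
      using p(3) by (simp add: sum_distrib_left)
    finally have s: "(\<Sum>c\<in>{c \<in> branch E a b. cover_adj E u c}. tpw Z a c) + (complex_of_real (W (last u)) - \<gamma>) * tpw Z a u
      = tpw Z a (cover_step u p) - tpw Z a (cover_step u p) * (Z p (last u) * (\<gamma> - complex_of_real (W (last u)) - (\<Sum>z\<in>{z. E (last u) z \<and> z \<noteq> p}. Z (last u) z)))"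
      unfolding p(2) by (simp add: algebra_simps)
    have "\<dots> = 0" using rec[OF sym[OF p(1)]] by simp
    with s have "(\<Sum>c\<in>{c \<in> branch E a b. cover_adj E u c}. tpw Z a c) + (complex_of_real (W (last u)) - \<gamma>) * tpw Z a u = 0"
      by simp
    then have "- Z (last b) (last a) * ((\<Sum>c\<in>{c \<in> branch E a b. cover_adj E u c}. tpw Z a c) + (complex_of_real (W (last u)) - \<gamma>) * tpw Z a u) = 0"
      by simp
    then show ?thesis using False by (simp add: algebra_simps sum_distrib_left sum_negf)
  qed
qed

text \<open>Conservation of flow with absorption: out of the amount \<open>m x y\<close> entering an
  edge, each further step absorbs a share proportional to \<open>\<eta>\<close> and passes on the
  rest. The total absorbed is at most what entered.\<close>

lemma sum_pw_walks_le:
  fixes E :: "'a::finite \<Rightarrow> 'a \<Rightarrow> bool" and Z :: "'a \<Rightarrow> 'a \<Rightarrow> complex"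
  assumes flow: "\<And>x y. E x y \<Longrightarrow> (cmod (Z x y))\<^sup>2 * (\<eta> + (\<Sum>z\<in>{z. E y z \<and> z \<noteq> x}. m y z)) = m x y"
    and m: "\<And>x y. m x y \<ge> 0"
  shows "E x y \<Longrightarrow> \<eta> * (\<Sum>k<n. \<Sum>r\<in>walks E k x y. (cmod (pw Z r))\<^sup>2) \<le> m x y"
proof (induction n arbitrary: x y)
  case 0
  then show ?case using m by simp
next
  case (Suc n)
  have step: "(\<Sum>r\<in>walks E (Suc k) x y. (cmod (pw Z r))\<^sup>2) =
    (cmod (Z x y))\<^sup>2 * (\<Sum>z\<in>{z. E y z \<and> z \<noteq> x}. \<Sum>r\<in>walks E k y z. (cmod (pw Z r))\<^sup>2)" for k
  proof -
    have "(cmod (pw Z (x # r)))\<^sup>2 = (cmod (Z x y))\<^sup>2 * (cmod (pw Z r))\<^sup>2" if "r \<in> walks E k y z" for r z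
      using walks_form[OF that] by (auto simp: norm_mult power_mult_distrib)
    then show ?thesis
      unfolding sum_walks_Suc[of E, OF Suc.prems] by (simp add: sum_distrib_left)
  qed
  have "\<eta> * (\<Sum>k<Suc n. \<Sum>r\<in>walks E k x y. (cmod (pw Z r))\<^sup>2) =
    \<eta> * ((cmod (Z x y))\<^sup>2 + (\<Sum>k<n. (cmod (Z x y))\<^sup>2 * (\<Sum>z\<in>{z. E y z \<and> z \<noteq> x}. \<Sum>r\<in>walks E k y z. (cmod (pw Z r))\<^sup>2)))"
    unfolding sum.lessThan_Suc_shift step using Suc.prems by (simp add: walks_0)
  also have "\<dots> = (cmod (Z x y))\<^sup>2 * (\<eta> + (\<Sum>z\<in>{z. E y z \<and> z \<noteq> x}. \<eta> * (\<Sum>k<n. \<Sum>r\<in>walks E k y z. (cmod (pw Z r))\<^sup>2)))"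
    unfolding sum_distrib_left[symmetric] sum.swap[of _ "{..<n}"] by (simp add: algebra_simps)
  also have "\<dots> \<le> (cmod (Z x y))\<^sup>2 * (\<eta> + (\<Sum>z\<in>{z. E y z \<and> z \<noteq> x}. m y z))"
    using Suc.IH by (intro mult_left_mono add_left_mono sum_mono) auto
  also have "\<dots> = m x y" by (rule flow[OF Suc.prems])
  finally show ?case .
qed

lemma pw_square_summable:
  fixes E :: "'a::finite \<Rightarrow> 'a \<Rightarrow> bool" and Z :: "'a \<Rightarrow> 'a \<Rightarrow> complex"
  assumes flow: "\<And>x y. E x y \<Longrightarrow> (cmod (Z x y))\<^sup>2 * (\<eta> + (\<Sum>z\<in>{z. E y z \<and> z \<noteq> x}. m y z)) = m x y"
    and m: "\<And>x y. m x y \<ge> 0" and \<eta>: "\<eta> > 0"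
  shows "(\<lambda>u. (cmod (pw Z u))\<^sup>2) summable_on {u. u \<noteq> [] \<and> nbw E u \<and> hd u = x}"
proof -
  have 1: "(\<lambda>u. (cmod (pw Z u))\<^sup>2) summable_on (\<Union>k. walks E k x y)" if y: "E x y" for y
  proof (rule nonneg_bdd_above_summable_on)
    show "bdd_above (sum (\<lambda>u. (cmod (pw Z u))\<^sup>2) ` {F. F \<subseteq> (\<Union>k. walks E k x y) \<and> finite F})"
    proof (rule bdd_aboveI2)
      fix F assume "F \<in> {F. F \<subseteq> (\<Union>k. walks E k x y) \<and> finite F}"
      then have F: "F \<subseteq> (\<Union>k. walks E k x y)" "finite F" by auto
      define n where "n = Suc (Max (length ` F))"
      have "F \<subseteq> (\<Union>k\<in>{..<n}. walks E k x y)"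
      proof
        fix r assume r: "r \<in> F"
        then obtain k where k: "r \<in> walks E k x y" using F by blast
        have "length r \<le> Max (length ` F)" using r F(2) by (intro Max_ge) auto
        moreover have "length r = k + 2" using k by (simp add: walks_def)
        ultimately show "r \<in> (\<Union>k\<in>{..<n}. walks E k x y)" using k by (auto simp: n_def)
      qed
      then have "(\<Sum>u\<in>F. (cmod (pw Z u))\<^sup>2) \<le> (\<Sum>u\<in>(\<Union>k\<in>{..<n}. walks E k x y). (cmod (pw Z u))\<^sup>2)"
        by (intro sum_mono2) (auto simp: finite_walks)
      also have "\<dots> = (\<Sum>k<n. \<Sum>r\<in>walks E k x y. (cmod (pw Z r))\<^sup>2)"
        by (rule sum.UNION_disjoint) (auto simp: finite_walks, auto simp: walks_def)
      also have "\<dots> \<le> m x y / \<eta>"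
        using sum_pw_walks_le[OF flow m, where n=n, OF _ y] \<eta> by (simp add: field_simps)
      finally show "(\<Sum>u\<in>F. (cmod (pw Z u))\<^sup>2) \<le> m x y / \<eta>" .
    qed
  qed auto
  have 2: "(\<lambda>u. (cmod (pw Z u))\<^sup>2) summable_on (\<Union>y\<in>B. \<Union>k. walks E k x y)" if "finite B" "B \<subseteq> {y. E x y}" for B
    using that
  proof (induction B rule: finite_induct)
    case (insert y B)
    then show ?case using 1[of y] by (auto intro: summable_on_union)
  qed auto
  have eq: "{u. u \<noteq> [] \<and> nbw E u \<and> hd u = x} = {[x]} \<union> (\<Union>y\<in>{y. E x y}. \<Union>k. walks E k x y)"
  proof (intro equalityI subsetI)
    fix u assume u: "u \<in> {u. u \<noteq> [] \<and> nbw E u \<and> hd u = x}"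
    show "u \<in> {[x]} \<union> (\<Union>y\<in>{y. E x y}. \<Union>k. walks E k x y)"
    proof (cases "\<exists>y q. u = x # y # q")
      case True
      then obtain y q where "u = x # y # q" by blast
      then have "E x y" "u \<in> walks E (length q) x y" using u nbw_Cons_adj[of E x y q] by (auto simp: walks_def)
      then show ?thesis by blast
    next
      case False
      then have "u = [x]" using u by (cases u; cases "tl u") auto
      then show ?thesis by blast
    qed
  qed (auto simp: walks_def)
  show ?thesis unfolding eq by (intro summable_on_union 2) auto
qed

text \<open>A walk that follows the first edge of \<open>a\<close> is treated with the tail of
  \<open>a\<close>. One that leaves \<open>a\<close> at once has the weight of its own edges times a
  constant.\<close>

lemma tpw_square_summable:
  fixes E :: "'a::finite \<Rightarrow> 'a \<Rightarrow> bool" and Z :: "'a \<Rightarrow> 'a \<Rightarrow> complex"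
  assumes flow: "\<And>x y. E x y \<Longrightarrow> (cmod (Z x y))\<^sup>2 * (\<eta> + (\<Sum>z\<in>{z. E y z \<and> z \<noteq> x}. m y z)) = m x y"
    and m: "\<And>x y. m x y \<ge> 0" and \<eta>: "\<eta> > 0"
  shows "a \<noteq> [] \<Longrightarrow> (\<lambda>u. (cmod (tpw Z a u))\<^sup>2) summable_on {u. u \<noteq> [] \<and> nbw E u \<and> hd u = hd a}"
proof (induction a rule: induct_list012)
  case (2 x)
  then show ?case using pw_square_summable[OF flow m \<eta>] by simp
next
  case (3 x y a)
  define A where "A = {u. u \<noteq> [] \<and> nbw E u \<and> hd u = x}"
  define c where "c = pw (\<lambda>s t. Z t s) (x # y # a)"
  have A1: "(\<lambda>u. (cmod (tpw Z (x # y # a) u))\<^sup>2) summable_on (#) x ` {u. u \<noteq> [] \<and> nbw E u \<and> hd u = y}"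
  proof (subst summable_on_reindex)
    have "tpw Z (x # y # a) (x # u) = tpw Z (y # a) u" if "u \<noteq> []" "hd u = y" for u
      using that by (cases u) auto
    then show "((\<lambda>u. (cmod (tpw Z (x # y # a) u))\<^sup>2) \<circ> (#) x) summable_on {u. u \<noteq> [] \<and> nbw E u \<and> hd u = y}"
      using 3 unfolding o_def
      by (subst summable_on_cong[where g = "\<lambda>u. (cmod (tpw Z (y # a) u))\<^sup>2"]) auto
  qed auto
  have "(\<lambda>u. (cmod c)\<^sup>2 * (cmod (pw Z u))\<^sup>2) summable_on A"
    using pw_square_summable[OF flow m \<eta>, of x] unfolding A_def by (intro summable_on_cmult_right)
  then have "(\<lambda>u. (cmod c)\<^sup>2 * (cmod (pw Z u))\<^sup>2) summable_on {u \<in> A. \<forall>q. u \<noteq> x # y # q}"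
    by (rule summable_on_subset) auto
  moreover have "(cmod (tpw Z (x # y # a) u))\<^sup>2 = (cmod c)\<^sup>2 * (cmod (pw Z u))\<^sup>2"
    if "u \<in> {u \<in> A. \<forall>q. u \<noteq> x # y # q}" for u
  proof -
    have "tpw Z (x # y # a) u = c * pw Z u"
      using that unfolding A_def c_def by (cases "(Z, x # y # a, u)" rule: tree_path_weight.cases) auto
    then show ?thesis by (simp add: norm_mult power_mult_distrib)
  qed
  ultimately have A2: "(\<lambda>u. (cmod (tpw Z (x # y # a) u))\<^sup>2) summable_on {u \<in> A. \<forall>q. u \<noteq> x # y # q}"
    using summable_on_cong[of "{u \<in> A. \<forall>q. u \<noteq> x # y # q}" "\<lambda>u. (cmod (tpw Z (x # y # a) u))\<^sup>2"
        "\<lambda>u. (cmod c)\<^sup>2 * (cmod (pw Z u))\<^sup>2"] by blast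
  have "A \<subseteq> (#) x ` {u. u \<noteq> [] \<and> nbw E u \<and> hd u = y} \<union> {u \<in> A. \<forall>q. u \<noteq> x # y # q}"
  proof
    fix u assume u: "u \<in> A"
    show "u \<in> (#) x ` {u. u \<noteq> [] \<and> nbw E u \<and> hd u = y} \<union> {u \<in> A. \<forall>q. u \<noteq> x # y # q}"
    proof (cases "\<exists>q. u = x # y # q")
      case True
      then obtain q where q: "u = x # y # q" by blast
      then have "nbw E (y # q)" using u nbw_ConsD[of E x "y # q"] by (simp add: A_def)
      then have "y # q \<in> {u. u \<noteq> [] \<and> nbw E u \<and> hd u = y}" by simp
      then show ?thesis using q by blast
    qed (use u in blast)
  qed
  then show ?case
    using summable_on_subset[OF summable_on_union[OF A1 A2]] unfolding A_def by simp
qed auto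

text \<open>The adjacency operator restricted to \<open>S\<close> is symmetric, so its quadratic
  form at \<open>f\<close> is real. The homogeneous equation makes the imaginary part of that form
  \<open>Im \<gamma>\<close> times the squared norm of \<open>f\<close>.\<close>

lemma cover_resolvent_unique:
  fixes E :: "'a::finite \<Rightarrow> 'a \<Rightarrow> bool" and f :: "'a list \<Rightarrow> complex"
  assumes sym: "\<And>x y. E x y \<Longrightarrow> E y x" and S: "\<And>u. u \<in> S \<Longrightarrow> nb_walk E u"
    and l2: "(\<lambda>u. (cmod (f u))\<^sup>2) summable_on S" and \<gamma>: "Im \<gamma> > 0"
    and eq: "\<And>u. u \<in> S \<Longrightarrow> (\<Sum>c\<in>{c\<in>S. cover_adj E u c}. f c) + (complex_of_real (W (last u)) - \<gamma>) * f u = 0"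
    and u: "u \<in> S"
  shows "f u = 0"
proof -
  define A where "A u = {c\<in>S. cover_adj E u c}" for u
  have A: "finite (A u) \<and> card (A u) \<le> CARD('a)" if "u \<in> S" for u
  proof -
    have "A u \<subseteq> cover_step u ` UNIV"
      using cover_nbrs[of E u] sym S[OF that] unfolding A_def by blast
    moreover have "card (cover_step u ` (UNIV::'a set)) \<le> CARD('a)" by (rule card_image_le) simp
    ultimately show ?thesis by (meson card_mono finite finite_imageI finite_subset order_trans)
  qed
  have sum1: "(\<lambda>(u, c). (cmod (f u))\<^sup>2) summable_on Sigma S A"
  proof (rule summable_on_SigmaI[where g = "\<lambda>u. real (card (A u)) * (cmod (f u))\<^sup>2"])
    fix u assume "u \<in> S"
    then show "((\<lambda>c. case (u, c) of (u, c) \<Rightarrow> (cmod (f u))\<^sup>2) has_sum real (card (A u)) * (cmod (f u))\<^sup>2) (A u)"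
      using A[of u] by (intro has_sum_finiteI) auto
  next
    show "(\<lambda>u. real (card (A u)) * (cmod (f u))\<^sup>2) summable_on S"
    proof (rule summable_on_comparison_test)
      show "(\<lambda>u. real CARD('a) * (cmod (f u))\<^sup>2) summable_on S"
        using l2 by (rule summable_on_cmult_right)
    qed (use A in \<open>auto intro!: mult_right_mono\<close>)
  qed auto
  have bij: "bij_betw prod.swap (Sigma S A) (Sigma S A)"
    by (rule bij_betwI[of _ _ _ prod.swap]) (auto simp: A_def dest: cover_adj_sym)
  have sum2: "(\<lambda>(u, c). (cmod (f c))\<^sup>2) summable_on Sigma S A"
    using summable_on_reindex_bij_betw[OF bij, of "\<lambda>(u, c). (cmod (f u))\<^sup>2"] sum1
    by (simp add: case_prod_beta')
  \<comment> \<open>Bounded degree makes the double sum over edges absolutely convergent, so it may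
    be reordered and summed row by row.\<close>
  have sum3: "(\<lambda>(u, c). cnj (f u) * f c) summable_on Sigma S A"
  proof (rule abs_summable_summable[OF Infinite_Sum.abs_summable_on_comparison_test'[where g = "\<lambda>x. (case x of (u, c) \<Rightarrow> (cmod (f u))\<^sup>2) + (case x of (u, c) \<Rightarrow> (cmod (f c))\<^sup>2)"]])
    show "(\<lambda>x. (case x of (u, c) \<Rightarrow> (cmod (f u))\<^sup>2) + (case x of (u, c) \<Rightarrow> (cmod (f c))\<^sup>2)) summable_on Sigma S A"
      by (intro summable_on_add sum1 sum2)
  next
    fix x assume "x \<in> Sigma S A"
    have "cmod (f s) * cmod (f t) \<le> (cmod (f s))\<^sup>2 + (cmod (f t))\<^sup>2" for s t
    proof -
      have "0 \<le> cmod (f s) * cmod (f t)" by simp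
      then show ?thesis
        using sum_squares_bound[of "cmod (f s)" "cmod (f t)"] by linarith
    qed
    then show "norm (case x of (u, c) \<Rightarrow> cnj (f u) * f c) \<le>
      (case x of (u, c) \<Rightarrow> (cmod (f u))\<^sup>2) + (case x of (u, c) \<Rightarrow> (cmod (f c))\<^sup>2)"
      by (simp add: case_prod_beta' norm_mult)
  qed
  define T where "T = infsum (\<lambda>(u, c). cnj (f u) * f c) (Sigma S A)"
  \<comment> \<open>Exchanging the two ends of an edge conjugates the summand.\<close>
  have "T = infsum (\<lambda>x. case prod.swap x of (u, c) \<Rightarrow> cnj (f u) * f c) (Sigma S A)"
    unfolding T_def using infsum_reindex_bij_betw[OF bij, of "\<lambda>(u, c). cnj (f u) * f c"] by simp
  also have "\<dots> = infsum (\<lambda>x. cnj (case x of (u, c) \<Rightarrow> cnj (f u) * f c)) (Sigma S A)"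
    by (intro infsum_cong) (auto simp: mult.commute)
  also have "\<dots> = cnj T" unfolding T_def by (rule infsum_cnj)
  finally have ImT: "Im T = 0" by (metis complex_cnj_cancel_iff Reals_cnj_iff complex_is_Real_iff)
  have inner: "infsum (\<lambda>c. cnj (f u) * f c) (A u) = (\<gamma> - complex_of_real (W (last u))) * complex_of_real ((cmod (f u))\<^sup>2)"
    if "u \<in> S" for u
  proof -
    have "infsum (\<lambda>c. cnj (f u) * f c) (A u) = cnj (f u) * (\<Sum>c\<in>A u. f c)"
      using A[OF that] by (simp add: sum_distrib_left)
    also have "(\<Sum>c\<in>A u. f c) = (\<gamma> - complex_of_real (W (last u))) * f u"
      using eq[OF that] unfolding A_def by (simp add: algebra_simps add_eq_0_iff)
    also have "cnj (f u) * ((\<gamma> - complex_of_real (W (last u))) * f u) = (\<gamma> - complex_of_real (W (last u))) * complex_of_real ((cmod (f u))\<^sup>2)"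
      unfolding complex_norm_square by (simp add: mult.commute mult.left_commute)
    finally show ?thesis .
  qed
  have T2: "T = infsum (\<lambda>u. (\<gamma> - complex_of_real (W (last u))) * complex_of_real ((cmod (f u))\<^sup>2)) S"
  proof -
    have "T = infsum (\<lambda>u. infsum (\<lambda>c. cnj (f u) * f c) (A u)) S"
      unfolding T_def using infsum_Sigma'_banach[OF sum3] by simp
    then show ?thesis using infsum_cong[OF inner] by simp
  qed
  have s2: "(\<lambda>u. (\<gamma> - complex_of_real (W (last u))) * complex_of_real ((cmod (f u))\<^sup>2)) summable_on S"
    by (rule iffD1[OF summable_on_cong[OF inner] summable_on_Sigma_banach[OF sum3]])
  have "Im T = infsum (\<lambda>u. Im \<gamma> * (cmod (f u))\<^sup>2) S"
    unfolding T2 by (subst infsum_Im[OF s2, symmetric], rule infsum_cong) (simp del: of_real_power)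
  also have "\<dots> = Im \<gamma> * infsum (\<lambda>u. (cmod (f u))\<^sup>2) S"
    using l2 by (intro infsum_cmult_right) auto
  finally have "infsum (\<lambda>u. (cmod (f u))\<^sup>2) S = 0" using ImT \<gamma> by simp
  then have "(cmod (f u))\<^sup>2 = 0"
    using nonneg_infsum_le_0D[of "\<lambda>u. (cmod (f u))\<^sup>2" S u] l2 u by auto
  then show ?thesis by simp
qed

lemma zeta_fixed_point_exists:
  fixes E :: "'a::finite \<Rightarrow> 'a \<Rightarrow> bool"
  assumes \<gamma>: "Im \<gamma> > 0"
  shows "\<exists>Z :: 'a \<Rightarrow> 'a \<Rightarrow> complex. (\<forall>x y. Im (Z x y) < 0) \<and>
    (\<forall>x y. Z x y * (\<gamma> - complex_of_real (W y) - (\<Sum>z\<in>{z. E y z \<and> z \<noteq> x}. Z y z)) = 1)"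
proof -
  \<comment> \<open>The closed half-plane makes \<open>K\<close> compact. The radius
    \<open>1 / Im \<gamma>\<close> bounds the inverse of a number with imaginary part at least
    \<open>Im \<gamma>\<close>. The image lies in the open half-plane, which yields strict
    negativity at the fixed point.\<close>
  define K where "K = {v :: complex ^ ('a \<times> 'a). \<forall>i. Im (v $ i) \<le> 0 \<and> norm (v $ i) \<le> 1 / Im \<gamma>}"
  define den where "den v i = \<gamma> - complex_of_real (W (snd i)) - (\<Sum>z\<in>{z. E (snd i) z \<and> z \<noteq> fst i}. v $ (snd i, z))"
    for v :: "complex ^ ('a \<times> 'a)" and i
  define \<Phi> where "\<Phi> v = (\<chi> i. 1 / den v i)" for v
  have KD: "Im (v $ i) \<le> 0" "norm (v $ i) \<le> 1 / Im \<gamma>" if "v \<in> K" for v i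
    using that unfolding K_def by blast+
  have den: "Im (den v i) \<ge> Im \<gamma>" if "v \<in> K" for v i
    using that unfolding K_def den_def by (auto intro!: sum_nonpos)
  have den0: "den v i \<noteq> 0" if "v \<in> K" for v i
    using den[OF that, of i] \<gamma> by auto
  have \<Phi>K: "Im (\<Phi> v $ i) < 0 \<and> norm (\<Phi> v $ i) \<le> 1 / Im \<gamma>" if "v \<in> K" for v i
  proof
    have "cmod (den v i) > 0" using den0[OF that] by simp
    then show "Im (\<Phi> v $ i) < 0"
      using den[OF that, of i] \<gamma> unfolding \<Phi>_def
      by (simp add: Im_divide cmod_power2[symmetric] divide_neg_pos)
    have "Im \<gamma> \<le> cmod (den v i)" using den[OF that, of i] abs_Im_le_cmod[of "den v i"] by linarith
    then show "norm (\<Phi> v $ i) \<le> 1 / Im \<gamma>"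
      using \<gamma> unfolding \<Phi>_def by (simp add: norm_divide frac_le)
  qed
  have "closed K"
    unfolding K_def by (intro closed_Collect_all closed_Collect_conj closed_Collect_le continuous_intros)
  moreover have "bounded K"
  proof (rule boundedI)
    fix v assume v: "v \<in> K"
    have "norm v \<le> (\<Sum>i\<in>UNIV. norm (v $ i))" by (simp add: norm_vec_def L2_set_le_sum)
    also have "\<dots> \<le> (\<Sum>i\<in>(UNIV :: ('a \<times> 'a) set). 1 / Im \<gamma>)"
      using v by (intro sum_mono) (auto simp: K_def)
    finally show "norm v \<le> (\<Sum>i\<in>(UNIV :: ('a \<times> 'a) set). 1 / Im \<gamma>)" .
  qed
  ultimately have "compact K" by (simp add: compact_eq_bounded_closed)
  moreover have "convex K"
  proof (rule convexI)
    fix v w :: "complex ^ ('a \<times> 'a)" and s t :: real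
    assume vw: "v \<in> K" "w \<in> K" and st: "0 \<le> s" "0 \<le> t" "s + t = 1"
    show "s *\<^sub>R v + t *\<^sub>R w \<in> K"
      unfolding K_def
    proof (intro CollectI allI conjI)
      fix i
      have "s * Im (v $ i) \<le> 0" "t * Im (w $ i) \<le> 0"
        using KD[OF vw(1), of i] KD[OF vw(2), of i] st by (auto intro: mult_nonneg_nonpos)
      then show "Im ((s *\<^sub>R v + t *\<^sub>R w) $ i) \<le> 0" by simp
      have "norm ((s *\<^sub>R v + t *\<^sub>R w) $ i) \<le> s * norm (v $ i) + t * norm (w $ i)"
        using st norm_triangle_ineq[of "s *\<^sub>R v $ i" "t *\<^sub>R w $ i"] by simp
      also have "\<dots> \<le> s * (1 / Im \<gamma>) + t * (1 / Im \<gamma>)"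
        using KD[OF vw(1), of i] KD[OF vw(2), of i] st by (intro add_mono mult_left_mono) auto
      also have "\<dots> = 1 / Im \<gamma>" using st by (metis distrib_right mult_1)
      finally show "norm ((s *\<^sub>R v + t *\<^sub>R w) $ i) \<le> 1 / Im \<gamma>" .
    qed
  qed
  moreover have "K \<noteq> {}"
  proof -
    have "0 \<in> K" using \<gamma> by (simp add: K_def)
    then show ?thesis by blast
  qed
  moreover have "continuous_on K \<Phi>"
    unfolding \<Phi>_def
  proof (intro continuous_on_vec_lambda continuous_on_divide continuous_on_const ballI)
    show "continuous_on K (\<lambda>v. den v i)" for i
      unfolding den_def by (intro continuous_intros)
  qed (use den0 in auto)
  moreover have "\<Phi> \<in> K \<rightarrow> K"
    using \<Phi>K unfolding K_def by (auto simp: less_imp_le)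
  ultimately obtain v where v: "v \<in> K" "\<Phi> v = v" by (rule brouwer)
  show ?thesis
  proof (intro exI[of _ "\<lambda>x y. v $ (x, y)"] conjI allI)
    fix x y
    show "Im (v $ (x, y)) < 0" using \<Phi>K[OF v(1), of "(x, y)"] v(2) by simp
    have "v $ (x, y) = 1 / den v (x, y)" using v(2) unfolding \<Phi>_def by (metis vec_lambda_beta)
    then have "v $ (x, y) * den v (x, y) = 1" using den0[OF v(1), of "(x, y)"] by simp
    then show "v $ (x, y) * (\<gamma> - complex_of_real (W y) - (\<Sum>z\<in>{z. E y z \<and> z \<noteq> x}. v $ (y, z))) = 1"
      by (simp add: den_def)
  qed
qed

text \<open>The recursion says that the bracket is \<open>1 / Z\<close>, whose imaginary part is
  \<open>- Im Z\<close> divided by the squared modulus.\<close>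

lemma Im_recursion:
  assumes "Z * (\<gamma> - complex_of_real w - s) = (1::complex)"
  shows "(cmod Z)\<^sup>2 * (Im \<gamma> - Im s) = - Im Z"
proof -
  have "Z \<noteq> 0" using assms by auto
  then have eq: "\<gamma> - complex_of_real w - s = inverse Z" using assms by (metis inverse_unique)
  have "Im \<gamma> - Im s = Im (inverse Z)" using arg_cong[OF eq, of Im] by simp
  also have "\<dots> = - Im Z / (cmod Z)\<^sup>2" by (simp add: cmod_power2)
  finally show ?thesis using \<open>Z \<noteq> 0\<close> by simp
qed

section \<open>Identification of \<open>zeta\<close> and passage to the real axis\<close>

lemma nb_walk_exists:
  assumes sym: "\<And>x y. E x y \<Longrightarrow> E y x" and conn: "E\<^sup>*\<^sup>* (SOME b. True) x"
  shows "\<exists>p. nb_walk E p \<and> last p = x"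
  using conn
proof (induction rule: rtranclp_induct)
  case base
  then show ?case by (intro exI[of _ "[SOME b. True]"]) (auto simp: nb_walk_iff)
next
  case (step x y)
  then obtain p where p: "nb_walk E p" "last p = x" by blast
  then have "cover_adj E p (cover_step p y)" using cover_adj_step[of E p y] sym step by blast
  then show ?case using last_cover_step[of p y] unfolding cover_adj_def by blast
qed

text \<open>For a fixed point in the lower half-plane the geodesic products are square summable, so
  they form the solution that \<open>tree_green\<close> describes. As the value depends on
  \<open>v\<close> and \<open>w\<close> alone, \<open>zeta\<close> is independent of the chosen
  lifts.\<close>

lemma zeta_eq_fixed_point:
  fixes E :: "'a::finite \<Rightarrow> 'a \<Rightarrow> bool"
  assumes sym: "\<And>x y. E x y \<Longrightarrow> E y x" and conn: "\<And>x y. E\<^sup>*\<^sup>* x y"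
    and \<gamma>: "Im \<gamma> > 0" and neg: "\<And>x y. Im (Z x y) < 0"
    and rec: "\<And>x y. E x y \<Longrightarrow> Z x y * (\<gamma> - complex_of_real (W y) - (\<Sum>z\<in>{z. E y z \<and> z \<noteq> x}. Z y z)) = 1"
    and vw: "E v w"
  shows "zeta E W \<gamma> w v = Z w v"
proof -
  define ab where "ab = (SOME (a, b). cover_adj E a b \<and> last a = v \<and> last b = w)"
  obtain p where p: "nb_walk E p" "last p = v" using nb_walk_exists[of E v] sym conn by blast
  have "cover_adj E p (cover_step p w) \<and> last p = v \<and> last (cover_step p w) = w"
    using cover_adj_step[of E p w] sym p vw last_cover_step[of p w] by blast
  then have "case (p, cover_step p w) of (a, b) \<Rightarrow> cover_adj E a b \<and> last a = v \<and> last b = w" by simp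
  then have "case ab of (a, b) \<Rightarrow> cover_adj E a b \<and> last a = v \<and> last b = w"
    unfolding ab_def by (rule someI)
  then obtain a b where ab: "ab = (a, b)" "cover_adj E a b" "last a = v" "last b = w" by (cases ab) auto
  have nba: "nb_walk E a" using ab unfolding cover_adj_def by blast
  define S where "S = branch E a b"
  have Snb: "nb_walk E u" if "u \<in> S" for u using branch_nb_walk that nba unfolding S_def by blast
  have aS: "a \<in> S" by (simp add: S_def branch_def)
  define f where "f u = - Z w v * tpw Z a u" for u
  have flow: "(cmod (Z x y))\<^sup>2 * (Im \<gamma> + (\<Sum>z\<in>{z. E y z \<and> z \<noteq> x}. - Im (Z y z))) = - Im (Z x y)" if "E x y" for x y
    using Im_recursion[OF rec[OF that]] by (simp add: sum_negf)
  have "(\<lambda>u. (cmod (tpw Z a u))\<^sup>2) summable_on {u. u \<noteq> [] \<and> nbw E u \<and> hd u = hd a}"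
    by (rule tpw_square_summable[where m = "\<lambda>x y. - Im (Z x y)" and \<eta> = "Im \<gamma>"])
      (use flow neg \<gamma> nba in \<open>auto simp: nb_walk_iff less_imp_le\<close>)
  then have "(\<lambda>u. (cmod (tpw Z a u))\<^sup>2) summable_on S"
    by (rule summable_on_subset) (use Snb nba in \<open>auto simp: nb_walk_iff\<close>)
  then have "(\<lambda>u. (cmod (Z w v))\<^sup>2 * (cmod (tpw Z a u))\<^sup>2) summable_on S" by (rule summable_on_cmult_right)
  then have f2: "(\<lambda>u. (cmod (f u))\<^sup>2) summable_on S" by (simp add: f_def norm_mult power_mult_distrib)
  have feq: "(\<Sum>c\<in>{c\<in>S. cover_adj E u c}. f c) + (complex_of_real (W (last u)) - \<gamma>) * f u = (if u = a then 1 else 0)"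
    if "u \<in> S" for u
    using tpw_resolvent_equation[OF sym ab(2) that[unfolded S_def] rec] ab unfolding f_def S_def by simp
  have fa: "f a = - Z w v" by (simp add: f_def tpw_self)
  have "tree_green E W S \<gamma> a = f a"
    unfolding tree_green_def
  proof (rule the_equality)
    show "\<exists>fa. (\<lambda>u. (cmod (fa u))\<^sup>2) summable_on S \<and> (\<forall>u\<in>S. sum fa {u' \<in> S. cover_adj E u u'} +
        (complex_of_real (W (last u)) - \<gamma>) * fa u = (if u = a then 1 else 0)) \<and> f a = fa a"
      using f2 feq by blast
  next
    fix g assume "\<exists>fa. (\<lambda>u. (cmod (fa u))\<^sup>2) summable_on S \<and> (\<forall>u\<in>S. sum fa {u' \<in> S. cover_adj E u u'} +
        (complex_of_real (W (last u)) - \<gamma>) * fa u = (if u = a then 1 else 0)) \<and> g = fa a"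
    then obtain h where h: "(\<lambda>u. (cmod (h u))\<^sup>2) summable_on S" "g = h a"
      "\<And>u. u \<in> S \<Longrightarrow> sum h {u' \<in> S. cover_adj E u u'} +
        (complex_of_real (W (last u)) - \<gamma>) * h u = (if u = a then 1 else 0)" by blast
    have "h a - f a = 0"
    proof (rule cover_resolvent_unique[where f = "\<lambda>u. h u - f u", OF sym Snb _ \<gamma> _ aS])
      show "(\<lambda>u. (cmod (h u - f u))\<^sup>2) summable_on S"
      proof (rule summable_on_comparison_test)
        show "(\<lambda>u. 2 * (cmod (h u))\<^sup>2 + 2 * (cmod (f u))\<^sup>2) summable_on S"
          by (intro summable_on_add summable_on_cmult_right h f2)
        fix u
        have "(cmod (h u - f u))\<^sup>2 \<le> (cmod (h u) + cmod (f u))\<^sup>2"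
          by (intro power_mono norm_triangle_ineq4) auto
        also have "\<dots> \<le> 2 * (cmod (h u))\<^sup>2 + 2 * (cmod (f u))\<^sup>2"
          using sum_squares_bound[of "cmod (h u)" "cmod (f u)"] by (simp add: power2_sum)
        finally show "(cmod (h u - f u))\<^sup>2 \<le> 2 * (cmod (h u))\<^sup>2 + 2 * (cmod (f u))\<^sup>2" .
      qed auto
      fix u assume "u \<in> S"
      then show "(\<Sum>c\<in>{c \<in> S. cover_adj E u c}. h c - f c) + (complex_of_real (W (last u)) - \<gamma>) * (h u - f u) = 0"
        using h(3)[of u] feq[of u] by (simp add: sum_subtractf algebra_simps)
    qed
    then show "g = f a" using h(2) by simp
  qed
  then show ?thesis
    unfolding zeta_def ab_def[symmetric] using ab fa by (simp add: S_def)
qed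

lemma zeta_recursion:
  fixes E :: "'a::finite \<Rightarrow> 'a \<Rightarrow> bool"
  assumes sym: "\<And>x y. E x y \<Longrightarrow> E y x" and conn: "\<And>x y. E\<^sup>*\<^sup>* x y" and \<gamma>: "Im \<gamma> > 0" and xy: "E x y"
  shows "Im (zeta E W \<gamma> x y) < 0"
    and "zeta E W \<gamma> x y * (\<gamma> - complex_of_real (W y) - (\<Sum>z\<in>{z. E y z \<and> z \<noteq> x}. zeta E W \<gamma> y z)) = 1"
proof -
  obtain Z where Z: "\<And>x y. Im (Z x y) < 0"
    "\<And>x y. Z x y * (\<gamma> - complex_of_real (W y) - (\<Sum>z\<in>{z. E y z \<and> z \<noteq> x}. Z y z)) = 1"
    using zeta_fixed_point_exists[OF \<gamma>, of W E] by blast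
  have eq: "zeta E W \<gamma> x y = Z x y" if "E x y" for x y
    by (rule zeta_eq_fixed_point[OF sym conn \<gamma> Z sym[OF that]])
  show "Im (zeta E W \<gamma> x y) < 0" using eq[OF xy] Z by simp
  show "zeta E W \<gamma> x y * (\<gamma> - complex_of_real (W y) - (\<Sum>z\<in>{z. E y z \<and> z \<noteq> x}. zeta E W \<gamma> y z)) = 1"
    using Z(2)[of x y] eq[OF xy] eq by simp
qed

text \<open>Membership in the bulk supplies limits with nonzero imaginary part, and the recursion is
  continuous. Limits of numbers in the lower half-plane have imaginary part at most zero, hence here
  negative.\<close>

lemma zeta0_recursion:
  fixes E :: "'a::finite \<Rightarrow> 'a \<Rightarrow> bool"
  assumes sym: "\<And>x y. E x y \<Longrightarrow> E y x" and conn: "\<And>x y. E\<^sup>*\<^sup>* x y"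
    and bulk: "lam \<in> bulk_spectrum E W" and xy: "E x y"
  shows "Im (zeta0 E W lam x y) < 0"
    and "zeta0 E W lam x y * (complex_of_real lam - complex_of_real (W y) - (\<Sum>z\<in>{z. E y z \<and> z \<noteq> x}. zeta0 E W lam y z)) = 1"
proof -
  have lim: "((\<lambda>\<eta>. zeta E W (Complex lam \<eta>) x y) \<longlongrightarrow> zeta0 E W lam x y) (at_right 0) \<and> Im (zeta0 E W lam x y) \<noteq> 0"
    if E: "E x y" for x y
  proof -
    obtain L where L: "((\<lambda>\<eta>. zeta E W (Complex lam \<eta>) x y) \<longlongrightarrow> L) (at_right 0)" "Im L \<noteq> 0"
      using bulk sym[OF E] unfolding bulk_spectrum_def by blast
    then have "zeta0 E W lam x y = L" unfolding zeta0_def by (intro tendsto_Lim) auto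
    then show ?thesis using L by simp
  qed
  have pos: "eventually (\<lambda>\<eta>::real. \<eta> > 0) (at_right 0)" by (simp add: eventually_at_right_less)
  have "((\<lambda>\<eta>. Im (zeta E W (Complex lam \<eta>) x y)) \<longlongrightarrow> Im (zeta0 E W lam x y)) (at_right 0)"
    using lim[OF xy] by (intro tendsto_intros) auto
  moreover have "eventually (\<lambda>\<eta>. Im (zeta E W (Complex lam \<eta>) x y) \<le> 0) (at_right 0)"
    using pos
  proof eventually_elim
    case (elim \<eta>)
    then show ?case using zeta_recursion(1)[of E "Complex lam \<eta>" x y W] sym conn xy by (simp add: less_imp_le)
  qed
  ultimately have "Im (zeta0 E W lam x y) \<le> 0"
    by (rule tendsto_upperbound) simp
  then show "Im (zeta0 E W lam x y) < 0" using lim[OF xy] by simp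
  let ?g = "\<lambda>\<eta>. zeta E W (Complex lam \<eta>) x y * (Complex lam \<eta> - complex_of_real (W y) -
      (\<Sum>z\<in>{z. E y z \<and> z \<noteq> x}. zeta E W (Complex lam \<eta>) y z))"
  have "((\<lambda>\<eta>. Complex lam \<eta>) \<longlongrightarrow> Complex lam 0) (at_right 0)"
    by (intro tendsto_Complex tendsto_intros)
  then have "(?g \<longlongrightarrow> zeta0 E W lam x y * (Complex lam 0 - complex_of_real (W y) - (\<Sum>z\<in>{z. E y z \<and> z \<noteq> x}. zeta0 E W lam y z))) (at_right 0)"
    using lim xy by (intro tendsto_intros) auto
  moreover have "(?g \<longlongrightarrow> 1) (at_right 0)"
  proof (rule tendsto_eventually)
    show "eventually (\<lambda>\<eta>. ?g \<eta> = 1) (at_right 0)"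
      using pos
    proof eventually_elim
      case (elim \<eta>)
      then show ?case using zeta_recursion(2)[of E "Complex lam \<eta>" x y W] sym conn xy by simp
    qed
  qed
  ultimately have "zeta0 E W lam x y * (Complex lam 0 - complex_of_real (W y) - (\<Sum>z\<in>{z. E y z \<and> z \<noteq> x}. zeta0 E W lam y z)) = 1"
    by (rule tendsto_unique[rotated]) simp
  then show "zeta0 E W lam x y * (complex_of_real lam - complex_of_real (W y) - (\<Sum>z\<in>{z. E y z \<and> z \<noteq> x}. zeta0 E W lam y z)) = 1"
    by (simp add: complex_of_real_def)
qed

subsection \<open>Non-backtracking eigenfunctions and their support\<close>

lemma sum_power2_le_card: "(\<Sum>i\<in>A. a i)\<^sup>2 \<le> real (card A) * (\<Sum>i\<in>A. (a i :: real)\<^sup>2)"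
  using Cauchy_Schwarz_ineq_sum[of a "\<lambda>_. 1" A] by (simp add: mult.commute)

locale zeta_graph =
  fixes E :: "'a::finite \<Rightarrow> 'a \<Rightarrow> bool" and W :: "'a \<Rightarrow> real" and lam :: real
    and Z :: "'a \<Rightarrow> 'a \<Rightarrow> complex" and zm :: real
  assumes E_sym: "E x y \<Longrightarrow> E y x" and E_irrefl: "\<not> E x x" and deg3: "deg E x \<ge> 3"
    and rec: "E x y \<Longrightarrow> Z x y * (complex_of_real lam - complex_of_real (W y) - (\<Sum>u\<in>{u. E y u \<and> u \<noteq> x}. Z y u)) = 1"
    and Im_neg: "E x y \<Longrightarrow> Im (Z x y) < 0"
    and zm_pos: "zm > 0" and zm_le: "E x y \<Longrightarrow> zm \<le> - Im (Z x y)"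
begin

definition m :: "'a \<Rightarrow> 'a \<Rightarrow> real" where "m x y = - Im (Z x y)"

definition N :: "'a \<Rightarrow> 'a \<Rightarrow> 'a set" where "N x y = {u. E y u \<and> u \<noteq> x}"

lemma m_pos: "E x y \<Longrightarrow> m x y > 0" and zm_le_m: "E x y \<Longrightarrow> zm \<le> m x y"
  using Im_neg zm_le by (simp_all add: m_def)

lemma flow: "E x y \<Longrightarrow> (cmod (Z x y))\<^sup>2 * (\<Sum>u\<in>N x y. m y u) = m x y"
  using Im_recursion[OF rec[of x y]] by (simp add: m_def N_def sum_negf)

text \<open>Minimal degree three leaves two forward neighbours. This is the origin of the factor two
  in the bounds by \<open>1 / (2 * zm)\<close>.\<close>

lemma sum_m_ge: "2 * zm \<le> (\<Sum>u\<in>N x y. m y u)"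
proof -
  have "2 * zm \<le> real (card (N x y)) * zm"
    using card_other_neighbours[of E y x] deg3 zm_pos unfolding N_def by (intro mult_right_mono) auto
  also have "\<dots> = (\<Sum>u\<in>N x y. zm)" by simp
  also have "\<dots> \<le> (\<Sum>u\<in>N x y. m y u)" by (intro sum_mono zm_le_m) (simp add: N_def)
  finally show ?thesis .
qed

lemma cmod_Z_sq_le: assumes "E x y" shows "(cmod (Z x y))\<^sup>2 \<le> m x y / (2 * zm)"
proof -
  have "(cmod (Z x y))\<^sup>2 * (2 * zm) \<le> m x y"
    using flow[OF assms] sum_m_ge[where x=x and y=y] by (metis mult_left_mono zero_le_power2)
  then show ?thesis using zm_pos by (simp add: field_simps)
qed

lemma m_le_cmod: "E x y \<Longrightarrow> m x y \<le> cmod (Z x y)"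
  using abs_Im_le_cmod[of "Z x y"] by (simp add: m_def)

lemma Z_nz: "E x y \<Longrightarrow> Z x y \<noteq> 0"
  using Im_neg by fastforce

lemma cmod_Z_le: assumes "E x y" shows "cmod (Z x y) \<le> 1 / (2 * zm)"
proof -
  have "(cmod (Z x y))\<^sup>2 \<le> cmod (Z x y) / (2 * zm)"
    using cmod_Z_sq_le[OF assms] m_le_cmod[OF assms] zm_pos by (meson divide_right_mono less_imp_le mult_pos_pos order_trans zero_less_numeral)
  then have "cmod (Z x y) * cmod (Z x y) \<le> cmod (Z x y) * (1 / (2 * zm))"
    by (simp add: power2_eq_square)
  then show ?thesis by (rule mult_left_le_imp_le) (use Z_nz[OF assms] in auto)
qed

lemma m_le: "E x y \<Longrightarrow> m x y \<le> 1 / (2 * zm)"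
  using m_le_cmod cmod_Z_le by (meson order_trans)

lemma ex_adj: "\<exists>y. E x y"
proof (rule ccontr)
  assume "\<not> (\<exists>y. E x y)"
  then have "{y. E x y} = {}" by blast
  then show False using deg3[of x] by (simp add: deg_def)
qed

text \<open>Each \<open>m x y\<close> lies between \<open>zm\<close> and
  \<open>1 / (2 * zm)\<close>. The consequence serves to compare different powers of
  \<open>zm\<close> in the constants.\<close>

lemma zm_sq_le: "2 * zm\<^sup>2 \<le> 1"
proof -
  obtain x y where "E x y" using ex_adj by blast
  then have "zm \<le> 1 / (2 * zm)" using zm_le_m m_le by (meson order_trans)
  then show ?thesis using zm_pos by (simp add: field_simps power2_eq_square)
qed

text \<open>The factors \<open>m\<close> in \<open>P\<close> telescope along a walk: this is
  \<open>m\<close> of the first edge times the probability of the walk under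
  \<open>P\<close>.\<close>

definition edge_mass :: "'a list \<Rightarrow> real" where
  "edge_mass r = (cmod (pw Z (butlast r)))\<^sup>2 * m (last (butlast r)) (last r)"

lemma edge_mass_Cons: "r \<in> walks E k y u \<Longrightarrow> edge_mass (x # r) = (cmod (Z x y))\<^sup>2 * edge_mass r"
  using walks_form[of r E k y u] by (auto simp: edge_mass_def norm_mult power_mult_distrib)

lemma last_edge_adj:
  assumes "r \<in> walks E k x y" shows "E (last (butlast r)) (last r)"
proof -
  obtain q where q: "r = x # y # q" using walks_form[OF assms] by blast
  define v where "v = butlast (butlast r)"
  have "r = v @ [last (butlast r), last r]"
    unfolding v_def using q by (metis append_butlast_last_id append_Cons append_assoc append_Nil butlast.simps(2) list.distinct(1))
  then have "nbw E (v @ [last (butlast r), last r])" using assms by (simp add: walks_def)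
  then show ?thesis by (simp add: nbw_snoc)
qed

lemma edge_mass_pos: "r \<in> walks E k x y \<Longrightarrow> edge_mass r \<ge> 0"
  using m_pos[OF last_edge_adj] unfolding edge_mass_def by (simp add: less_imp_le)

text \<open>After the first step the rest of the walk obeys the same bound from its own first edge,
  so each step multiplies the moment of order \<open>s\<close> by at most \<open>t\<close>.\<close>

lemma sum_edge_mass_powr_le:
  fixes s t :: real
  assumes t: "\<And>x y. E x y \<Longrightarrow> (\<Sum>u\<in>N x y. cmod (Z x y) powr (2 * s) * m y u powr s) \<le> t * m x y powr s"
  shows "E x y \<Longrightarrow> t \<ge> 0 \<Longrightarrow> (\<Sum>r\<in>walks E k x y. edge_mass r powr s) \<le> t ^ k * m x y powr s"
proof (induction k arbitrary: x y)
  case 0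
  then show ?case by (simp add: walks_0 edge_mass_def)
next
  case (Suc k)
  have pp: "((cmod (Z x y))\<^sup>2 * M) powr s = cmod (Z x y) powr (2 * s) * M powr s" if "M \<ge> 0" for M
    using that Z_nz[OF Suc.prems(1)] by (simp add: powr_mult powr_powr flip: powr_numeral)
  have "(\<Sum>r\<in>walks E (Suc k) x y. edge_mass r powr s) =
    (\<Sum>u\<in>N x y. \<Sum>r\<in>walks E k y u. cmod (Z x y) powr (2 * s) * edge_mass r powr s)"
    unfolding sum_walks_Suc[of E, OF Suc.prems(1)] N_def
    using edge_mass_Cons edge_mass_pos pp by (intro sum.cong refl) simp
  also have "\<dots> = (\<Sum>u\<in>N x y. cmod (Z x y) powr (2 * s) * (\<Sum>r\<in>walks E k y u. edge_mass r powr s))"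
    by (simp add: sum_distrib_left)
  also have "\<dots> \<le> (\<Sum>u\<in>N x y. cmod (Z x y) powr (2 * s) * (t ^ k * m y u powr s))"
    using Suc.IH Suc.prems by (intro sum_mono mult_left_mono) (auto simp: N_def)
  also have "\<dots> = t ^ k * (\<Sum>u\<in>N x y. cmod (Z x y) powr (2 * s) * m y u powr s)"
    by (simp add: sum_distrib_left ac_simps)
  also have "\<dots> \<le> t ^ k * (t * m x y powr s)"
    using t[OF Suc.prems(1)] Suc.prems(2) by (intro mult_left_mono) auto
  finally show ?case by (simp add: mult.commute mult.left_commute)
qed

section \<open>Functions fixed by the weighted non-backtracking operator\<close>

definition nb_eigen :: "('a \<Rightarrow> 'a \<Rightarrow> complex) \<Rightarrow> bool" where
  "nb_eigen f \<longleftrightarrow> (\<forall>x y. E x y \<longrightarrow> f x y = Z x y * (\<Sum>u\<in>N x y. f y u))"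

lemma nb_eigen_iterate:
  assumes f: "nb_eigen f"
  shows "E x y \<Longrightarrow> f x y = (\<Sum>r\<in>walks E k x y. pw Z (butlast r) * f (last (butlast r)) (last r))"
proof (induction k arbitrary: x y)
  case 0
  then show ?case by (simp add: walks_0)
next
  case (Suc k)
  have *: "pw Z (butlast (x # r)) * f (last (butlast (x # r))) (last (x # r)) =
    Z x y * (pw Z (butlast r) * f (last (butlast r)) (last r))" if "r \<in> walks E k y u" for r u
    using walks_form[OF that] by auto
  have "(\<Sum>r\<in>walks E (Suc k) x y. pw Z (butlast r) * f (last (butlast r)) (last r)) =
    (\<Sum>u\<in>N x y. \<Sum>r\<in>walks E k y u. Z x y * (pw Z (butlast r) * f (last (butlast r)) (last r)))"
    unfolding sum_walks_Suc[of E, OF Suc.prems] N_def using * by (intro sum.cong refl) simp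
  also have "\<dots> = Z x y * (\<Sum>u\<in>N x y. f y u)"
    using Suc.IH by (simp add: sum_distrib_left[symmetric] N_def)
  also have "\<dots> = f x y" using f Suc.prems by (simp add: nb_eigen_def)
  finally show ?case by simp
qed

text \<open>At an edge where \<open>cmod f / sqrt m\<close> is maximal, expand over walks of length
  \<open>l\<close> and divide by the maximum: \<open>sqrt m\<close> is at most the sum of
  \<open>sqrt (edge_mass r)\<close> over the walks ending in the support. Two uses of Cauchy-Schwarz
  bound its fourth power by the cube of the number of these walks times the second moment of
  \<open>edge_mass\<close>.\<close>

lemma nb_eigen_support:
  assumes f: "nb_eigen f" and x0: "E x0 y0" "f x0 y0 \<noteq> 0"
    and few: "few_cycles E l" and t0: "t \<ge> 0"
    and t: "\<And>x y. E x y \<Longrightarrow> (\<Sum>u\<in>N x y. cmod (Z x y) powr (2 * 2) * m y u powr 2) \<le> t * m x y powr 2"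
  shows "1 \<le> (3 * real (card {(x, y). E x y \<and> f x y \<noteq> 0})) ^ 3 * t ^ l"
proof -
  define F where "F = (\<lambda>(x, y). cmod (f x y) / sqrt (m x y))"
  define Ed where "Ed = {(x, y). E x y}"
  have fin: "finite (F ` Ed)" "F ` Ed \<noteq> {}" using x0 by (auto simp: Ed_def)
  obtain e where e: "e \<in> Ed" "F e = Max (F ` Ed)"
    using Max_in[OF fin] by auto
  obtain x y where xy: "e = (x, y)" by (cases e)
  have Exy: "E x y" using e xy by (simp add: Ed_def)
  have Fmax: "F e' \<le> F e" if "e' \<in> Ed" for e' using that e fin by simp
  have "F (x0, y0) > 0" using x0 m_pos by (simp add: F_def)
  then have Fpos: "F e > 0" using Fmax[of "(x0, y0)"] x0 by (simp add: Ed_def)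
  define G where "G = {r \<in> walks E l x y. f (last (butlast r)) (last r) \<noteq> 0}"
  have finG: "finite G" unfolding G_def by (simp add: finite_walks)
  have "cmod (f x y) = cmod (\<Sum>r\<in>G. pw Z (butlast r) * f (last (butlast r)) (last r))"
    unfolding nb_eigen_iterate[OF f Exy, of l] G_def
    by (intro arg_cong[of _ _ cmod] sum.mono_neutral_right) (auto simp: finite_walks)
  also have "\<dots> \<le> (\<Sum>r\<in>G. cmod (pw Z (butlast r)) * cmod (f (last (butlast r)) (last r)))"
    by (rule order_trans[OF norm_sum]) (simp add: norm_mult)
  also have "\<dots> \<le> (\<Sum>r\<in>G. sqrt (edge_mass r) * F e)"
  proof (rule sum_mono)
    fix r assume r: "r \<in> G"
    then have adj: "E (last (butlast r)) (last r)" using last_edge_adj unfolding G_def by blast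
    have "cmod (f (last (butlast r)) (last r)) = sqrt (m (last (butlast r)) (last r)) * F (last (butlast r), last r)"
      using m_pos[OF adj] by (simp add: F_def)
    also have "\<dots> \<le> sqrt (m (last (butlast r)) (last r)) * F e"
      using Fmax adj m_pos[OF adj] by (intro mult_left_mono) (auto simp: Ed_def)
    finally have "cmod (pw Z (butlast r)) * cmod (f (last (butlast r)) (last r)) \<le>
      cmod (pw Z (butlast r)) * (sqrt (m (last (butlast r)) (last r)) * F e)"
      by (intro mult_left_mono) auto
    also have "\<dots> = sqrt (edge_mass r) * F e"
      by (simp add: edge_mass_def real_sqrt_mult)
    finally show "cmod (pw Z (butlast r)) * cmod (f (last (butlast r)) (last r)) \<le> sqrt (edge_mass r) * F e" .
  qed
  also have "\<dots> = (\<Sum>r\<in>G. sqrt (edge_mass r)) * F e" by (simp add: sum_distrib_right)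
  finally have "sqrt (m x y) * F e \<le> (\<Sum>r\<in>G. sqrt (edge_mass r)) * F e"
    using m_pos[OF Exy] xy by (simp add: F_def)
  then have le: "sqrt (m x y) \<le> (\<Sum>r\<in>G. sqrt (edge_mass r))" using Fpos by simp
  have mp: "m x y > 0" using m_pos[OF Exy] .
  have "(sqrt (m x y))\<^sup>2 \<le> (\<Sum>r\<in>G. sqrt (edge_mass r))\<^sup>2" using le mp by (intro power_mono) auto
  also have "\<dots> \<le> real (card G) * (\<Sum>r\<in>G. (sqrt (edge_mass r))\<^sup>2)" by (rule sum_power2_le_card)
  also have "(\<Sum>r\<in>G. (sqrt (edge_mass r))\<^sup>2) = (\<Sum>r\<in>G. edge_mass r)"
    using edge_mass_pos by (intro sum.cong refl) (auto simp: G_def)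
  finally have 1: "m x y \<le> real (card G) * (\<Sum>r\<in>G. edge_mass r)" using mp by simp
  have "(\<Sum>r\<in>G. (edge_mass r)\<^sup>2) \<le> (\<Sum>r\<in>walks E l x y. (edge_mass r)\<^sup>2)"
    unfolding G_def by (intro sum_mono2) (auto simp: finite_walks)
  also have "\<dots> = (\<Sum>r\<in>walks E l x y. edge_mass r powr 2)"
    using edge_mass_pos by (intro sum.cong refl) (simp add: powr_numeral)
  also have "\<dots> \<le> t ^ l * m x y powr 2" by (rule sum_edge_mass_powr_le[OF t Exy t0])
  also have "m x y powr 2 = (m x y)\<^sup>2" using mp by (simp add: powr_numeral)
  finally have 2: "(\<Sum>r\<in>G. (edge_mass r)\<^sup>2) \<le> t ^ l * (m x y)\<^sup>2" .
  have "(m x y)\<^sup>2 \<le> (real (card G) * (\<Sum>r\<in>G. edge_mass r))\<^sup>2" using 1 mp by (intro power_mono) auto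
  also have "\<dots> \<le> (real (card G))\<^sup>2 * (real (card G) * (\<Sum>r\<in>G. (edge_mass r)\<^sup>2))"
    unfolding power_mult_distrib by (intro mult_left_mono sum_power2_le_card) auto
  also have "\<dots> \<le> (real (card G))\<^sup>2 * (real (card G) * (t ^ l * (m x y)\<^sup>2))"
    using 2 by (intro mult_left_mono) auto
  finally have "(m x y)\<^sup>2 \<le> (m x y)\<^sup>2 * (real (card G) ^ 3 * t ^ l)"
    by (simp add: power2_eq_square power3_eq_cube ac_simps)
  then have "1 \<le> real (card G) ^ 3 * t ^ l" using mp by simp
  also have "\<dots> \<le> (3 * real (card {(x, y). E x y \<and> f x y \<noteq> 0})) ^ 3 * t ^ l"
  proof (intro mult_right_mono power_mono)
    let ?S = "{(x, y). E x y \<and> f x y \<noteq> 0}"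
    let ?T = "\<lambda>e. {r \<in> walks E l x y. last (butlast r) = fst e \<and> last r = snd e}"
    have "G \<subseteq> (\<Union>e\<in>?S. ?T e)"
    proof
      fix r assume r: "r \<in> G"
      then have "E (last (butlast r)) (last r)" using last_edge_adj unfolding G_def by blast
      then show "r \<in> (\<Union>e\<in>?S. ?T e)"
        using r unfolding G_def by (intro UN_I[of "(last (butlast r), last r)"]) auto
    qed
    then have "card G \<le> card (\<Union>e\<in>?S. ?T e)" by (intro card_mono) (auto simp: finite_walks)
    also have "\<dots> \<le> (\<Sum>e\<in>?S. card (?T e))" by (rule card_UN_le) simp
    also have "\<dots> \<le> (\<Sum>e\<in>?S. 3)"
    proof (rule sum_mono)
      fix e
      \<comment> \<open>All these walks share the first edge, so the first vertex may be dropped.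
        What remains has \<open>l\<close> edges, just within the range of the multiplicity
        bound.\<close>
      have "card (?T e) = card (tl ` ?T e)"
      proof (rule card_image[symmetric], rule inj_onI)
        fix q r assume "q \<in> ?T e" "r \<in> ?T e" and tl: "tl q = tl r"
        then obtain q' r' where "q = x # y # q'" "r = x # y # r'" using walks_form by (metis (mono_tags, lifting) mem_Collect_eq)
        then show "q = r" using tl by simp
      qed
      also have "\<dots> \<le> card {r. (nbw E r \<and> hd r = y \<and> last r = snd e) \<and> length r = Suc l}"
      proof (intro card_mono finite_lists_length subsetI)
        fix q assume "q \<in> tl ` ?T e"
        then obtain r where r: "r \<in> walks E l x y" "last r = snd e" "q = tl r" by auto
        then obtain q' where "r = x # y # q'" "length q' = l" using walks_form[OF r(1)] by auto
        then show "q \<in> {r. (nbw E r \<and> hd r = y \<and> last r = snd e) \<and> length r = Suc l}"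
          using r nbw_ConsD[of E x "y # q'"] by (simp add: walks_def)
      qed
      also have "\<dots> \<le> 3" using E_sym E_irrefl few by (intro card_nbw_few_cycles) auto
      finally show "card (?T e) \<le> 3" .
    qed
    finally show "real (card G) \<le> 3 * real (card ?S)" by (simp add: mult.commute)
  qed (use t0 in auto)
  finally show ?thesis .
qed

end

subsection \<open>Young's inequality and reversal of walks\<close>

text \<open>Tangent line of the exponential at the weighted mean \<open>M\<close> of the logarithms.
  The weights sum to one, so the linear terms cancel.\<close>

lemma weighted_amgm3:
  fixes x y w :: real
  assumes "x > 0" "y > 0" "w > 0" "\<alpha> \<ge> 0" "\<beta> \<ge> 0" "2 * \<alpha> + \<beta> = 1"
  shows "x powr \<alpha> * y powr \<alpha> * w powr \<beta> \<le> \<alpha> * x + \<alpha> * y + \<beta> * w"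
proof -
  define M where "M = \<alpha> * ln x + \<alpha> * ln y + \<beta> * ln w"
  have tangent: "v \<ge> exp M * (1 + (ln v - M))" if "v > 0" for v
  proof -
    have "v = exp M * exp (ln v - M)" using that by (simp flip: exp_add)
    also have "\<dots> \<ge> exp M * (1 + (ln v - M))" by (intro mult_left_mono exp_ge_add_one_self) auto
    finally show ?thesis by simp
  qed
  have "\<alpha> * x + \<alpha> * y + \<beta> * w \<ge> \<alpha> * (exp M * (1 + (ln x - M))) + \<alpha> * (exp M * (1 + (ln y - M))) + \<beta> * (exp M * (1 + (ln w - M)))"
    using assms tangent by (intro add_mono mult_left_mono) auto
  also have "\<alpha> * (exp M * (1 + (ln x - M))) + \<alpha> * (exp M * (1 + (ln y - M))) + \<beta> * (exp M * (1 + (ln w - M)))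
    = exp M * ((2 * \<alpha> + \<beta>) * (1 - M) + M)" by (simp add: M_def algebra_simps)
  also have "\<dots> = exp M" using assms by simp
  also have "\<dots> = x powr \<alpha> * y powr \<alpha> * w powr \<beta>"
    using assms by (simp add: M_def powr_def exp_add)
  finally show ?thesis .
qed

text \<open>The product is split into three factors with weights \<open>1 / p\<close>,
  \<open>1 / p\<close> and \<open>1 - 2 / p\<close>, chosen so that the powers \<open>q\<close> of
  \<open>a\<close> and \<open>b\<close> and \<open>p / 2\<close> of \<open>k\<close> return to the
  first power. Dividing \<open>k\<close> by \<open>C\<close> normalises the kernel sums.\<close>

lemma young_pointwise:
  fixes a b k p C :: real
  assumes p: "p > 2" and a: "a \<ge> 0" and b: "b \<ge> 0" and k: "k \<ge> 0" and C: "C > 0"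
  defines "q \<equiv> p / (p - 1)"
  shows "a * b * k \<le> C * ((1 / p) * (a powr q * (k powr (p / 2) / C powr (p / 2)))
     + (1 / p) * (b powr q * (k powr (p / 2) / C powr (p / 2))) + (1 - 2 / p) * (a powr q * b powr q))"
proof (cases "a = 0 \<or> b = 0 \<or> k = 0")
  case True
  have "0 \<le> C * ((1 / p) * (a powr q * (k powr (p / 2) / C powr (p / 2)))
     + (1 / p) * (b powr q * (k powr (p / 2) / C powr (p / 2))) + (1 - 2 / p) * (a powr q * b powr q))"
    using p C by (intro mult_nonneg_nonneg add_nonneg_nonneg) auto
  then show ?thesis using True by auto
next
  case False
  then have pos: "a > 0" "b > 0" "k > 0" using a b k by auto
  define \<tau> where "\<tau> = k / C"
  have \<tau>: "\<tau> > 0" using pos C by (simp add: \<tau>_def)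
  have tp: "k powr (p / 2) / C powr (p / 2) = \<tau> powr (p / 2)" using pos C by (simp add: \<tau>_def powr_divide)
  have e1: "q * (1 / p) + q * (1 - 2 / p) = 1"
  proof -
    have "q * (1 / p) + q * (1 - 2 / p) = q * ((p - 1) / p)" using p by (simp add: field_simps)
    also have "\<dots> = 1" using p by (simp add: q_def)
    finally show ?thesis .
  qed
  have "(a powr q * \<tau> powr (p / 2)) powr (1 / p) * (b powr q * \<tau> powr (p / 2)) powr (1 / p) * (a powr q * b powr q) powr (1 - 2 / p)
    = (a powr (q * (1 / p)) * a powr (q * (1 - 2 / p))) * (b powr (q * (1 / p)) * b powr (q * (1 - 2 / p))) * (\<tau> powr (p / 2 * (1 / p)) * \<tau> powr (p / 2 * (1 / p)))"
    using pos \<tau> by (simp only: powr_mult powr_powr powr_ge_zero ac_simps)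
  also have "\<dots> = a powr 1 * b powr 1 * \<tau> powr 1"
    unfolding powr_add[symmetric] e1 using p by simp
  also have "\<dots> = a * b * \<tau>" using pos \<tau> by simp
  finally have "a * b * \<tau> \<le> (1 / p) * (a powr q * \<tau> powr (p / 2)) + (1 / p) * (b powr q * \<tau> powr (p / 2)) + (1 - 2 / p) * (a powr q * b powr q)"
    using weighted_amgm3[of "a powr q * \<tau> powr (p / 2)" "b powr q * \<tau> powr (p / 2)" "a powr q * b powr q" "1 / p" "1 - 2 / p"] pos \<tau> p
    by simp
  then have "C * (a * b * \<tau>) \<le> C * ((1 / p) * (a powr q * \<tau> powr (p / 2)) + (1 / p) * (b powr q * \<tau> powr (p / 2)) + (1 - 2 / p) * (a powr q * b powr q))"
    using C by (intro mult_left_mono) auto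
  moreover have "C * (a * b * \<tau>) = a * b * k" using C by (simp add: \<tau>_def)
  ultimately show ?thesis unfolding tp by simp
qed

text \<open>Young's inequality for a kernel given as a family with two end maps, so that several
  walks with the same ends stay separate. The multiplicity enters the term without the kernel, and
  \<open>1 / p + 1 / p + 3 * (1 - 2 / p)\<close> is at most three.\<close>

lemma young_multiplicity:
  fixes \<Delta> :: "'d set" and \<sigma> \<tau> :: "'d \<Rightarrow> 'e::finite" and \<kappa> :: "'d \<Rightarrow> real" and \<phi> :: "'e \<Rightarrow> real"
  assumes p: "p > 2" and C: "C > 0" and fin: "finite \<Delta>"
    and \<kappa>: "\<And>d. d \<in> \<Delta> \<Longrightarrow> \<kappa> d \<ge> 0" and \<phi>: "\<And>e. \<phi> e \<ge> 0"
    and norm: "(\<Sum>e\<in>UNIV. \<phi> e powr (p / (p - 1))) \<le> 1"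
    and row: "\<And>e. (\<Sum>d\<in>{d\<in>\<Delta>. \<sigma> d = e}. \<kappa> d powr (p / 2)) \<le> C powr (p / 2)"
    and col: "\<And>e. (\<Sum>d\<in>{d\<in>\<Delta>. \<tau> d = e}. \<kappa> d powr (p / 2)) \<le> C powr (p / 2)"
    and mult: "\<And>e e'. card {d\<in>\<Delta>. \<sigma> d = e \<and> \<tau> d = e'} \<le> 3"
  shows "(\<Sum>d\<in>\<Delta>. \<phi> (\<sigma> d) * \<phi> (\<tau> d) * \<kappa> d) \<le> 3 * C"
proof -
  define q where "q = p / (p - 1)"
  define \<Phi> where "\<Phi> e = \<phi> e powr q" for e
  define k where "k d = \<kappa> d powr (p / 2) / C powr (p / 2)" for d
  have \<Phi>0: "\<Phi> e \<ge> 0" for e by (simp add: \<Phi>_def)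
  have \<Phi>1: "(\<Sum>e\<in>UNIV. \<Phi> e) \<le> 1" using norm by (simp add: \<Phi>_def q_def)
  have marg: "(\<Sum>d\<in>\<Delta>. \<Phi> (\<sigma> d) * k d) \<le> 1"
    if r: "\<And>e. (\<Sum>d\<in>{d\<in>\<Delta>. \<sigma> d = e}. \<kappa> d powr (p / 2)) \<le> C powr (p / 2)" for \<sigma> :: "'d \<Rightarrow> 'e"
  proof -
    have "(\<Sum>d\<in>\<Delta>. \<Phi> (\<sigma> d) * k d) = (\<Sum>e\<in>UNIV. \<Sum>d\<in>{d\<in>\<Delta>. \<sigma> d = e}. \<Phi> (\<sigma> d) * k d)"
      by (rule sum.group[symmetric]) (use fin in auto)
    also have "\<dots> = (\<Sum>e\<in>UNIV. \<Phi> e * ((\<Sum>d\<in>{d\<in>\<Delta>. \<sigma> d = e}. \<kappa> d powr (p / 2)) / C powr (p / 2)))"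
      by (intro sum.cong refl) (simp add: k_def sum_distrib_left sum_divide_distrib)
    also have "\<dots> \<le> (\<Sum>e\<in>UNIV. \<Phi> e * 1)"
      using r C \<Phi>0 by (intro sum_mono mult_left_mono) (auto simp: divide_le_eq)
    finally show ?thesis using \<Phi>1 by simp
  qed
  have "(\<Sum>d\<in>\<Delta>. \<Phi> (\<sigma> d) * \<Phi> (\<tau> d)) = (\<Sum>e\<in>UNIV. \<Sum>d\<in>{d\<in>\<Delta>. (\<sigma> d, \<tau> d) = e}. \<Phi> (\<sigma> d) * \<Phi> (\<tau> d))"
    by (rule sum.group[symmetric]) (use fin in auto)
  also have "\<dots> = (\<Sum>e\<in>UNIV. real (card {d\<in>\<Delta>. \<sigma> d = fst e \<and> \<tau> d = snd e}) * (\<Phi> (fst e) * \<Phi> (snd e)))"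
    by (intro sum.cong refl) (auto simp: prod_eq_iff)
  also have "\<dots> \<le> (\<Sum>e\<in>UNIV. 3 * (\<Phi> (fst e) * \<Phi> (snd e)))"
  proof (intro sum_mono mult_right_mono)
    fix e
    show "real (card {d \<in> \<Delta>. \<sigma> d = fst e \<and> \<tau> d = snd e}) \<le> 3"
      using of_nat_mono[OF mult[of "fst e" "snd e"], where 'a=real] by simp
  qed (use \<Phi>0 in auto)
  also have "\<dots> = 3 * ((\<Sum>e\<in>UNIV. \<Phi> e) * (\<Sum>e\<in>UNIV. \<Phi> e))"
  proof -
    have "(\<Sum>e\<in>UNIV. \<Phi> (fst e) * \<Phi> (snd e)) = (\<Sum>e\<in>UNIV. \<Phi> e) * (\<Sum>e\<in>UNIV. \<Phi> e)"
      unfolding sum_product sum.cartesian_product UNIV_Times_UNIV by (simp add: case_prod_beta')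
    then show ?thesis by (simp add: sum_distrib_left[symmetric])
  qed
  also have "\<dots> \<le> 3 * (1 * 1)" using \<Phi>1 \<Phi>0 by (intro mult_left_mono mult_mono sum_nonneg) auto
  finally have cross: "(\<Sum>d\<in>\<Delta>. \<Phi> (\<sigma> d) * \<Phi> (\<tau> d)) \<le> 3" by simp
  have "(\<Sum>d\<in>\<Delta>. \<phi> (\<sigma> d) * \<phi> (\<tau> d) * \<kappa> d) \<le>
    (\<Sum>d\<in>\<Delta>. C * ((1 / p) * (\<Phi> (\<sigma> d) * k d) + (1 / p) * (\<Phi> (\<tau> d) * k d) + (1 - 2 / p) * (\<Phi> (\<sigma> d) * \<Phi> (\<tau> d))))"
    unfolding \<Phi>_def k_def q_def using \<phi> \<kappa> p C by (intro sum_mono young_pointwise) auto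
  also have "\<dots> = C * ((1 / p) * (\<Sum>d\<in>\<Delta>. \<Phi> (\<sigma> d) * k d) + (1 / p) * (\<Sum>d\<in>\<Delta>. \<Phi> (\<tau> d) * k d) + (1 - 2 / p) * (\<Sum>d\<in>\<Delta>. \<Phi> (\<sigma> d) * \<Phi> (\<tau> d)))"
    by (simp only: sum_distrib_left[symmetric] sum.distrib)
  also have "\<dots> \<le> C * ((1 / p) * 1 + (1 / p) * 1 + (1 - 2 / p) * 3)"
    using marg[OF row] marg[OF col] cross p C by (intro mult_left_mono add_mono) auto
  also have "\<dots> \<le> C * 3" using p C by (intro mult_left_mono) (auto simp: field_simps)
  finally show ?thesis by simp
qed

section \<open>Comparison of a walk with its reversal\<close>

context zeta_graph
begin

text \<open>Formally minus the inverse of the diagonal Green function of the whole cover above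
  \<open>y\<close>, at energy \<open>lam\<close>: the recursion with no neighbour left out.\<close>

definition green_inv :: "'a \<Rightarrow> complex" where
  "green_inv y = complex_of_real lam - complex_of_real (W y) - (\<Sum>u\<in>{u. E y u}. Z y u)"

lemma green_inv_split: "E x y \<Longrightarrow> green_inv y = 1 / Z x y - Z y x"
proof -
  assume xy: "E x y"
  have "{u. E y u} = insert x {u. E y u \<and> u \<noteq> x}" using E_sym xy by auto
  then have "(\<Sum>u\<in>{u. E y u}. Z y u) = Z y x + (\<Sum>u\<in>{u. E y u \<and> u \<noteq> x}. Z y u)" by simp
  moreover have "complex_of_real lam - complex_of_real (W y) - (\<Sum>u\<in>{u. E y u \<and> u \<noteq> x}. Z y u) = 1 / Z x y"
    using rec[OF xy] Z_nz[OF xy] by (simp add: field_simps)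
  ultimately show ?thesis unfolding green_inv_def by (simp add: algebra_simps)
qed

lemma green_inv_mult: "E x y \<Longrightarrow> Z x y * green_inv y = 1 - Z x y * Z y x"
  using green_inv_split[of x y] Z_nz[of x y] by (simp add: right_diff_distrib)

text \<open>Both sides equal \<open>1 - Z x y * Z y x\<close>. This expresses the symmetry of the
  Green function at adjacent vertices, and it telescopes along walks.\<close>

lemma green_inv_swap: "E x y \<Longrightarrow> Z x y * green_inv y = Z y x * green_inv x"
  using green_inv_mult[of x y] green_inv_mult[of y x] E_sym[of x y] by (simp add: mult.commute)

lemma Im_green_inv: "Im (green_inv y) = (\<Sum>u\<in>{u. E y u}. m y u)"
  by (simp add: green_inv_def m_def sum_negf)

lemma cmod_green_inv_ge:
  assumes "B \<subseteq> {u. E y u}" shows "(\<Sum>u\<in>B. m y u) \<le> cmod (green_inv y)"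
proof -
  have "(\<Sum>u\<in>B. m y u) \<le> (\<Sum>u\<in>{u. E y u}. m y u)"
    using assms m_pos by (intro sum_mono2) (auto simp: less_imp_le)
  then show ?thesis using Im_green_inv[of y] abs_Im_le_cmod[of "green_inv y"] by linarith
qed

lemma cmod_green_inv_pos: "cmod (green_inv y) > 0"
proof -
  obtain u where "E y u" using ex_adj by blast
  then show ?thesis using cmod_green_inv_ge[of "{u}" y] m_pos[of y u] by (simp del: zero_less_norm_iff)
qed

lemma cmod_green_inv_le: "cmod (green_inv y) \<le> 3 / (2 * zm)"
proof -
  obtain x where "E y x" using ex_adj by blast
  then have xy: "E x y" "E y x" using E_sym by auto
  have "zm \<le> cmod (Z x y)" using zm_le_m[OF xy(1)] m_le_cmod[OF xy(1)] by linarith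
  then have "cmod (1 / Z x y) \<le> 1 / zm" using zm_pos by (simp add: norm_divide frac_le)
  then have "cmod (green_inv y) \<le> 1 / zm + 1 / (2 * zm)"
    using green_inv_split[OF xy(1)] norm_triangle_ineq4[of "1 / Z x y" "Z y x"] cmod_Z_le[OF xy(2)] by simp
  also have "\<dots> = 3 / (2 * zm)" using zm_pos by (simp add: field_simps)
  finally show ?thesis .
qed

lemma pw_rev:
  "nbw E q \<Longrightarrow> q \<noteq> [] \<Longrightarrow> pw Z q * green_inv (last q) = pw Z (rev q) * green_inv (hd q)"
proof (induction q rule: induct_list012)
  case (3 x y q)
  have IH: "pw Z (y # q) * green_inv (last (y # q)) = pw Z (rev (y # q)) * green_inv y"
    using 3 nbw_ConsD by fastforce
  have "pw Z (x # y # q) * green_inv (last (x # y # q)) = Z x y * (pw Z (rev (y # q)) * green_inv y)"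
    using IH by simp
  also have "\<dots> = pw Z (rev (y # q)) * (Z y x * green_inv x)"
    using green_inv_swap[OF nbw_Cons_adj[OF 3(3)]] by (simp add: algebra_simps)
  also have "\<dots> = pw Z (rev (x # y # q)) * green_inv x"
    using pw_snoc[of "rev (y # q)" Z x] by simp
  finally show ?case by simp
qed auto

lemma cmod_pw_sq_le:
  assumes r: "r \<in> walks E k x y" shows "(cmod (pw Z r))\<^sup>2 \<le> edge_mass r / (2 * zm)"
proof -
  obtain q where q: "r = x # y # q" using walks_form[OF r] by blast
  have "r = butlast r @ [last r]" "butlast r \<noteq> []" using q by auto
  then have "pw Z r = pw Z (butlast r) * Z (last (butlast r)) (last r)" using pw_snoc by metis
  then have "(cmod (pw Z r))\<^sup>2 = (cmod (pw Z (butlast r)))\<^sup>2 * (cmod (Z (last (butlast r)) (last r)))\<^sup>2"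
    by (simp add: norm_mult power_mult_distrib)
  also have "\<dots> \<le> (cmod (pw Z (butlast r)))\<^sup>2 * (m (last (butlast r)) (last r) / (2 * zm))"
    by (intro mult_left_mono cmod_Z_sq_le last_edge_adj[OF r]) auto
  finally show ?thesis by (simp add: edge_mass_def)
qed

lemma edge_mass_rev_eq:
  assumes "r \<in> walks E k y x" shows "edge_mass (rev r) = (cmod (pw Z (rev (tl r))))\<^sup>2 * m x y"
  using walks_form[OF assms] by (auto simp: edge_mass_def butlast_append)

text \<open>The moment bound concerns walks leaving a given edge; sums over walks arriving at a
  given edge require reversal. Its cost is a ratio of values of \<open>green_inv\<close> at the
  ends. The constant is \<open>1 / (2 * zm)\<close>, from the last edge, times the square of the
  upper bound \<open>3 / (2 * zm)\<close> for \<open>green_inv\<close>.\<close>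

lemma edge_mass_rev_le:
  assumes r: "r \<in> walks E k x y"
  shows "edge_mass (rev r) * m x y \<le> 9 / (8 * zm ^ 3) * edge_mass r"
proof -
  obtain q where q: "r = x # y # q" using walks_form[OF r] by blast
  have xy: "E x y" "E y x" using walks_adj[OF r] E_sym by auto
  define g where "g = green_inv"
  have nb: "nbw E (tl r)" using r q nbw_ConsD unfolding walks_def by auto
  have "nbw E (rev (tl r))" using nb E_sym by (intro nbw_rev) auto
  then have "pw Z (rev (tl r)) * g y = pw Z (tl r) * g (last r)"
    using pw_rev[of "rev (tl r)"] q by (simp add: g_def hd_rev)
  then have 1: "(cmod (pw Z (rev (tl r))))\<^sup>2 * (cmod (g y))\<^sup>2 = (cmod (pw Z (tl r)))\<^sup>2 * (cmod (g (last r)))\<^sup>2"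
    by (metis norm_mult power_mult_distrib)
  have S: "(\<Sum>u\<in>N x y. m y u) \<le> cmod (g y)" unfolding g_def by (intro cmod_green_inv_ge) (auto simp: N_def)
  have myx: "m y x \<le> cmod (g y)" using cmod_green_inv_ge[of "{x}" y] xy by (simp add: g_def)
  have gy: "cmod (g y) > 0" by (simp add: g_def cmod_green_inv_pos del: zero_less_norm_iff)
  \<comment> \<open>Both \<open>m y x\<close> and the outgoing sum at \<open>y\<close> are at most
    \<open>cmod (g y)\<close>. The resulting square cancels the one produced by reversal.\<close>
  have "m y x * m x y = (cmod (Z x y))\<^sup>2 * (m y x * (\<Sum>u\<in>N x y. m y u))"
    using flow[OF xy(1)] by (simp add: algebra_simps)
  also have "\<dots> \<le> (cmod (Z x y))\<^sup>2 * (cmod (g y) * cmod (g y))"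
    using S myx m_pos[OF xy(2)] sum_m_ge[where x=x and y=y] zm_pos by (intro mult_left_mono mult_mono) auto
  finally have 2: "m y x * m x y \<le> (cmod (Z x y))\<^sup>2 * (cmod (g y))\<^sup>2" by (simp add: power2_eq_square)
  have "edge_mass (rev r) * m x y * (cmod (g y))\<^sup>2 = ((cmod (pw Z (rev (tl r))))\<^sup>2 * (cmod (g y))\<^sup>2) * (m y x * m x y)"
    using edge_mass_rev_eq[OF r] by simp
  also have "\<dots> \<le> ((cmod (pw Z (tl r)))\<^sup>2 * (cmod (g (last r)))\<^sup>2) * ((cmod (Z x y))\<^sup>2 * (cmod (g y))\<^sup>2)"
    unfolding 1 using 2 by (intro mult_left_mono) auto
  also have "\<dots> = (cmod (pw Z r))\<^sup>2 * (cmod (g (last r)))\<^sup>2 * (cmod (g y))\<^sup>2"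
    using q by (simp add: norm_mult power_mult_distrib)
  finally have "edge_mass (rev r) * m x y \<le> (cmod (pw Z r))\<^sup>2 * (cmod (g (last r)))\<^sup>2"
    by (rule mult_right_le_imp_le) (use gy in \<open>auto intro: zero_less_power\<close>)
  also have "\<dots> \<le> (edge_mass r / (2 * zm)) * (3 / (2 * zm))\<^sup>2"
    using cmod_pw_sq_le[OF r] cmod_green_inv_le edge_mass_pos[OF r] zm_pos
    by (intro mult_mono power_mono) (auto simp: g_def)
  also have "\<dots> = 9 / (8 * zm ^ 3) * edge_mass r"
    by (simp add: power2_eq_square power3_eq_cube)
  finally show ?thesis .
qed

lemma rev_walks:
  assumes "r \<in> walks E k x y" shows "rev r \<in> walks E k (last r) (last (butlast r))"
proof -
  obtain q where q: "r = x # y # q" "length q = k" using walks_form[OF assms] by blast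
  have nb: "nbw E (rev r)" using assms E_sym by (intro nbw_rev) (auto simp: walks_def)
  have "rev r ! 1 = last (butlast r)"
    using q by (cases "y # q" rule: rev_cases; cases q rule: rev_cases) (auto simp: rev_nth butlast_append nth_append last_conv_nth)
  then show ?thesis using nb q by (auto simp: walks_def hd_rev)
qed

lemma edge_sum_swap:
  "(\<Sum>y\<in>UNIV. \<Sum>x\<in>{x. E y x}. F x y) = (\<Sum>y\<in>UNIV. \<Sum>x\<in>{x. E y x}. F y x :: 'b::comm_monoid_add)"
proof -
  have "(\<Sum>y\<in>UNIV. \<Sum>x\<in>{x. E y x}. F x y) = (\<Sum>y\<in>UNIV. \<Sum>x\<in>{x\<in>UNIV. E y x}. F x y)" by simp
  also have "\<dots> = (\<Sum>x\<in>UNIV. \<Sum>y\<in>{y\<in>UNIV. E y x}. F x y)" by (rule sum.swap_restrict) auto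
  also have "\<dots> = (\<Sum>x\<in>UNIV. \<Sum>y\<in>{y. E x y}. F x y)"
    using E_sym by (intro sum.cong) auto
  finally show ?thesis .
qed

lemma edge_mass_rev_pos: "r \<in> walks E k x y \<Longrightarrow> edge_mass (rev r) \<ge> 0"
  using rev_walks edge_mass_pos by blast

end

subsection \<open>The dual norm estimate\<close>

lemma sum_pairs_swap:
  assumes "finite A"
  shows "(\<Sum>z\<in>A. \<Sum>x\<in>A - {z}. F z x) = (\<Sum>x\<in>A. \<Sum>z\<in>A - {x}. F z x :: 'b::comm_monoid_add)"
proof -
  have "(\<Sum>z\<in>A. \<Sum>x\<in>A - {z}. F z x) = (\<Sum>z\<in>A. \<Sum>x\<in>{x\<in>A. x \<noteq> z}. F z x)"
    by (intro sum.cong refl) auto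
  also have "\<dots> = (\<Sum>x\<in>A. \<Sum>z\<in>{z\<in>A. x \<noteq> z}. F z x)"
    using assms by (intro sum.swap_restrict) auto
  also have "\<dots> = (\<Sum>x\<in>A. \<Sum>z\<in>A - {x}. F z x)"
    by (intro sum.cong refl) auto
  finally show ?thesis .
qed

text \<open>Expansion according to whether the two factors pick the same index. Equal indices stand
  for two walks arriving over the same edge, different ones for two walks that merge at the
  vertex.\<close>

lemma sum_product_off_diagonal:
  fixes a b c :: "'b \<Rightarrow> complex"
  assumes A: "finite A"
  shows "(\<Sum>z\<in>A. c z * ((\<Sum>x\<in>A - {z}. a x) * (\<Sum>x\<in>A - {z}. b x))) =
    (\<Sum>x\<in>A. a x * b x * (\<Sum>z\<in>A - {x}. c z)) +
    (\<Sum>x\<in>A. \<Sum>x'\<in>A - {x}. a x * b x' * (\<Sum>z\<in>A - {x, x'}. c z))"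
proof -
  have "(\<Sum>z\<in>A. c z * ((\<Sum>x\<in>A - {z}. a x) * (\<Sum>x\<in>A - {z}. b x))) =
    (\<Sum>z\<in>A. \<Sum>x\<in>A - {z}. \<Sum>x'\<in>A - {z}. c z * (a x * b x'))"
    unfolding sum_product by (simp only: sum_distrib_left)
  also have "\<dots> = (\<Sum>x\<in>A. \<Sum>z\<in>A - {x}. \<Sum>x'\<in>A - {z}. c z * (a x * b x'))"
    by (rule sum_pairs_swap[OF A])
  also have "\<dots> = (\<Sum>x\<in>A. (\<Sum>z\<in>A - {x}. c z * (a x * b x)) + (\<Sum>z\<in>A - {x}. \<Sum>x'\<in>(A - {x}) - {z}. c z * (a x * b x')))"
  proof (intro sum.cong refl)
    fix x assume x: "x \<in> A"
    have "(\<Sum>x'\<in>A - {z}. c z * (a x * b x')) = c z * (a x * b x) + (\<Sum>x'\<in>(A - {x}) - {z}. c z * (a x * b x'))"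
      if "z \<in> A - {x}" for z
    proof -
      have "A - {z} = insert x ((A - {x}) - {z})" using x that by auto
      then show ?thesis using A by (simp add: sum.insert_remove)
    qed
    then show "(\<Sum>z\<in>A - {x}. \<Sum>x'\<in>A - {z}. c z * (a x * b x')) =
      (\<Sum>z\<in>A - {x}. c z * (a x * b x)) + (\<Sum>z\<in>A - {x}. \<Sum>x'\<in>(A - {x}) - {z}. c z * (a x * b x'))"
      by (simp add: sum.distrib)
  qed
  also have "\<dots> = (\<Sum>x\<in>A. (\<Sum>z\<in>A - {x}. c z * (a x * b x)) + (\<Sum>x'\<in>A - {x}. \<Sum>z\<in>(A - {x}) - {x'}. c z * (a x * b x')))"
    using A by (subst sum_pairs_swap) auto
  also have "\<dots> = (\<Sum>x\<in>A. a x * b x * (\<Sum>z\<in>A - {x}. c z)) +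
    (\<Sum>x\<in>A. \<Sum>x'\<in>A - {x}. a x * b x' * (\<Sum>z\<in>A - {x, x'}. c z))"
  proof -
    have "A - {x} - {x'} = A - {x, x'}" for x x' by auto
    then show ?thesis by (simp add: sum.distrib sum_distrib_left mult.commute)
  qed
  finally show ?thesis .
qed

lemma sqrt_powr_double: "v \<ge> 0 \<Longrightarrow> sqrt v powr (2 * s) = v powr s"
  by (simp add: powr_half_sqrt[symmetric] powr_powr)

text \<open>To be used with \<open>s = p / 4\<close> and \<open>t = Zs E W s lam\<close>, so that
  \<open>4 * s\<close> is the exponent of the norm.\<close>

locale zeta_graph_norm = zeta_graph +
  fixes s t D :: real and l :: nat
  assumes s1: "s > 1" and t0: "t > 0" and t1: "t < 1"
    and t_bound: "E x y \<Longrightarrow> (\<Sum>u\<in>N x y. cmod (Z x y) powr (2 * s) * m y u powr s) \<le> t * m x y powr s"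
    and D: "real (deg E x) \<le> D" and few: "few_cycles E l"
begin

section \<open>Moments of reversed walks and the constants\<close>

definition all_walks :: "nat \<Rightarrow> 'a list set" where
  "all_walks k = {r. nbw E r \<and> length r = k + 2}"

lemma finite_all_walks: "finite (all_walks k)"
  unfolding all_walks_def by (rule finite_lists_length)

lemma all_walks_in: "r \<in> all_walks k \<Longrightarrow> r \<in> walks E k (hd r) (r ! 1)"
  by (simp add: all_walks_def walks_def)

lemma all_walks_UN: "all_walks k = (\<Union>y. \<Union>x. walks E k y x)"
  by (auto simp: all_walks_def walks_def)

lemma sum_all_walks: "(\<Sum>r\<in>all_walks k. G r) = (\<Sum>y\<in>UNIV. \<Sum>x\<in>UNIV. \<Sum>r\<in>walks E k y x. G r)"
proof -
  have "(\<Sum>r\<in>all_walks k. G r) = (\<Sum>y\<in>UNIV. \<Sum>r\<in>(\<Union>x. walks E k y x). G r)"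
    unfolding all_walks_UN by (rule sum.UNION_disjoint) (auto simp: finite_walks, auto simp: walks_def)
  also have "\<dots> = (\<Sum>y\<in>UNIV. \<Sum>x\<in>UNIV. \<Sum>r\<in>walks E k y x. G r)"
    by (intro sum.cong refl sum.UNION_disjoint) (auto simp: finite_walks, auto simp: walks_def)
  finally show ?thesis .
qed

text \<open>The kernel moment in Young's inequality has order \<open>2 * s\<close>, so a bound
  \<open>t ^ n\<close> for it becomes a factor \<open>\<rho> ^ n\<close> for the kernel
  itself.\<close>

definition \<rho> :: real where "\<rho> = t powr (1 / (2 * s))"

text \<open>Chosen so that \<open>C0 powr (2 * s)\<close> absorbs the degree together with any
  factor up to \<open>(1 / zm ^ 4) powr s\<close>, as in \<open>const_le\<close>.\<close>

definition C0 :: real where "C0 = D * (1 / zm\<^sup>2)"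

lemma rho_pos: "\<rho> > 0" and rho_less: "\<rho> < 1"
proof -
  show "\<rho> > 0" using t0 by (simp add: \<rho>_def)
  have "t powr (1 / (2 * s)) < 1 powr (1 / (2 * s))"
    using t0 t1 s1 by (intro powr_less_mono2) auto
  then show "\<rho> < 1" by (simp add: \<rho>_def)
qed

lemma D1: "D \<ge> 1"
proof -
  have "3 \<le> real (deg E undefined)" using of_nat_mono[OF deg3, where 'a=real] by simp
  then show ?thesis using D[of undefined] by linarith
qed

lemma C0_pos: "C0 > 0"
  using D1 zm_pos by (simp add: C0_def)

lemma C_powr: "(C0 * \<rho> ^ n) powr (2 * s) = C0 powr (2 * s) * t ^ n"
proof -
  have "(\<rho> ^ n) powr (2 * s) = (\<rho> powr real n) powr (2 * s)" using rho_pos by (simp add: powr_realpow)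
  also have "\<dots> = t powr (1 / (2 * s) * real n * (2 * s))" by (simp add: \<rho>_def powr_powr)
  also have "\<dots> = t ^ n" using s1 t0 by (simp add: powr_realpow)
  finally show ?thesis using C0_pos rho_pos by (simp add: powr_mult)
qed

lemma const_le:
  assumes "0 \<le> c" "c \<le> 1 / zm ^ 4"
  shows "c powr s * D \<le> C0 powr (2 * s)"
proof -
  have "c powr s \<le> (1 / zm ^ 4) powr s" using assms s1 by (intro powr_mono2) auto
  also have "1 / zm ^ 4 = (1 / zm\<^sup>2) powr 2" using zm_pos by (simp add: powr_numeral power_divide)
  also have "((1 / zm\<^sup>2) powr 2) powr s = (1 / zm\<^sup>2) powr (2 * s)" by (simp only: powr_powr)
  finally have 1: "c powr s \<le> (1 / zm\<^sup>2) powr (2 * s)" .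
  have "D = D powr 1" using D1 by simp
  also have "\<dots> \<le> D powr (2 * s)" using D1 s1 by (intro powr_mono) auto
  finally have 2: "D \<le> D powr (2 * s)" .
  have "c powr s * D \<le> (1 / zm\<^sup>2) powr (2 * s) * D powr (2 * s)" using 1 2 D1 by (intro mult_mono) auto
  also have "\<dots> = C0 powr (2 * s)" unfolding C0_def using D1 by (subst powr_mult) (auto simp: mult.commute)
  finally show ?thesis .
qed

lemma const_le_zm4: "1 / (2 * zm) * (9 / (8 * zm ^ 3)) \<le> 1 / zm ^ 4"
proof -
  have "1 / (2 * zm) * (9 / (8 * zm ^ 3)) = (9 / 16) * (1 / zm ^ 4)"
    by (simp add: power3_eq_cube power4_eq_xxxx)
  also have "\<dots> \<le> 1 * (1 / zm ^ 4)" using zm_pos by (intro mult_right_mono) auto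
  finally show ?thesis by simp
qed

lemma zm4: "1 / zm\<^sup>2 \<le> 1 / (2 * zm ^ 4)"
proof -
  have "2 * zm ^ 4 = zm\<^sup>2 * (2 * zm\<^sup>2)" by (simp add: power2_eq_square power4_eq_xxxx)
  also have "\<dots> \<le> zm\<^sup>2 * 1" using zm_sq_le by (intro mult_left_mono) auto
  finally show ?thesis using zm_pos by (intro divide_left_mono) auto
qed

text \<open>Reversed, these are exactly the walks that leave the edge \<open>e\<close>, so the
  moment bound applies directly.\<close>

lemma sum_edge_mass_rev_from:
  "(\<Sum>r\<in>{r\<in>all_walks k. (last r, last (butlast r)) = e}. edge_mass (rev r) powr s) \<le> (1 / (2 * zm)) powr s * t ^ k"
proof -
  obtain c d where e: "e = (c, d)" by (cases e)
  have eq: "{r\<in>all_walks k. (last r, last (butlast r)) = e} = rev ` walks E k c d"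
  proof (intro equalityI subsetI)
    fix r assume "r \<in> {r\<in>all_walks k. (last r, last (butlast r)) = e}"
    then have "rev r \<in> walks E k c d" using rev_walks[OF all_walks_in] e by fastforce
    then show "r \<in> rev ` walks E k c d" by (metis image_eqI rev_rev_ident)
  next
    fix r assume "r \<in> rev ` walks E k c d"
    then obtain q where q: "q \<in> walks E k c d" "r = rev q" by blast
    then obtain q' where q': "q = c # d # q'" using walks_form by metis
    have "r \<in> all_walks k" using rev_walks[OF q(1)] q(2) by (auto simp: all_walks_def walks_def)
    then show "r \<in> {r\<in>all_walks k. (last r, last (butlast r)) = e}"
      using q' q e by (simp add: butlast_append)
  qed
  have "(\<Sum>r\<in>{r\<in>all_walks k. (last r, last (butlast r)) = e}. edge_mass (rev r) powr s) = (\<Sum>r\<in>walks E k c d. edge_mass r powr s)"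
    unfolding eq by (subst sum.reindex) auto
  also have "\<dots> \<le> (1 / (2 * zm)) powr s * t ^ k"
  proof (cases "E c d")
    case True
    have "(\<Sum>r\<in>walks E k c d. edge_mass r powr s) \<le> t ^ k * m c d powr s"
      using sum_edge_mass_powr_le[OF t_bound True] t0 by simp
    also have "\<dots> \<le> t ^ k * (1 / (2 * zm)) powr s"
      using m_le[OF True] m_pos[OF True] t0 s1 by (intro mult_left_mono powr_mono2) auto
    finally show ?thesis by (simp add: mult.commute)
  next
    case False
    then have "walks E k c d = {}" using walks_adj[of _ E k c d] by blast
    then show ?thesis using t0 by simp
  qed
  finally show ?thesis .
qed

text \<open>Here the fixed edge is the last one of the reversed walks, so each walk is compared with
  its reversal. The factor \<open>m y x\<close> of that comparison cancels the one in the moment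
  bound.\<close>

lemma sum_edge_mass_rev_walks:
  "(\<Sum>r\<in>walks E k y x. edge_mass (rev r) powr s) \<le> (9 / (8 * zm ^ 3)) powr s * t ^ k"
proof (cases "E y x")
  case True
  have mp: "m y x > 0" by (rule m_pos[OF True])
  have "(\<Sum>r\<in>walks E k y x. edge_mass (rev r) powr s) \<le>
    (\<Sum>r\<in>walks E k y x. (9 / (8 * zm ^ 3)) powr s * (edge_mass r powr s / m y x powr s))"
  proof (rule sum_mono)
    fix r assume r: "r \<in> walks E k y x"
    have "edge_mass (rev r) \<le> 9 / (8 * zm ^ 3) * (edge_mass r / m y x)"
      using edge_mass_rev_le[OF r] mp by (simp only: times_divide_eq_right pos_le_divide_eq)
    then have "edge_mass (rev r) powr s \<le> (9 / (8 * zm ^ 3) * (edge_mass r / m y x)) powr s"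
      using edge_mass_rev_pos[OF r] s1 by (intro powr_mono2) auto
    also have "\<dots> = (9 / (8 * zm ^ 3)) powr s * (edge_mass r powr s / m y x powr s)"
      using edge_mass_pos[OF r] mp zm_pos by (simp add: powr_mult powr_divide)
    finally show "edge_mass (rev r) powr s \<le> (9 / (8 * zm ^ 3)) powr s * (edge_mass r powr s / m y x powr s)" .
  qed
  also have "\<dots> = (9 / (8 * zm ^ 3)) powr s * ((\<Sum>r\<in>walks E k y x. edge_mass r powr s) / m y x powr s)"
    by (simp add: sum_distrib_left sum_divide_distrib)
  also have "\<dots> \<le> (9 / (8 * zm ^ 3)) powr s * t ^ k"
    using sum_edge_mass_powr_le[OF t_bound True, of k] t0 mp by (intro mult_left_mono) (auto simp: divide_le_eq)
  finally show ?thesis .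
next
  case False
  then have "walks E k y x = {}" using walks_adj[of _ E k y x] by blast
  then show ?thesis using t0 by simp
qed

lemma sum_edge_mass_rev_into:
  "(\<Sum>r\<in>{r\<in>all_walks k. hd r = y}. edge_mass (rev r) powr s) \<le> D * ((9 / (8 * zm ^ 3)) powr s * t ^ k)"
proof -
  have eq: "{r\<in>all_walks k. hd r = y} = (\<Union>x\<in>{x. E y x}. walks E k y x)"
    using walks_adj by (fastforce simp: all_walks_def walks_def)
  have "(\<Sum>r\<in>{r\<in>all_walks k. hd r = y}. edge_mass (rev r) powr s) =
    (\<Sum>x\<in>{x. E y x}. \<Sum>r\<in>walks E k y x. edge_mass (rev r) powr s)"
    unfolding eq by (rule sum.UNION_disjoint) (auto simp: finite_walks, auto simp: walks_def)
  also have "\<dots> \<le> (\<Sum>x\<in>{x. E y x}. (9 / (8 * zm ^ 3)) powr s * t ^ k)"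
    by (intro sum_mono sum_edge_mass_rev_walks)
  also have "\<dots> = real (deg E y) * ((9 / (8 * zm ^ 3)) powr s * t ^ k)"
    by (simp add: deg_def)
  also have "\<dots> \<le> D * ((9 / (8 * zm ^ 3)) powr s * t ^ k)"
    using t0 by (intro mult_right_mono D) auto
  finally show ?thesis .
qed

section \<open>Counting walks and merging pairs by their ends\<close>

lemma card_walk_ends:
  assumes "Suc k \<le> l"
  shows "card {r\<in>all_walks k. hd r = x \<and> last r = y} \<le> 3"
proof -
  have "{r\<in>all_walks k. hd r = x \<and> last r = y} \<subseteq> {r. (nbw E r \<and> hd r = x \<and> last r = y) \<and> length r = Suc (Suc k)}"
    by (auto simp: all_walks_def)
  then have "card {r\<in>all_walks k. hd r = x \<and> last r = y} \<le> card {r. (nbw E r \<and> hd r = x \<and> last r = y) \<and> length r = Suc (Suc k)}"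
    by (rule card_mono[OF finite_lists_length])
  also have "\<dots> \<le> 3" using E_sym E_irrefl few assms by (intro card_nbw_few_cycles) auto
  finally show ?thesis .
qed

text \<open>Pairs are written outwards from the meeting vertex. Different first steps mean that the
  reversed walks arrive there over different edges.\<close>

definition merging :: "nat \<Rightarrow> nat \<Rightarrow> ('a list \<times> 'a list) set" where
  "merging a b = {(r, r'). r \<in> all_walks a \<and> r' \<in> all_walks b \<and> hd r = hd r' \<and> r ! 1 \<noteq> r' ! 1}"

lemma finite_merging: "finite (merging a b)"
  by (rule finite_subset[of _ "all_walks a \<times> all_walks b"]) (auto simp: merging_def finite_all_walks)

text \<open>One walk reversed and continued by the other does not backtrack at the meeting vertex,
  and the pair can be recovered from it. It has \<open>(a + 1) + (b + 1)\<close> edges, whence the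
  hypothesis on \<open>l\<close>.\<close>

lemma card_merging_ends:
  assumes "a + b + 2 \<le> l"
  shows "card {d\<in>merging a b. last (fst d) = x \<and> last (snd d) = y} \<le> 3"
proof -
  let ?A = "{d\<in>merging a b. last (fst d) = x \<and> last (snd d) = y}"
  let ?g = "\<lambda>d. rev (fst d) @ tl (snd d)"
  have "inj_on ?g ?A"
  proof (rule inj_onI)
    fix d e assume de: "d \<in> ?A" "e \<in> ?A" "?g d = ?g e"
    have l1: "length (fst d) = a + 2" "length (fst e) = a + 2"
      using de by (auto simp: merging_def all_walks_def)
    then have "rev (fst d) = rev (fst e)" "tl (snd d) = tl (snd e)"
      using de(3) by (auto simp: append_eq_append_conv)
    moreover have "snd d \<noteq> []" "snd e \<noteq> []" "hd (snd d) = hd (fst d)" "hd (snd e) = hd (fst e)"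
      using de by (auto simp: merging_def all_walks_def)
    ultimately show "d = e" by (metis list.expand prod_eqI rev_is_rev_conv)
  qed
  then have "card ?A = card (?g ` ?A)" by (simp add: card_image)
  also have "\<dots> \<le> card {r. (nbw E r \<and> hd r = x \<and> last r = y) \<and> length r = Suc (a + b + 2)}"
  proof (intro card_mono finite_lists_length subsetI)
    fix q assume "q \<in> ?g ` ?A"
    then obtain r r' where r: "q = rev r @ tl r'" "r \<in> all_walks a" "r' \<in> all_walks b" "hd r = hd r'" "r ! 1 \<noteq> r' ! 1"
      "last r = x" "last r' = y" by (auto simp: merging_def)
    obtain v v' where v: "r = hd r # r ! 1 # v" "r' = hd r' # r' ! 1 # v'"
      using walks_form[OF all_walks_in[OF r(2)]] walks_form[OF all_walks_in[OF r(3)]] by blast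
    have "nbw E (rev r)" using r(2) E_sym by (intro nbw_rev) (auto simp: all_walks_def)
    then have "nbw E (rev v @ [r ! 1, hd r])" by (subst (asm) v(1)) simp
    moreover have "nbw E (hd r # r' ! 1 # v')" using r(3,4) v(2) by (metis (mono_tags, lifting) all_walks_def mem_Collect_eq)
    ultimately have nb: "nbw E (rev v @ r ! 1 # hd r # r' ! 1 # v')" using r(5) by (rule nbw_join)
    have "q = rev v @ r ! 1 # hd r # r' ! 1 # v'"
      unfolding r(1) by (subst v(1), subst v(2)) simp
    moreover have "hd q = x"
      using r(6) r(1) v(1) by (metis hd_append2 hd_rev list.distinct(1) rev_is_Nil_conv)
    moreover have "last q = y"
      using r(7) calculation v(2) by (metis last_ConsR last_appendR list.distinct(1))
    moreover have "length q = Suc (a + b + 2)" using r by (simp add: all_walks_def)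
    ultimately show "q \<in> {r. (nbw E r \<and> hd r = x \<and> last r = y) \<and> length r = Suc (a + b + 2)}" using nb by simp
  qed
  also have "\<dots> \<le> 3" using E_sym E_irrefl few assms by (intro card_nbw_few_cycles) auto
  finally show ?thesis .
qed

text \<open>Iterate of order \<open>k\<close> of the transpose of the operator in
  \<open>nb_eigen\<close>. Walks are listed backwards from \<open>y\<close>; \<open>tl\<close> drops
  \<open>y\<close> because the weight of the edge from \<open>x\<close> to \<open>y\<close> is
  applied only in the next step.\<close>

definition propagate :: "('a \<Rightarrow> 'a \<Rightarrow> complex) \<Rightarrow> nat \<Rightarrow> 'a \<Rightarrow> 'a \<Rightarrow> complex" where
  "propagate \<phi> k x y = (\<Sum>r\<in>walks E k y x. pw Z (rev (tl r)) * \<phi> (last r) (last (butlast r)))"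

lemma propagate_0: "E x y \<Longrightarrow> propagate \<phi> 0 x y = \<phi> x y"
  using E_sym by (simp add: propagate_def walks_0)

lemma propagate_Suc:
  assumes "E y z"
  shows "propagate \<phi> (Suc k) y z = (\<Sum>x\<in>{x. E y x} - {z}. Z x y * propagate \<phi> k x y)"
proof -
  have zy: "E z y" using E_sym assms by blast
  have *: "pw Z (rev (tl (z # r))) * \<phi> (last (z # r)) (last (butlast (z # r))) =
    Z x y * (pw Z (rev (tl r)) * \<phi> (last r) (last (butlast r)))" if r: "r \<in> walks E k y x" for r x
  proof -
    obtain q where q: "r = y # x # q" using walks_form[OF r] by blast
    have "pw Z (rev r) = pw Z (rev (tl r)) * Z x y"
      using pw_snoc[of "rev (tl r)" Z y] q by simp
    then show ?thesis using q by simp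
  qed
  have "{u. E y u \<and> u \<noteq> z} = {x. E y x} - {z}" by auto
  then show ?thesis
    unfolding propagate_def sum_walks_Suc[of E, OF zy] using * by (simp add: sum_distrib_left)
qed

section \<open>The \<open>m\<close>-weighted form on propagated test functions\<close>

definition edge_form :: "('a \<Rightarrow> 'a \<Rightarrow> complex) \<Rightarrow> ('a \<Rightarrow> 'a \<Rightarrow> complex) \<Rightarrow> complex" where
  "edge_form g h = (\<Sum>y\<in>UNIV. \<Sum>x\<in>{x. E y x}. complex_of_real (m x y) * (g x y * cnj (h x y)))"

text \<open>Contribution of two walks that reach \<open>y\<close> from different neighbours and
  leave it together over a third edge.\<close>

definition merge_form :: "('a \<Rightarrow> 'a \<Rightarrow> complex) \<Rightarrow> ('a \<Rightarrow> 'a \<Rightarrow> complex) \<Rightarrow> complex" where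
  "merge_form g h = (\<Sum>y\<in>UNIV. \<Sum>x\<in>{x. E y x}. \<Sum>x'\<in>{x. E y x} - {x}.
     (Z x y * g x y) * cnj (Z x' y * h x' y) * (\<Sum>u\<in>{u. E y u} - {x, x'}. complex_of_real (m y u)))"

text \<open>If both walks arrive over the same edge, \<open>flow\<close> sums the outgoing weights
  to \<open>m\<close> of that edge, and the form one step earlier is recovered. Only the pairs
  merging at the current vertex are new.\<close>

lemma edge_form_step:
  assumes g: "\<And>y z. E y z \<Longrightarrow> g' y z = (\<Sum>x\<in>{x. E y x} - {z}. Z x y * g x y)"
    and h: "\<And>y z. E y z \<Longrightarrow> h' y z = (\<Sum>x\<in>{x. E y x} - {z}. Z x y * h x y)"
  shows "edge_form g' h' = edge_form g h + merge_form g h"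
proof -
  have "edge_form g' h' = (\<Sum>y\<in>UNIV. \<Sum>z\<in>{z. E y z}. complex_of_real (m y z) * (g' y z * cnj (h' y z)))"
    unfolding edge_form_def by (rule edge_sum_swap)
  also have "\<dots> = (\<Sum>y\<in>UNIV. (\<Sum>x\<in>{x. E y x}. (Z x y * g x y) * cnj (Z x y * h x y) * (\<Sum>u\<in>{u. E y u} - {x}. complex_of_real (m y u)))
    + (\<Sum>x\<in>{x. E y x}. \<Sum>x'\<in>{x. E y x} - {x}. (Z x y * g x y) * cnj (Z x' y * h x' y) * (\<Sum>u\<in>{u. E y u} - {x, x'}. complex_of_real (m y u))))"
  proof (rule sum.cong[OF refl])
    fix y
    have "(\<Sum>z\<in>{z. E y z}. complex_of_real (m y z) * (g' y z * cnj (h' y z))) =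
      (\<Sum>z\<in>{z. E y z}. complex_of_real (m y z) * ((\<Sum>x\<in>{x. E y x} - {z}. Z x y * g x y) * (\<Sum>x\<in>{x. E y x} - {z}. cnj (Z x y * h x y))))"
      using g h by (intro sum.cong refl) simp
    then show "(\<Sum>z\<in>{z. E y z}. complex_of_real (m y z) * (g' y z * cnj (h' y z))) =
      (\<Sum>x\<in>{x. E y x}. (Z x y * g x y) * cnj (Z x y * h x y) * (\<Sum>u\<in>{u. E y u} - {x}. complex_of_real (m y u)))
      + (\<Sum>x\<in>{x. E y x}. \<Sum>x'\<in>{x. E y x} - {x}. (Z x y * g x y) * cnj (Z x' y * h x' y) * (\<Sum>u\<in>{u. E y u} - {x, x'}. complex_of_real (m y u)))"
      by (subst (asm) sum_product_off_diagonal) auto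
  qed
  also have "\<dots> = edge_form g h + merge_form g h"
    unfolding sum.distrib
  proof (rule arg_cong2[of _ _ _ _ "(+)"])
    show "(\<Sum>y\<in>UNIV. \<Sum>x\<in>{x. E y x}. (Z x y * g x y) * cnj (Z x y * h x y) * (\<Sum>u\<in>{u. E y u} - {x}. complex_of_real (m y u))) = edge_form g h"
      unfolding edge_form_def
    proof (intro sum.cong refl)
      fix y x assume "x \<in> {x. E y x}"
      then have xy: "E x y" using E_sym by blast
      have "{u. E y u} - {x} = N x y" by (auto simp: N_def)
      then have "(Z x y * cnj (Z x y)) * (\<Sum>u\<in>{u. E y u} - {x}. complex_of_real (m y u)) =
        complex_of_real ((cmod (Z x y))\<^sup>2 * (\<Sum>u\<in>N x y. m y u))"
        by (simp add: complex_norm_square del: of_real_power)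
      also have "\<dots> = complex_of_real (m x y)" by (simp only: flow[OF xy])
      finally show "(Z x y * g x y) * cnj (Z x y * h x y) * (\<Sum>u\<in>{u. E y u} - {x}. complex_of_real (m y u)) =
        complex_of_real (m x y) * (g x y * cnj (h x y))"
        by (simp add: ac_simps)
    qed
    show "(\<Sum>y\<in>UNIV. \<Sum>x\<in>{x. E y x}. \<Sum>x'\<in>{x. E y x} - {x}. (Z x y * g x y) * cnj (Z x' y * h x' y) * (\<Sum>u\<in>{u. E y u} - {x, x'}. complex_of_real (m y u))) = merge_form g h"
      by (simp add: merge_form_def)
  qed
  finally show ?thesis .
qed

lemma edge_form_cnj: "edge_form g h = cnj (edge_form h g)"
  by (simp add: edge_form_def mult.commute)

definition end_edge :: "'a list \<Rightarrow> 'a \<times> 'a" where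
  "end_edge r = (last r, last (butlast r))"

text \<open>The exponent is conjugate to \<open>4 * s\<close>.\<close>

definition dual_normalized :: "('a \<Rightarrow> 'a \<Rightarrow> complex) \<Rightarrow> bool" where
  "dual_normalized \<phi> \<longleftrightarrow> (\<Sum>e\<in>UNIV. cmod (\<phi> (fst e) (snd e)) powr (4 * s / (4 * s - 1))) \<le> 1"

text \<open>The weight in \<open>propagate\<close> lacks the final edge; the factor
  \<open>sqrt m\<close> of that edge completes it to the square root of the mass of the reversed
  walk.\<close>

lemma sqrt_m_propagate_le:
  assumes "E y x"
  shows "sqrt (m x y) * cmod (propagate \<phi> k x y) \<le>
    (\<Sum>r\<in>walks E k y x. sqrt (edge_mass (rev r)) * cmod (\<phi> (fst (end_edge r)) (snd (end_edge r))))"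
proof -
  have mp: "m x y > 0" using m_pos E_sym assms by blast
  have "sqrt (m x y) * cmod (propagate \<phi> k x y) \<le>
    sqrt (m x y) * (\<Sum>r\<in>walks E k y x. cmod (pw Z (rev (tl r))) * cmod (\<phi> (last r) (last (butlast r))))"
    unfolding propagate_def using mp
    by (intro mult_left_mono order_trans[OF norm_sum]) (auto simp: norm_mult)
  also have "\<dots> = (\<Sum>r\<in>walks E k y x. sqrt (edge_mass (rev r)) * cmod (\<phi> (fst (end_edge r)) (snd (end_edge r))))"
    unfolding sum_distrib_left
    by (intro sum.cong refl) (simp add: edge_mass_rev_eq real_sqrt_mult end_edge_def mult.commute mult.left_commute)
  finally show ?thesis .
qed

lemma sum_merging:
  fixes G H :: "'a list \<Rightarrow> real"
  shows "(\<Sum>d\<in>merging a b. G (fst d) * H (snd d)) =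
    (\<Sum>y\<in>UNIV. \<Sum>x\<in>UNIV. \<Sum>x'\<in>-{x}. (\<Sum>r\<in>walks E a y x. G r) * (\<Sum>r\<in>walks E b y x'. H r))"
proof -
  have "merging a b = {d \<in> all_walks a \<times> all_walks b. hd (fst d) = hd (snd d) \<and> fst d ! 1 \<noteq> snd d ! 1}"
    by (auto simp: merging_def)
  then have "(\<Sum>d\<in>merging a b. G (fst d) * H (snd d)) =
    (\<Sum>d\<in>all_walks a \<times> all_walks b. if hd (fst d) = hd (snd d) \<and> fst d ! 1 \<noteq> snd d ! 1 then G (fst d) * H (snd d) else 0)"
    by (simp add: sum.inter_filter finite_all_walks)
  also have "\<dots> = (\<Sum>r\<in>all_walks a. \<Sum>r'\<in>all_walks b. if hd r = hd r' \<and> r ! 1 \<noteq> r' ! 1 then G r * H r' else 0)"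
    by (simp add: sum.cartesian_product case_prod_beta')
  also have "\<dots> = (\<Sum>y\<in>UNIV. \<Sum>x\<in>UNIV. \<Sum>r\<in>walks E a y x. \<Sum>y'\<in>UNIV. \<Sum>x'\<in>UNIV. \<Sum>r'\<in>walks E b y' x'.
      if hd r = hd r' \<and> r ! 1 \<noteq> r' ! 1 then G r * H r' else 0)"
    by (simp only: sum_all_walks)
  also have "\<dots> = (\<Sum>y\<in>UNIV. \<Sum>x\<in>UNIV. \<Sum>r\<in>walks E a y x. \<Sum>y'\<in>UNIV. if y' = y then (\<Sum>x'\<in>-{x}. \<Sum>r'\<in>walks E b y' x'. G r * H r') else 0)"
  proof (intro sum.cong refl)
    fix y x r y' assume r: "r \<in> walks E a y x"
    have "(\<Sum>x'\<in>UNIV. \<Sum>r'\<in>walks E b y' x'. if hd r = hd r' \<and> r ! 1 \<noteq> r' ! 1 then G r * H r' else 0) =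
      (\<Sum>x'\<in>UNIV. if y' = y \<and> x' \<noteq> x then \<Sum>r'\<in>walks E b y' x'. G r * H r' else 0)"
      using r by (intro sum.cong refl) (auto simp: walks_def intro!: sum.cong sum.neutral)
    also have "\<dots> = (if y' = y then (\<Sum>x'\<in>-{x}. \<Sum>r'\<in>walks E b y' x'. G r * H r') else 0)"
    proof (cases "y' = y")
      case True
      have "(\<Sum>x'\<in>-{x}. \<Sum>r'\<in>walks E b y x'. G r * H r') =
        (\<Sum>x'\<in>UNIV. if x' \<noteq> x then \<Sum>r'\<in>walks E b y x'. G r * H r' else 0)"
        by (rule sum.mono_neutral_cong_left) auto
      then show ?thesis unfolding True by simp
    qed simp
    finally show "(\<Sum>x'\<in>UNIV. \<Sum>r'\<in>walks E b y' x'. if hd r = hd r' \<and> r ! 1 \<noteq> r' ! 1 then G r * H r' else 0) =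
      (if y' = y then (\<Sum>x'\<in>-{x}. \<Sum>r'\<in>walks E b y' x'. G r * H r') else 0)" .
  qed
  also have "\<dots> = (\<Sum>y\<in>UNIV. \<Sum>x\<in>UNIV. \<Sum>r\<in>walks E a y x. \<Sum>x'\<in>-{x}. \<Sum>r'\<in>walks E b y x'. G r * H r')"
    by (simp add: sum.delta)
  also have "\<dots> = (\<Sum>y\<in>UNIV. \<Sum>x\<in>UNIV. \<Sum>x'\<in>-{x}. (\<Sum>r\<in>walks E a y x. G r) * (\<Sum>r\<in>walks E b y x'. H r))"
  proof (intro sum.cong refl)
    fix y x
    show "(\<Sum>r\<in>walks E a y x. \<Sum>x'\<in>-{x}. \<Sum>r'\<in>walks E b y x'. G r * H r') =
      (\<Sum>x'\<in>-{x}. (\<Sum>r\<in>walks E a y x. G r) * (\<Sum>r\<in>walks E b y x'. H r))"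
      unfolding sum_product by (rule sum.swap)
  qed
  finally show ?thesis .
qed

text \<open>The condition of different first steps is dropped. The second walk is summed first, with
  only its meeting vertex fixed, at the cost of reversal and of a factor \<open>D\<close>. The first
  walk, reversed, leaves the edge \<open>e\<close>.\<close>

lemma merge_kernel_row:
  "(\<Sum>d\<in>{d\<in>merging a b. end_edge (fst d) = e}. (sqrt (edge_mass (rev (fst d))) * sqrt (edge_mass (rev (snd d)))) powr (2 * s))
    \<le> (C0 * \<rho> ^ (a + b)) powr (2 * s)"
proof -
  let ?M = "\<lambda>r. edge_mass (rev r)"
  have pos: "?M r \<ge> 0" if "r \<in> all_walks k" for r k using edge_mass_rev_pos[OF all_walks_in[OF that]] .
  have "(\<Sum>d\<in>{d\<in>merging a b. end_edge (fst d) = e}. (sqrt (?M (fst d)) * sqrt (?M (snd d))) powr (2 * s)) =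
    (\<Sum>d\<in>{d\<in>merging a b. end_edge (fst d) = e}. ?M (fst d) powr s * ?M (snd d) powr s)"
    using pos by (intro sum.cong refl) (auto simp: merging_def powr_mult sqrt_powr_double)
  also have "\<dots> \<le> (\<Sum>d\<in>(SIGMA r:{r\<in>all_walks a. end_edge r = e}. {r'\<in>all_walks b. hd r' = hd r}). ?M (fst d) powr s * ?M (snd d) powr s)"
    by (intro sum_mono2) (auto simp: merging_def finite_all_walks)
  also have "\<dots> = (\<Sum>r\<in>{r\<in>all_walks a. end_edge r = e}. \<Sum>r'\<in>{r'\<in>all_walks b. hd r' = hd r}. ?M r powr s * ?M r' powr s)"
    by (subst sum.Sigma) (auto simp: finite_all_walks case_prod_beta')
  also have "\<dots> = (\<Sum>r\<in>{r\<in>all_walks a. end_edge r = e}. ?M r powr s * (\<Sum>r'\<in>{r'\<in>all_walks b. hd r' = hd r}. ?M r' powr s))"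
    by (simp add: sum_distrib_left)
  also have "\<dots> \<le> (\<Sum>r\<in>{r\<in>all_walks a. end_edge r = e}. ?M r powr s * (D * ((9 / (8 * zm ^ 3)) powr s * t ^ b)))"
    by (intro sum_mono mult_left_mono sum_edge_mass_rev_into) auto
  also have "\<dots> = (\<Sum>r\<in>{r\<in>all_walks a. end_edge r = e}. ?M r powr s) * (D * ((9 / (8 * zm ^ 3)) powr s * t ^ b))"
    by (simp add: sum_distrib_right)
  also have "\<dots> \<le> ((1 / (2 * zm)) powr s * t ^ a) * (D * ((9 / (8 * zm ^ 3)) powr s * t ^ b))"
    using sum_edge_mass_rev_from[of a e] D1 t0 by (intro mult_right_mono) (auto simp: end_edge_def)
  also have "\<dots> = ((1 / (2 * zm)) powr s * (9 / (8 * zm ^ 3)) powr s * D) * t ^ (a + b)"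
    by (simp add: power_add ac_simps)
  also have "(1 / (2 * zm)) powr s * (9 / (8 * zm ^ 3)) powr s = (1 / (2 * zm) * (9 / (8 * zm ^ 3))) powr s"
    by (rule powr_mult[symmetric])
  also have "(1 / (2 * zm) * (9 / (8 * zm ^ 3))) powr s * D * t ^ (a + b) \<le> C0 powr (2 * s) * t ^ (a + b)"
    using zm_pos t0 by (intro mult_right_mono const_le const_le_zm4) auto
  finally show ?thesis unfolding C_powr .
qed

lemma merge_form_bound:
  assumes ab: "a + b + 2 \<le> l" and \<phi>: "dual_normalized \<phi>"
  shows "cmod (merge_form (propagate \<phi> a) (propagate \<phi> b)) \<le> 3 * (C0 * \<rho> ^ (a + b))"
proof -
  define \<Phi> where "\<Phi> e = cmod (\<phi> (fst e) (snd e))" for e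
  define M where "M r = sqrt (edge_mass (rev r))" for r
  define H where "H k y x = (\<Sum>r\<in>walks E k y x. M r * \<Phi> (end_edge r))" for k y x
  have H0: "H k y x \<ge> 0" for k y x
    unfolding H_def M_def \<Phi>_def using edge_mass_rev_pos by (intro sum_nonneg) auto
  have tm: "cmod ((Z x y * propagate \<phi> a x y) * cnj (Z x' y * propagate \<phi> b x' y) * (\<Sum>u\<in>{u. E y u} - {x, x'}. complex_of_real (m y u)))
    \<le> H a y x * H b y x'" if "E y x" "E y x'" for x x' y
  proof -
    define S where "S = (\<Sum>u\<in>{u. E y u} - {x, x'}. m y u)"
    have S0: "S \<ge> 0" unfolding S_def using m_pos by (intro sum_nonneg) (auto simp: less_imp_le)
    \<comment> \<open>\<open>S\<close> is at most the full outgoing sum behind either edge, so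
      \<open>flow\<close> applies at both. The geometric mean of the two bounds produces
      \<open>sqrt (m x y * m x' y)\<close>.\<close>
    have ZS: "(cmod (Z v y))\<^sup>2 * S \<le> m v y" if "E y v" "v = x \<or> v = x'" for v
    proof -
      have "S \<le> (\<Sum>u\<in>N v y. m y u)"
        unfolding S_def using that m_pos by (intro sum_mono2) (auto simp: N_def less_imp_le)
      then have "(cmod (Z v y))\<^sup>2 * S \<le> (cmod (Z v y))\<^sup>2 * (\<Sum>u\<in>N v y. m y u)" by (intro mult_left_mono) auto
      then show ?thesis using flow[of v y] E_sym that by simp
    qed
    have "(cmod (Z x y) * cmod (Z x' y) * S)\<^sup>2 = ((cmod (Z x y))\<^sup>2 * S) * ((cmod (Z x' y))\<^sup>2 * S)"
      by (simp add: power2_eq_square ac_simps)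
    also have "\<dots> \<le> m x y * m x' y"
      using ZS[of x] ZS[of x'] that S0 m_pos E_sym by (intro mult_mono) (auto simp: less_imp_le)
    finally have "cmod (Z x y) * cmod (Z x' y) * S \<le> sqrt (m x y * m x' y)"
      by (rule real_le_rsqrt)
    then have "(cmod (Z x y) * cmod (Z x' y) * S) * (cmod (propagate \<phi> a x y) * cmod (propagate \<phi> b x' y))
      \<le> (sqrt (m x y) * sqrt (m x' y)) * (cmod (propagate \<phi> a x y) * cmod (propagate \<phi> b x' y))"
      by (intro mult_right_mono) (auto simp: real_sqrt_mult)
    also have "\<dots> = (sqrt (m x y) * cmod (propagate \<phi> a x y)) * (sqrt (m x' y) * cmod (propagate \<phi> b x' y))"
      by (simp add: ac_simps)
    also have "\<dots> \<le> H a y x * H b y x'"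
      using sqrt_m_propagate_le[OF that(1), of \<phi> a] sqrt_m_propagate_le[OF that(2), of \<phi> b] H0[of a y x] m_pos[OF E_sym[OF that(2)]]
      by (intro mult_mono) (auto simp: H_def M_def \<Phi>_def)
    finally show ?thesis
      using S0 by (simp add: norm_mult S_def[symmetric] ac_simps flip: of_real_sum)
  qed
  have "cmod (merge_form (propagate \<phi> a) (propagate \<phi> b)) \<le> (\<Sum>y\<in>UNIV. \<Sum>x\<in>{x. E y x}. \<Sum>x'\<in>{x. E y x} - {x}. H a y x * H b y x')"
    unfolding merge_form_def by (intro order_trans[OF norm_sum] sum_mono tm) auto
  also have "\<dots> \<le> (\<Sum>y\<in>UNIV. \<Sum>x\<in>UNIV. \<Sum>x'\<in>-{x}. H a y x * H b y x')"
  proof (rule sum_mono)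
    fix y
    have "(\<Sum>x\<in>{x. E y x}. \<Sum>x'\<in>{x. E y x} - {x}. H a y x * H b y x') \<le> (\<Sum>x\<in>{x. E y x}. \<Sum>x'\<in>-{x}. H a y x * H b y x')"
      using H0 by (intro sum_mono sum_mono2) auto
    also have "\<dots> \<le> (\<Sum>x\<in>UNIV. \<Sum>x'\<in>-{x}. H a y x * H b y x')"
      using H0 by (intro sum_mono2 sum_nonneg) auto
    finally show "(\<Sum>x\<in>{x. E y x}. \<Sum>x'\<in>{x. E y x} - {x}. H a y x * H b y x') \<le> (\<Sum>x\<in>UNIV. \<Sum>x'\<in>-{x}. H a y x * H b y x')" .
  qed
  also have "\<dots> = (\<Sum>d\<in>merging a b. (M (fst d) * \<Phi> (end_edge (fst d))) * (M (snd d) * \<Phi> (end_edge (snd d))))"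
    unfolding H_def by (rule sum_merging[symmetric])
  also have "\<dots> = (\<Sum>d\<in>merging a b. \<Phi> (end_edge (fst d)) * \<Phi> (end_edge (snd d)) * (M (fst d) * M (snd d)))"
    by (simp add: ac_simps)
  also have "\<dots> \<le> 3 * (C0 * \<rho> ^ (a + b))"
  proof (rule young_multiplicity[where p = "4 * s"])
    show "4 * s > 2" "C0 * \<rho> ^ (a + b) > 0" using s1 C0_pos rho_pos by auto
    show "finite (merging a b)" by (rule finite_merging)
    show "M (fst d) * M (snd d) \<ge> 0" if "d \<in> merging a b" for d
      using that edge_mass_rev_pos[OF all_walks_in] by (auto simp: M_def merging_def intro!: mult_nonneg_nonneg)
    show "\<Phi> e \<ge> 0" for e by (simp add: \<Phi>_def)
    show "(\<Sum>e\<in>UNIV. \<Phi> e powr (4 * s / (4 * s - 1))) \<le> 1"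
      using \<phi> by (simp add: dual_normalized_def \<Phi>_def)
    show "(\<Sum>d\<in>{d\<in>merging a b. end_edge (fst d) = e}. (M (fst d) * M (snd d)) powr (4 * s / 2)) \<le> (C0 * \<rho> ^ (a + b)) powr (4 * s / 2)" for e
      using merge_kernel_row[of a b e] by (simp add: M_def)
    show "(\<Sum>d\<in>{d\<in>merging a b. end_edge (snd d) = e}. (M (fst d) * M (snd d)) powr (4 * s / 2)) \<le> (C0 * \<rho> ^ (a + b)) powr (4 * s / 2)" for e
    proof -
      have "(\<Sum>d\<in>{d\<in>merging a b. end_edge (snd d) = e}. (M (fst d) * M (snd d)) powr (4 * s / 2)) =
        (\<Sum>d\<in>{d\<in>merging b a. end_edge (fst d) = e}. (M (fst d) * M (snd d)) powr (4 * s / 2))"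
        by (rule sum.reindex_bij_witness[of _ prod.swap prod.swap]) (auto simp: merging_def mult.commute)
      then show ?thesis using merge_kernel_row[of b a e] by (simp add: M_def add.commute)
    qed
    show "card {d\<in>merging a b. end_edge (fst d) = e \<and> end_edge (snd d) = e'} \<le> 3" for e e'
    proof -
      have "card {d\<in>merging a b. end_edge (fst d) = e \<and> end_edge (snd d) = e'} \<le>
        card {d\<in>merging a b. last (fst d) = fst e \<and> last (snd d) = fst e'}"
        by (intro card_mono) (auto simp: end_edge_def finite_merging)
      then show ?thesis using card_merging_ends[OF ab, of "fst e" "fst e'"] by linarith
    qed
  qed
  finally show ?thesis .
qed

end

section \<open>Decay of the form in the difference of the lengths\<close>

lemma sum_power_le_geometric:
  fixes \<rho> :: real
  assumes "0 \<le> \<rho>" "\<rho> < 1" "finite A" "inj_on g A"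
  shows "(\<Sum>k\<in>A. \<rho> ^ g k) \<le> 1 / (1 - \<rho>)"
proof -
  have "(\<Sum>k\<in>A. \<rho> ^ g k) = (\<Sum>i\<in>g ` A. \<rho> ^ i)" using assms by (simp add: sum.reindex)
  also have "\<dots> \<le> (\<Sum>i. \<rho> ^ i)" using assms by (intro sum_le_suminf summable_geometric) auto
  also have "\<dots> = 1 / (1 - \<rho>)" using assms by (intro suminf_geometric) auto
  finally show ?thesis .
qed

text \<open>The exponent is the distance of \<open>j\<close> and \<open>k\<close>, written by cases
  because subtraction on naturals truncates. Each side is part of one geometric series.\<close>

lemma sum_power_dist_le:
  fixes \<rho> :: real
  assumes "0 \<le> \<rho>" "\<rho> < 1"
  shows "(\<Sum>k<n. \<rho> ^ (if k \<le> j then j - k else k - j)) \<le> 2 / (1 - \<rho>)"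
proof -
  have "{..<n} = {k. k < n \<and> k \<le> j} \<union> {k. k < n \<and> \<not> k \<le> j}" by auto
  then have "(\<Sum>k<n. \<rho> ^ (if k \<le> j then j - k else k - j)) =
    (\<Sum>k\<in>{k. k < n \<and> k \<le> j} \<union> {k. k < n \<and> \<not> k \<le> j}. \<rho> ^ (if k \<le> j then j - k else k - j))" by simp
  also have "\<dots> = (\<Sum>k\<in>{k. k < n \<and> k \<le> j}. \<rho> ^ (j - k)) + (\<Sum>k\<in>{k. k < n \<and> \<not> k \<le> j}. \<rho> ^ (k - j))"
    by (subst sum.union_disjoint) auto
  also have "\<dots> \<le> 1 / (1 - \<rho>) + 1 / (1 - \<rho>)"
    using assms by (intro add_mono sum_power_le_geometric) (auto simp: inj_on_def)
  finally show ?thesis by simp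
qed

context zeta_graph_norm
begin

lemma edge_kernel_powr:
  assumes "r \<in> walks E k y x"
  shows "(sqrt (edge_mass (rev r)) * sqrt (m x y)) powr (2 * s) \<le> edge_mass (rev r) powr s * (1 / (2 * zm)) powr s"
proof -
  have xy: "E x y" using walks_adj[OF assms] E_sym by blast
  have "(sqrt (edge_mass (rev r)) * sqrt (m x y)) powr (2 * s) = edge_mass (rev r) powr s * m x y powr s"
    using edge_mass_rev_pos[OF assms] m_pos[OF xy] by (simp add: powr_mult sqrt_powr_double)
  also have "\<dots> \<le> edge_mass (rev r) powr s * (1 / (2 * zm)) powr s"
    using m_le[OF xy] m_pos[OF xy] s1 by (intro mult_left_mono powr_mono2) auto
  finally show ?thesis .
qed

lemma const_le_one: "0 \<le> c \<Longrightarrow> c \<le> 1 / zm ^ 4 \<Longrightarrow> c powr s \<le> C0 powr (2 * s)"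
  using const_le[of c] D1 mult_left_mono[OF D1, of "c powr s"] by simp

text \<open>With the second test function not propagated, single walks replace merging pairs: the
  walk itself joins the two edges at which the test function is evaluated.\<close>

lemma edge_form_base_bound:
  assumes c: "Suc c \<le> l" and \<phi>: "dual_normalized \<phi>"
  shows "cmod (edge_form (propagate \<phi> c) \<phi>) \<le> 3 * (C0 * \<rho> ^ c)"
proof -
  define \<Phi> where "\<Phi> e = cmod (\<phi> (fst e) (snd e))" for e
  define start where "start r = (r ! 1, hd r)" for r :: "'a list"
  define \<kappa> where "\<kappa> r = sqrt (edge_mass (rev r)) * sqrt (m (r ! 1) (hd r))" for r
  have tm: "cmod (complex_of_real (m x y) * (propagate \<phi> c x y * cnj (\<phi> x y))) \<le>
    (\<Sum>r\<in>walks E c y x. \<Phi> (end_edge r) * \<Phi> (start r) * \<kappa> r)" if "E y x" for x y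
  proof -
    have mp: "m x y > 0" using m_pos E_sym that by blast
    have "cmod (complex_of_real (m x y) * (propagate \<phi> c x y * cnj (\<phi> x y))) =
      (sqrt (m x y) * cmod (propagate \<phi> c x y)) * (sqrt (m x y) * cmod (\<phi> x y))"
      using mp by (simp add: norm_mult)
    also have "\<dots> \<le> (\<Sum>r\<in>walks E c y x. sqrt (edge_mass (rev r)) * cmod (\<phi> (fst (end_edge r)) (snd (end_edge r)))) * (sqrt (m x y) * cmod (\<phi> x y))"
      using mp by (intro mult_right_mono sqrt_m_propagate_le that) auto
    also have "\<dots> = (\<Sum>r\<in>walks E c y x. \<Phi> (end_edge r) * \<Phi> (start r) * \<kappa> r)"
      unfolding sum_distrib_right
      by (intro sum.cong refl) (auto simp: \<Phi>_def start_def \<kappa>_def walks_def ac_simps)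
    finally show ?thesis .
  qed
  have "cmod (edge_form (propagate \<phi> c) \<phi>) \<le> (\<Sum>y\<in>UNIV. \<Sum>x\<in>{x. E y x}. \<Sum>r\<in>walks E c y x. \<Phi> (end_edge r) * \<Phi> (start r) * \<kappa> r)"
    unfolding edge_form_def by (intro order_trans[OF norm_sum] sum_mono tm) auto
  also have "\<dots> = (\<Sum>y\<in>UNIV. \<Sum>x\<in>UNIV. \<Sum>r\<in>walks E c y x. \<Phi> (end_edge r) * \<Phi> (start r) * \<kappa> r)"
  proof (rule sum.cong[OF refl], rule sum.mono_neutral_left)
    fix y
    have "walks E c y x = {}" if "\<not> E y x" for x using walks_adj[of _ E c y x] that by blast
    then show "\<forall>x\<in>UNIV - {x. E y x}. (\<Sum>r\<in>walks E c y x. \<Phi> (end_edge r) * \<Phi> (start r) * \<kappa> r) = 0" by simp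
  qed auto
  also have "\<dots> = (\<Sum>r\<in>all_walks c. \<Phi> (end_edge r) * \<Phi> (start r) * \<kappa> r)" by (rule sum_all_walks[symmetric])
  also have "\<dots> \<le> 3 * (C0 * \<rho> ^ c)"
  proof (rule young_multiplicity[where p = "4 * s"])
    show "4 * s > 2" "C0 * \<rho> ^ c > 0" using s1 C0_pos rho_pos by auto
    show "finite (all_walks c)" by (rule finite_all_walks)
    show "\<kappa> r \<ge> 0" if "r \<in> all_walks c" for r
      using edge_mass_rev_pos[OF all_walks_in[OF that]] m_pos[OF E_sym[OF walks_adj[OF all_walks_in[OF that]]]]
      by (simp add: \<kappa>_def less_imp_le)
    show "\<Phi> e \<ge> 0" for e by (simp add: \<Phi>_def)
    show "(\<Sum>e\<in>UNIV. \<Phi> e powr (4 * s / (4 * s - 1))) \<le> 1"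
      using \<phi> by (simp add: dual_normalized_def \<Phi>_def)
    have \<kappa>le: "\<kappa> r powr (2 * s) \<le> edge_mass (rev r) powr s * (1 / (2 * zm)) powr s" if "r \<in> all_walks c" for r
      unfolding \<kappa>_def by (rule edge_kernel_powr[OF all_walks_in[OF that]])
    show "(\<Sum>r\<in>{r\<in>all_walks c. end_edge r = e}. \<kappa> r powr (4 * s / 2)) \<le> (C0 * \<rho> ^ c) powr (4 * s / 2)" for e
    proof -
      have "(\<Sum>r\<in>{r\<in>all_walks c. end_edge r = e}. \<kappa> r powr (2 * s)) \<le>
        (\<Sum>r\<in>{r\<in>all_walks c. end_edge r = e}. edge_mass (rev r) powr s * (1 / (2 * zm)) powr s)"
        using \<kappa>le by (intro sum_mono) auto
      also have "\<dots> = (\<Sum>r\<in>{r\<in>all_walks c. end_edge r = e}. edge_mass (rev r) powr s) * (1 / (2 * zm)) powr s"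
        by (simp add: sum_distrib_right)
      also have "\<dots> \<le> ((1 / (2 * zm)) powr s * t ^ c) * (1 / (2 * zm)) powr s"
        using sum_edge_mass_rev_from[of c e] by (intro mult_right_mono) (auto simp: end_edge_def)
      also have "\<dots> = (1 / (2 * zm) * (1 / (2 * zm))) powr s * t ^ c" by (simp only: powr_mult ac_simps)
      also have "\<dots> \<le> C0 powr (2 * s) * t ^ c"
      proof (intro mult_right_mono const_le_one)
        have "1 / (2 * zm) * (1 / (2 * zm)) = (1 / 4) * (1 / zm\<^sup>2)" by (simp add: power2_eq_square)
        also have "\<dots> \<le> 1 * (1 / zm\<^sup>2)" by (intro mult_right_mono) auto
        also have "\<dots> \<le> 1 / (2 * zm ^ 4)" using zm4 by simp
        also have "\<dots> \<le> 1 / zm ^ 4" using zm_pos by (simp add: field_simps)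
        finally show "1 / (2 * zm) * (1 / (2 * zm)) \<le> 1 / zm ^ 4" .
      qed (use t0 zm_pos in auto)
      finally show ?thesis unfolding C_powr[symmetric] by simp
    qed
    show "(\<Sum>r\<in>{r\<in>all_walks c. start r = e}. \<kappa> r powr (4 * s / 2)) \<le> (C0 * \<rho> ^ c) powr (4 * s / 2)" for e
    proof -
      have eq: "{r\<in>all_walks c. start r = e} = walks E c (snd e) (fst e)"
        by (auto simp: start_def all_walks_def walks_def)
      have "(\<Sum>r\<in>{r\<in>all_walks c. start r = e}. \<kappa> r powr (2 * s)) \<le>
        (\<Sum>r\<in>{r\<in>all_walks c. start r = e}. edge_mass (rev r) powr s * (1 / (2 * zm)) powr s)"
        using \<kappa>le by (intro sum_mono) auto
      also have "\<dots> = (\<Sum>r\<in>walks E c (snd e) (fst e). edge_mass (rev r) powr s) * (1 / (2 * zm)) powr s"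
        unfolding eq by (simp add: sum_distrib_right)
      also have "\<dots> \<le> ((9 / (8 * zm ^ 3)) powr s * t ^ c) * (1 / (2 * zm)) powr s"
        by (intro mult_right_mono sum_edge_mass_rev_walks) auto
      also have "\<dots> = (1 / (2 * zm) * (9 / (8 * zm ^ 3))) powr s * t ^ c" by (simp only: powr_mult ac_simps)
      also have "\<dots> \<le> C0 powr (2 * s) * t ^ c"
        using zm_pos t0 by (intro mult_right_mono const_le_one const_le_zm4) auto
      finally show ?thesis unfolding C_powr[symmetric] by simp
    qed
    show "card {r\<in>all_walks c. end_edge r = e \<and> start r = e'} \<le> 3" for e e'
    proof -
      have "card {r\<in>all_walks c. end_edge r = e \<and> start r = e'} \<le>
        card {r\<in>all_walks c. hd r = snd e' \<and> last r = fst e}"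
        by (intro card_mono) (auto simp: end_edge_def start_def finite_all_walks)
      then show ?thesis using card_walk_ends[OF c, of "snd e'" "fst e"] by linarith
    qed
  qed
  finally show ?thesis .
qed

text \<open>The factor \<open>2 - \<rho> ^ k\<close> starts at one and grows by
  \<open>(1 - \<rho>) * \<rho> ^ k\<close> in each step, which covers the newly merged pairs. It
  stays below two, so the bound is uniform in \<open>k\<close>.\<close>

lemma edge_form_propagate_bound:
  assumes l: "l > 0" and \<phi>: "dual_normalized \<phi>"
  shows "k + d \<le> l div 2 \<Longrightarrow> cmod (edge_form (propagate \<phi> (k + d)) (propagate \<phi> k)) \<le> 3 * C0 * \<rho> ^ d * (2 - \<rho> ^ k) / (1 - \<rho>)"
proof (induction k)
  case 0
  have "edge_form (propagate \<phi> (0 + d)) (propagate \<phi> 0) = edge_form (propagate \<phi> d) \<phi>"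
    unfolding edge_form_def using propagate_0 E_sym by (intro sum.cong refl) auto
  moreover have "Suc d \<le> l" using 0 l by auto
  then have "cmod (edge_form (propagate \<phi> d) \<phi>) \<le> 3 * (C0 * \<rho> ^ d)" using \<phi> by (rule edge_form_base_bound)
  moreover have "3 * (C0 * \<rho> ^ d) \<le> 3 * (C0 * \<rho> ^ d) / (1 - \<rho>)"
    using rho_pos rho_less C0_pos by (simp add: le_divide_eq mult_le_cancel_left1)
  ultimately show ?case by simp
next
  case (Suc k)
  have step: "edge_form (propagate \<phi> (Suc k + d)) (propagate \<phi> (Suc k)) =
    edge_form (propagate \<phi> (k + d)) (propagate \<phi> k) + merge_form (propagate \<phi> (k + d)) (propagate \<phi> k)"
    using propagate_Suc by (intro edge_form_step) auto
  \<comment> \<open>Two walks with at most \<open>l div 2\<close> edges each join to one with at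
    most \<open>l\<close> edges.\<close>
  have "k + d + k + 2 \<le> l" using Suc.prems by auto
  then have mb: "cmod (merge_form (propagate \<phi> (k + d)) (propagate \<phi> k)) \<le> 3 * (C0 * \<rho> ^ (k + d + k))"
    using \<phi> by (rule merge_form_bound)
  have IH: "cmod (edge_form (propagate \<phi> (k + d)) (propagate \<phi> k)) \<le> 3 * C0 * \<rho> ^ d * (2 - \<rho> ^ k) / (1 - \<rho>)"
    using Suc by simp
  have "\<rho> ^ (k + d + k) \<le> \<rho> ^ (d + k)" using rho_pos rho_less by (intro power_decreasing) auto
  also have "\<dots> = \<rho> ^ d * ((1 - \<rho>) * \<rho> ^ k) / (1 - \<rho>)" using rho_less by (simp add: power_add)
  also have "\<dots> = \<rho> ^ d * (\<rho> ^ k - \<rho> ^ Suc k) / (1 - \<rho>)" by (simp add: algebra_simps)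
  finally have "3 * C0 * \<rho> ^ (k + d + k) \<le> 3 * C0 * (\<rho> ^ d * (\<rho> ^ k - \<rho> ^ Suc k) / (1 - \<rho>))"
    using C0_pos by (intro mult_left_mono) auto
  then have "cmod (edge_form (propagate \<phi> (Suc k + d)) (propagate \<phi> (Suc k))) \<le>
    3 * C0 * \<rho> ^ d * (2 - \<rho> ^ k) / (1 - \<rho>) + 3 * C0 * (\<rho> ^ d * (\<rho> ^ k - \<rho> ^ Suc k) / (1 - \<rho>))"
    unfolding step using norm_triangle_ineq[of "edge_form (propagate \<phi> (k + d)) (propagate \<phi> k)" "merge_form (propagate \<phi> (k + d)) (propagate \<phi> k)"] IH mb
    by linarith
  also have "\<dots> = 3 * C0 * \<rho> ^ d * (2 - \<rho> ^ Suc k) / (1 - \<rho>)"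
    by (simp add: add_divide_distrib[symmetric] algebra_simps)
  finally show ?case .
qed

lemma edge_form_propagate_bound':
  assumes l: "l > 0" and \<phi>: "dual_normalized \<phi>" and jk: "j \<le> l div 2" "k \<le> l div 2"
  shows "cmod (edge_form (propagate \<phi> j) (propagate \<phi> k)) \<le> 6 * C0 / (1 - \<rho>) * \<rho> ^ (if k \<le> j then j - k else k - j)"
proof -
  have main: "cmod (edge_form (propagate \<phi> j) (propagate \<phi> k)) \<le> 6 * C0 / (1 - \<rho>) * \<rho> ^ (j - k)"
    if "k \<le> j" "j \<le> l div 2" for j k
  proof -
    have "cmod (edge_form (propagate \<phi> (k + (j - k))) (propagate \<phi> k)) \<le> 3 * C0 * \<rho> ^ (j - k) * (2 - \<rho> ^ k) / (1 - \<rho>)"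
      using that by (intro edge_form_propagate_bound l \<phi>) auto
    also have "\<dots> \<le> 3 * C0 * \<rho> ^ (j - k) * 2 / (1 - \<rho>)"
      using C0_pos rho_pos rho_less by (intro divide_right_mono mult_left_mono) auto
    finally show ?thesis using that by simp
  qed
  show ?thesis
  proof (cases "k \<le> j")
    case True
    then show ?thesis using main jk by simp
  next
    case False
    then show ?thesis using main[of j k] jk edge_form_cnj[of "propagate \<phi> j" "propagate \<phi> k"] by simp
  qed
qed

section \<open>Averaging over lengths and duality\<close>

lemma edge_form_sum_left: "edge_form (\<lambda>x y. \<Sum>j<n. g j x y) h = (\<Sum>j<(n::nat). edge_form (g j) h)"
proof (induction n)
  case (Suc n)
  have "edge_form (\<lambda>x y. (\<Sum>j<n. g j x y) + g n x y) h = edge_form (\<lambda>x y. \<Sum>j<n. g j x y) h + edge_form (g n) h"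
    by (simp add: edge_form_def algebra_simps sum.distrib)
  then show ?case using Suc by simp
qed (simp add: edge_form_def)

lemma edge_form_sum_right: "edge_form h (\<lambda>x y. \<Sum>j<n. g j x y) = (\<Sum>j<(n::nat). edge_form h (g j))"
proof -
  have "edge_form h (\<lambda>x y. \<Sum>j<n. g j x y) = cnj (\<Sum>j<n. edge_form (g j) h)"
    by (subst edge_form_cnj) (simp add: edge_form_sum_left)
  also have "\<dots> = (\<Sum>j<n. edge_form h (g j))" by (subst (2) edge_form_cnj) simp
  finally show ?thesis .
qed

text \<open>\<open>f\<close> is fixed by the operator, so its pairing does not change when the
  transpose acts on the test function.\<close>

lemma nb_eigen_propagate:
  assumes f: "nb_eigen f"
  shows "(\<Sum>y\<in>UNIV. \<Sum>x\<in>{x. E y x}. f x y * propagate \<phi> k x y) = (\<Sum>y\<in>UNIV. \<Sum>x\<in>{x. E y x}. f x y * \<phi> x y)"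
proof (induction k)
  case 0
  then show ?case using propagate_0 E_sym by (intro sum.cong refl) auto
next
  case (Suc k)
  have "(\<Sum>y\<in>UNIV. \<Sum>x\<in>{x. E y x}. f x y * propagate \<phi> (Suc k) x y) =
    (\<Sum>y\<in>UNIV. \<Sum>z\<in>{x. E y x}. f y z * propagate \<phi> (Suc k) y z)" by (rule edge_sum_swap)
  also have "\<dots> = (\<Sum>y\<in>UNIV. \<Sum>z\<in>{x. E y x}. \<Sum>x\<in>{x. E y x} - {z}. f y z * (Z x y * propagate \<phi> k x y))"
    using propagate_Suc by (intro sum.cong refl) (simp add: sum_distrib_left)
  also have "\<dots> = (\<Sum>y\<in>UNIV. \<Sum>x\<in>{x. E y x}. \<Sum>z\<in>{x. E y x} - {x}. f y z * (Z x y * propagate \<phi> k x y))"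
    by (intro sum.cong refl sum_pairs_swap) auto
  also have "\<dots> = (\<Sum>y\<in>UNIV. \<Sum>x\<in>{x. E y x}. f x y * propagate \<phi> k x y)"
  proof (intro sum.cong refl)
    fix y x assume "x \<in> {x. E y x}"
    then have xy: "E x y" using E_sym by blast
    have "{x. E y x} - {x} = N x y" by (auto simp: N_def)
    then have "(\<Sum>z\<in>{x. E y x} - {x}. f y z * (Z x y * propagate \<phi> k x y)) = (Z x y * (\<Sum>z\<in>N x y. f y z)) * propagate \<phi> k x y"
      by (simp add: sum_distrib_left sum_distrib_right ac_simps)
    then show "(\<Sum>z\<in>{x. E y x} - {x}. f y z * (Z x y * propagate \<phi> k x y)) = f x y * propagate \<phi> k x y"
      using f xy by (simp add: nb_eigen_def)
  qed
  finally show ?case using Suc by simp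
qed

lemma edge_sum_Cauchy_Schwarz:
  fixes a b :: "'a \<Rightarrow> 'a \<Rightarrow> real"
  shows "(\<Sum>y\<in>UNIV. \<Sum>x\<in>{x. E y x}. a x y * b x y) \<le>
    sqrt (\<Sum>y\<in>UNIV. \<Sum>x\<in>{x. E y x}. (a x y)\<^sup>2) * sqrt (\<Sum>y\<in>UNIV. \<Sum>x\<in>{x. E y x}. (b x y)\<^sup>2)"
proof -
  let ?S = "SIGMA y:UNIV. {x. E y x}"
  have eq: "(\<Sum>y\<in>UNIV. \<Sum>x\<in>{x. E y x}. F x y) = (\<Sum>e\<in>?S. F (snd e) (fst e))" for F :: "'a \<Rightarrow> 'a \<Rightarrow> real"
    by (subst sum.Sigma) (auto simp: case_prod_beta')
  have "(\<Sum>e\<in>?S. a (snd e) (fst e) * b (snd e) (fst e))\<^sup>2 \<le> (\<Sum>e\<in>?S. (a (snd e) (fst e))\<^sup>2) * (\<Sum>e\<in>?S. (b (snd e) (fst e))\<^sup>2)"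
    by (rule Cauchy_Schwarz_ineq_sum)
  then show ?thesis unfolding eq real_sqrt_mult[symmetric] by (rule real_le_rsqrt)
qed

text \<open>The sum \<open>H\<close> of \<open>n\<close> propagated test functions pairs with
  \<open>f\<close> to \<open>n\<close> times the original pairing, while decay in the difference of
  the lengths keeps its squared \<open>m\<close>-norm of order \<open>n\<close>. Cauchy-Schwarz and
  division by \<open>n\<close> gain \<open>1 / sqrt n\<close>.\<close>

lemma nb_eigen_dual_bound:
  assumes f: "nb_eigen f" and l: "l > 0" and \<phi>: "dual_normalized \<phi>"
  shows "cmod (\<Sum>y\<in>UNIV. \<Sum>x\<in>{x. E y x}. f x y * \<phi> x y) \<le>
    sqrt (\<Sum>y\<in>UNIV. \<Sum>x\<in>{x. E y x}. (cmod (f x y))\<^sup>2 / m x y) * sqrt (24 * C0 / real l) / (1 - \<rho>)"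
proof -
  \<comment> \<open>The lengths are \<open>0\<close> to \<open>l div 2\<close>. Counting both ends
    gives \<open>l <= 2 * n\<close> also for odd \<open>l\<close>, which turns the constant 12 into
    24.\<close>
  define n where "n = l div 2 + 1"
  define H where "H x y = (\<Sum>k<n. propagate \<phi> k x y)" for x y
  define T where "T = (\<Sum>y\<in>UNIV. \<Sum>x\<in>{x. E y x}. f x y * \<phi> x y)"
  define Q where "Q = (\<Sum>y\<in>UNIV. \<Sum>x\<in>{x. E y x}. (cmod (f x y))\<^sup>2 / m x y)"
  define V where "V = (\<Sum>y\<in>UNIV. \<Sum>x\<in>{x. E y x}. m x y * (cmod (H x y))\<^sup>2)"
  have n0: "real n > 0" "real l \<le> 2 * real n" by (auto simp: n_def)
  have r1: "1 - \<rho> > 0" using rho_less by simp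
  have "complex_of_real V = edge_form H H"
    unfolding V_def edge_form_def by (simp add: complex_norm_square[symmetric])
  also have "\<dots> = (\<Sum>j<n. \<Sum>k<n. edge_form (propagate \<phi> j) (propagate \<phi> k))"
    unfolding H_def edge_form_sum_left edge_form_sum_right ..
  finally have "cmod (complex_of_real V) \<le> (\<Sum>j<n. \<Sum>k<n. 6 * C0 / (1 - \<rho>) * \<rho> ^ (if k \<le> j then j - k else k - j))"
    using l \<phi> by (simp only:) (intro order_trans[OF norm_sum] sum_mono edge_form_propagate_bound'; simp add: n_def)
  also have "\<dots> = (\<Sum>j<n. 6 * C0 / (1 - \<rho>) * (\<Sum>k<n. \<rho> ^ (if k \<le> j then j - k else k - j)))"
    by (simp only: sum_distrib_left)
  also have "\<dots> \<le> (\<Sum>j<n. 6 * C0 / (1 - \<rho>) * (2 / (1 - \<rho>)))"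
    using C0_pos rho_pos rho_less by (intro sum_mono mult_left_mono sum_power_dist_le) auto
  also have "\<dots> = 12 * C0 * real n / (1 - \<rho>)\<^sup>2" by (simp add: power2_eq_square)
  finally have V: "V \<le> 12 * C0 * real n / (1 - \<rho>)\<^sup>2" by simp
  have "real n * cmod T = cmod (\<Sum>k<n. \<Sum>y\<in>UNIV. \<Sum>x\<in>{x. E y x}. f x y * propagate \<phi> k x y)"
    using nb_eigen_propagate[OF f] by (simp add: T_def norm_mult)
  also have "(\<Sum>k<n. \<Sum>y\<in>UNIV. \<Sum>x\<in>{x. E y x}. f x y * propagate \<phi> k x y) = (\<Sum>y\<in>UNIV. \<Sum>x\<in>{x. E y x}. f x y * H x y)"
    unfolding H_def sum_distrib_left by (subst sum.swap, rule sum.cong[OF refl], rule sum.swap)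
  also have "cmod \<dots> \<le> (\<Sum>y\<in>UNIV. \<Sum>x\<in>{x. E y x}. cmod (f x y) * cmod (H x y))"
    by (intro order_trans[OF norm_sum] sum_mono) (auto simp: norm_mult)
  also have "\<dots> = (\<Sum>y\<in>UNIV. \<Sum>x\<in>{x. E y x}. (cmod (f x y) / sqrt (m x y)) * (sqrt (m x y) * cmod (H x y)))"
  proof (intro sum.cong refl)
    fix y x assume "x \<in> {x. E y x}"
    then have "m x y > 0" using m_pos E_sym by blast
    then show "cmod (f x y) * cmod (H x y) = (cmod (f x y) / sqrt (m x y)) * (sqrt (m x y) * cmod (H x y))" by simp
  qed
  also have "\<dots> \<le> sqrt (\<Sum>y\<in>UNIV. \<Sum>x\<in>{x. E y x}. (cmod (f x y) / sqrt (m x y))\<^sup>2) * sqrt (\<Sum>y\<in>UNIV. \<Sum>x\<in>{x. E y x}. (sqrt (m x y) * cmod (H x y))\<^sup>2)"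
    by (rule edge_sum_Cauchy_Schwarz)
  also have "\<dots> = sqrt Q * sqrt V"
  proof -
    have "(cmod (f x y) / sqrt (m x y))\<^sup>2 = (cmod (f x y))\<^sup>2 / m x y" "(sqrt (m x y) * cmod (H x y))\<^sup>2 = m x y * (cmod (H x y))\<^sup>2"
      if "E y x" for x y using m_pos[OF E_sym[OF that]] by (simp_all add: power_divide power_mult_distrib)
    then show ?thesis by (simp add: Q_def V_def)
  qed
  also have "\<dots> \<le> sqrt Q * sqrt (12 * C0 * real n / (1 - \<rho>)\<^sup>2)"
    using V m_pos E_sym unfolding Q_def by (intro mult_left_mono real_sqrt_le_mono real_sqrt_ge_zero sum_nonneg) (auto simp: less_imp_le)
  finally have "cmod T \<le> sqrt Q * sqrt (12 * C0 * real n / (1 - \<rho>)\<^sup>2) / real n"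
    using n0 by (simp add: field_simps)
  also have "\<dots> = sqrt Q * sqrt (12 * C0 / real n) / (1 - \<rho>)"
  proof -
    have "sqrt (12 * C0 * real n / (1 - \<rho>)\<^sup>2) / real n = sqrt (12 * C0 * real n / (1 - \<rho>)\<^sup>2) / sqrt ((real n)\<^sup>2)" by simp
    also have "\<dots> = sqrt (12 * C0 / real n / (1 - \<rho>)\<^sup>2)"
    proof -
      have "12 * C0 * real n / q / (real n)\<^sup>2 = 12 * C0 / real n / q" for q
        using n0 by (simp add: power2_eq_square)
      then show ?thesis by (simp only: real_sqrt_divide[symmetric])
    qed
    also have "\<dots> = sqrt (12 * C0 / real n) / (1 - \<rho>)" using r1 by (simp add: real_sqrt_divide real_sqrt_mult)
    finally show ?thesis by (simp only: times_divide_eq_right[symmetric])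
  qed
  also have "\<dots> \<le> sqrt Q * sqrt (24 * C0 / real l) / (1 - \<rho>)"
  proof (intro divide_right_mono mult_left_mono real_sqrt_le_mono)
    have "12 * C0 / real n = 24 * C0 / (2 * real n)" by simp
    also have "\<dots> \<le> 24 * C0 / real l" using n0 l C0_pos by (intro divide_left_mono) auto
    finally show "12 * C0 / real n \<le> 24 * C0 / real l" .
    show "0 \<le> sqrt Q" unfolding Q_def using m_pos E_sym by (intro real_sqrt_ge_zero sum_nonneg) (auto simp: less_imp_le)
  qed (use r1 in auto)
  finally show ?thesis by (simp add: T_def Q_def)
qed

lemma nb_eigen_norm_bound:
  assumes f: "nb_eigen f" and l: "l > 0"
  shows "(\<Sum>y\<in>UNIV. \<Sum>x\<in>{x. E y x}. cmod (f x y) powr (4 * s)) powr (1 / (4 * s)) \<le>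
    sqrt (\<Sum>y\<in>UNIV. \<Sum>x\<in>{x. E y x}. (cmod (f x y))\<^sup>2 / m x y) * sqrt (24 * C0 / real l) / (1 - \<rho>)"
proof -
  define p where "p = 4 * s"
  define X where "X = (\<Sum>y\<in>UNIV. \<Sum>x\<in>{x. E y x}. cmod (f x y) powr p)"
  have p: "p > 4" using s1 by (simp add: p_def)
  have X0: "X \<ge> 0" unfolding X_def by (intro sum_nonneg) auto
  show ?thesis
  proof (cases "X = 0")
    case True
    have "0 \<le> sqrt (\<Sum>y\<in>UNIV. \<Sum>x\<in>{x. E y x}. (cmod (f x y))\<^sup>2 / m x y) * sqrt (24 * C0 / real l) / (1 - \<rho>)"
      using C0_pos rho_less m_pos E_sym
      by (intro divide_nonneg_nonneg mult_nonneg_nonneg real_sqrt_ge_zero sum_nonneg) (auto simp: less_imp_le)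
    then show ?thesis using True by (simp add: X_def p_def)
  next
    case False
    then have X: "X > 0" using X0 by simp
    \<comment> \<open>The test function is extremal in Hoelder's inequality: \<open>cnj f\<close>
      times the power \<open>p - 2\<close> of \<open>cmod f\<close>. The factor \<open>c\<close>
      scales it to norm one in the conjugate exponent, leaving the pairing
      \<open>X powr (1 / p)\<close>.\<close>
    define c where "c = X powr (- (p - 1) / p)"
    have c0: "c > 0" using X by (simp add: c_def)
    define \<phi> where "\<phi> x y = (if E x y then cnj (f x y) * complex_of_real (cmod (f x y) powr (p - 2) * c) else 0)" for x y
    have cmod\<phi>: "cmod (\<phi> x y) = cmod (f x y) powr (p - 1) * c" if "E x y" for x y
    proof (cases "f x y = 0")
      case False
      then have "cmod (f x y) * cmod (f x y) powr (p - 2) = cmod (f x y) powr (p - 1)"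
        using powr_add[of "cmod (f x y)" 1 "p - 2"] by simp
      then show ?thesis using that c0 by (simp add: \<phi>_def norm_mult)
    qed (use that p in \<open>simp add: \<phi>_def\<close>)
    have "cmod (\<phi> x y) powr (p / (p - 1)) = cmod (f x y) powr p / X" if "E x y" for x y
    proof -
      have "cmod (\<phi> x y) powr (p / (p - 1)) = (cmod (f x y) powr (p - 1)) powr (p / (p - 1)) * c powr (p / (p - 1))"
        unfolding cmod\<phi>[OF that] by (rule powr_mult)
      also have "(cmod (f x y) powr (p - 1)) powr (p / (p - 1)) = cmod (f x y) powr p"
        using p by (simp add: powr_powr)
      also have "c powr (p / (p - 1)) = X powr (- (p - 1) / p * (p / (p - 1)))"
        unfolding c_def by (rule powr_powr)
      also have "- (p - 1) / p * (p / (p - 1)) = - 1" using p by (simp add: field_simps)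
      also have "X powr (- 1) = 1 / X" using X by (simp add: powr_minus divide_inverse)
      finally show ?thesis by simp
    qed
    then have "(\<Sum>y\<in>UNIV. \<Sum>x\<in>{x. E y x}. cmod (\<phi> x y) powr (p / (p - 1))) = (\<Sum>y\<in>UNIV. \<Sum>x\<in>{x. E y x}. cmod (f x y) powr p / X)"
      using E_sym by (intro sum.cong refl) auto
    also have "\<dots> = 1" using X by (simp add: X_def sum_divide_distrib[symmetric])
    finally have n1: "(\<Sum>y\<in>UNIV. \<Sum>x\<in>{x. E y x}. cmod (\<phi> x y) powr (p / (p - 1))) = 1" .
    have "(\<Sum>e\<in>UNIV. cmod (\<phi> (fst e) (snd e)) powr (p / (p - 1))) = (\<Sum>x\<in>UNIV. \<Sum>y\<in>UNIV. cmod (\<phi> x y) powr (p / (p - 1)))"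
      unfolding sum.cartesian_product UNIV_Times_UNIV by (simp add: case_prod_beta')
    also have "\<dots> = (\<Sum>x\<in>UNIV. \<Sum>y\<in>{y. E x y}. cmod (\<phi> x y) powr (p / (p - 1)))"
      by (intro sum.cong refl sum.mono_neutral_right) (auto simp: \<phi>_def)
    also have "\<dots> = 1" using n1 by (subst (asm) edge_sum_swap) simp
    finally have dn: "dual_normalized \<phi>" by (simp add: dual_normalized_def p_def)
    have "(\<Sum>y\<in>UNIV. \<Sum>x\<in>{x. E y x}. f x y * \<phi> x y) = (\<Sum>y\<in>UNIV. \<Sum>x\<in>{x. E y x}. complex_of_real (cmod (f x y) powr p * c))"
    proof (intro sum.cong refl)
      fix y x assume "x \<in> {x. E y x}"
      then have xy: "E x y" using E_sym by blast
      have "cmod (f x y) powr p = (cmod (f x y))\<^sup>2 * cmod (f x y) powr (p - 2)"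
        using powr_add[of "cmod (f x y)" 2 "p - 2"] p by (cases "f x y = 0") (auto simp: powr_numeral)
      then show "f x y * \<phi> x y = complex_of_real (cmod (f x y) powr p * c)"
        using xy complex_norm_square[of "f x y"] by (simp add: \<phi>_def)
    qed
    also have "\<dots> = complex_of_real (X * c)"
      by (simp add: X_def sum_distrib_right)
    also have "X * c = X powr (1 / p)"
    proof -
      have "X * c = X powr (1 + - (p - 1) / p)" unfolding c_def powr_add using X by simp
      also have "1 + - (p - 1) / p = 1 / p" using p by (simp add: field_simps)
      finally show ?thesis .
    qed
    finally have eq: "(\<Sum>y\<in>UNIV. \<Sum>x\<in>{x. E y x}. f x y * \<phi> x y) = complex_of_real (X powr (1 / p))" .
    have "cmod (\<Sum>y\<in>UNIV. \<Sum>x\<in>{x. E y x}. f x y * \<phi> x y) = X powr (1 / p)" unfolding eq by simp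
    then show ?thesis using nb_eigen_dual_bound[OF f l dn] by (simp add: X_def p_def)
  qed
qed

end

subsection \<open>Eigenfunctions\<close>

text \<open>A row of \<open>P\<close> is a probability vector with at least two positive entries.
  Each entry is therefore below one and strictly decreases when raised to a power above one.\<close>

lemma (in zeta_graph) transition_powr_bound:
  assumes s: "s > 1" and xy: "E x y"
  shows "(\<Sum>u\<in>N x y. cmod (Z x y) powr (2 * s) * m y u powr s / m x y powr s) < 1"
    and "(\<Sum>u\<in>N x y. cmod (Z x y) powr (2 * s) * m y u powr s / m x y powr s) > 0"
proof -
  define P where "P u = (cmod (Z x y))\<^sup>2 * m y u / m x y" for u
  have mp: "m x y > 0" by (rule m_pos[OF xy])
  have Zp: "cmod (Z x y) > 0" using Z_nz[OF xy] by simp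
  have c2: "card (N x y) \<ge> 2" unfolding N_def by (rule card_other_neighbours[OF deg3])
  then have ne: "N x y \<noteq> {}" by auto
  have fin: "finite (N x y)" by simp
  have Pp: "P u > 0" if "u \<in> N x y" for u
    using mp Zp m_pos[of y u] that unfolding P_def N_def by (intro divide_pos_pos mult_pos_pos) auto
  have sum1: "(\<Sum>u\<in>N x y. P u) = 1"
    using flow[OF xy] mp unfolding P_def by (simp add: sum_distrib_left[symmetric] sum_divide_distrib[symmetric])
  have eq: "cmod (Z x y) powr (2 * s) * m y u powr s / m x y powr s = P u powr s" if "u \<in> N x y" for u
  proof -
    have "((cmod (Z x y))\<^sup>2) powr s = cmod (Z x y) powr (2 * s)"
      using Zp by (simp add: powr_powr flip: powr_numeral)
    then show ?thesis
      using mp m_pos[of y u] that unfolding P_def N_def by (simp add: powr_mult powr_divide)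
  qed
  have lt: "P u powr s < P u" if u: "u \<in> N x y" for u
  proof -
    have "N x y \<noteq> {u}" using c2 by auto
    then obtain v where v: "v \<in> N x y" "v \<noteq> u" using u by blast
    have "P u + P v = (\<Sum>w\<in>{u, v}. P w)" using v by simp
    also have "\<dots> \<le> (\<Sum>w\<in>N x y. P w)" using u v Pp by (intro sum_mono2) (auto simp: less_imp_le)
    finally have "P u < 1" using sum1 Pp[OF v(1)] by simp
    have "P u powr s < P u powr 1"
      using Pp[OF u] \<open>P u < 1\<close> s by (intro powr_less_mono') auto
    then show ?thesis using Pp[OF u] by simp
  qed
  have "(\<Sum>u\<in>N x y. P u powr s) < (\<Sum>u\<in>N x y. P u)" by (rule sum_strict_mono[OF fin ne lt])
  then show "(\<Sum>u\<in>N x y. cmod (Z x y) powr (2 * s) * m y u powr s / m x y powr s) < 1"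
    using sum1 eq by simp
  have "(\<Sum>u\<in>N x y. P u powr s) > 0" using Pp by (intro sum_pos fin ne) (simp add: order.strict_implies_not_eq[symmetric] powr_gt_zero[THEN iffD2])
  then show "(\<Sum>u\<in>N x y. cmod (Z x y) powr (2 * s) * m y u powr s / m x y powr s) > 0"
    using eq by simp
qed

text \<open>\<open>Zs\<close> is a maximum over finitely many edges, so it is attained and inherits
  the strict bounds of a single row.\<close>

lemma (in zeta_graph) Zs_bounds:
  assumes Z: "Z = zeta0 E W lam" and s: "s > 1"
  shows "Zs E W s lam < 1" "Zs E W s lam > 0"
    and "E x y \<Longrightarrow> (\<Sum>u\<in>N x y. cmod (Z x y) powr (2 * s) * m y u powr s) \<le> Zs E W s lam * m x y powr s"
proof -
  define A where "A = {(\<Sum>u\<in>N x y. cmod (Z x y) powr (2 * s) * m y u powr s / m x y powr s) | x y. E x y}"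
  have absm: "\<bar>Im (Z x y)\<bar> = m x y" if "E x y" for x y using Im_neg[OF that] by (simp add: m_def)
  have "(\<Sum>u\<in>{u. E y u \<and> u \<noteq> x}. cmod (Z x y) powr (2 * s) * \<bar>Im (Z y u)\<bar> powr s / \<bar>Im (Z x y)\<bar> powr s) =
    (\<Sum>u\<in>N x y. cmod (Z x y) powr (2 * s) * m y u powr s / m x y powr s)" if "E x y" for x y
    unfolding N_def using absm that by (intro sum.cong refl) auto
  then have ZA: "Zs E W s lam = Max A"
    unfolding Zs_def A_def Z[symmetric] by (intro arg_cong[of _ _ Max]) (metis (no_types, lifting))
  have "A = (\<lambda>(x, y). \<Sum>u\<in>N x y. cmod (Z x y) powr (2 * s) * m y u powr s / m x y powr s) ` {(x, y). E x y}"
    by (auto simp: A_def)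
  then have fin: "finite A" by simp
  obtain x0 y0 where "E x0 y0" using ex_adj by blast
  then have ne: "A \<noteq> {}" by (auto simp: A_def)
  have "Max A \<in> A" using fin ne by (rule Max_in)
  then obtain x1 y1 where "Max A = (\<Sum>u\<in>N x1 y1. cmod (Z x1 y1) powr (2 * s) * m y1 u powr s / m x1 y1 powr s)" "E x1 y1"
    unfolding A_def by blast
  then show "Zs E W s lam < 1" "Zs E W s lam > 0"
    using transition_powr_bound[OF s, of x1 y1] ZA by simp_all
  assume xy: "E x y"
  then have "(\<Sum>u\<in>N x y. cmod (Z x y) powr (2 * s) * m y u powr s / m x y powr s) \<le> Max A"
    using fin by (intro Max_ge) (auto simp: A_def)
  then have "(\<Sum>u\<in>N x y. cmod (Z x y) powr (2 * s) * m y u powr s) / m x y powr s \<le> Zs E W s lam"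
    by (simp add: ZA sum_divide_distrib)
  then show "(\<Sum>u\<in>N x y. cmod (Z x y) powr (2 * s) * m y u powr s) \<le> Zs E W s lam * m x y powr s"
    using m_pos[OF xy] by (simp add: divide_le_eq)
qed

section \<open>The lift of an eigenfunction to oriented edges\<close>

context zeta_graph
begin

definition nb_lift :: "('a \<Rightarrow> complex) \<Rightarrow> 'a \<Rightarrow> 'a \<Rightarrow> complex" where
  "nb_lift \<psi> x y = \<psi> y - Z x y * \<psi> x"

definition eigenfunction :: "('a \<Rightarrow> complex) \<Rightarrow> bool" where
  "eigenfunction \<psi> \<longleftrightarrow> (\<forall>x. (\<Sum>y\<in>{y. E x y}. \<psi> y) + complex_of_real (W x) * \<psi> x = complex_of_real lam * \<psi> x)"

text \<open>Leaving \<open>x\<close> out of the eigenvalue equation at \<open>y\<close> produces the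
  term \<open>- \<psi> x\<close>, and the recursion reduces the coefficient of
  \<open>\<psi> y\<close> to one.\<close>

lemma nb_eigen_nb_lift:
  assumes "eigenfunction \<psi>" shows "nb_eigen (nb_lift \<psi>)"
  unfolding nb_eigen_def
proof (intro allI impI)
  fix x y assume xy: "E x y"
  have "{u. E y u} = insert x (N x y)" using xy E_sym by (auto simp: N_def)
  then have "(\<Sum>u\<in>{u. E y u}. \<psi> u) = \<psi> x + (\<Sum>u\<in>N x y. \<psi> u)" by (simp add: N_def)
  moreover have "(\<Sum>u\<in>{u. E y u}. \<psi> u) = complex_of_real lam * \<psi> y - complex_of_real (W y) * \<psi> y"
    using assms unfolding eigenfunction_def by (metis add_diff_cancel_right')
  ultimately have 1: "(\<Sum>u\<in>N x y. \<psi> u) = complex_of_real lam * \<psi> y - complex_of_real (W y) * \<psi> y - \<psi> x"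
    by (simp add: algebra_simps)
  have "Z x y * (\<Sum>u\<in>N x y. nb_lift \<psi> y u) = Z x y * ((\<Sum>u\<in>N x y. \<psi> u) - (\<Sum>u\<in>N x y. Z y u) * \<psi> y)"
    by (simp add: nb_lift_def sum_subtractf sum_distrib_right)
  also have "\<dots> = (Z x y * (complex_of_real lam - complex_of_real (W y) - (\<Sum>u\<in>N x y. Z y u))) * \<psi> y - Z x y * \<psi> x"
    unfolding 1 by (simp add: algebra_simps)
  also have "\<dots> = nb_lift \<psi> x y" using rec[OF xy] by (simp add: nb_lift_def N_def)
  finally show "nb_lift \<psi> x y = Z x y * (\<Sum>u\<in>N x y. nb_lift \<psi> y u)" by simp
qed

text \<open>If the lift vanished on both orientations of an edge at \<open>x\<close>, then
  \<open>Z x y * Z y x = 1\<close>. This would force \<open>green_inv y = 0\<close>, whose imaginary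
  part is positive.\<close>

lemma nb_lift_nonzero:
  assumes "\<psi> x \<noteq> 0" shows "\<exists>u v. E u v \<and> nb_lift \<psi> u v \<noteq> 0"
proof (rule ccontr)
  assume c: "\<not> (\<exists>u v. E u v \<and> nb_lift \<psi> u v \<noteq> 0)"
  obtain y where xy: "E x y" using ex_adj by blast
  have "nb_lift \<psi> x y = 0" "nb_lift \<psi> y x = 0" using c xy E_sym[OF xy] by blast+
  then have 1: "\<psi> y = Z x y * \<psi> x" and 2: "\<psi> x = Z y x * \<psi> y" by (simp_all add: nb_lift_def)
  have "1 * \<psi> x = (Z x y * Z y x) * \<psi> x" using 2 unfolding 1 by (simp add: ac_simps)
  then have "Z x y * Z y x = 1" using assms mult_right_cancel by metis
  then have "Z x y * green_inv y = 0" using green_inv_mult[OF xy] by simp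
  then show False using Z_nz[OF xy] cmod_green_inv_pos[of y] by simp
qed

text \<open>The lift can be nonzero only on edges touching the support of \<open>\<psi>\<close>;
  each has two orientations, hence the factor two.\<close>

lemma card_nb_lift_support:
  assumes D: "\<And>x. real (deg E x) \<le> D"
  shows "real (card {(x, y). E x y \<and> nb_lift \<psi> x y \<noteq> 0}) \<le> 2 * D * real (card {x. \<psi> x \<noteq> 0})"
proof -
  define L where "L = {x. \<psi> x \<noteq> 0}"
  define S where "S = (SIGMA x:L. {y. E x y})"
  have "{(x, y). E x y \<and> nb_lift \<psi> x y \<noteq> 0} \<subseteq> S \<union> prod.swap ` S"
  proof
    fix e assume "e \<in> {(x, y). E x y \<and> nb_lift \<psi> x y \<noteq> 0}"
    then obtain x y where e: "e = (x, y)" "E x y" "nb_lift \<psi> x y \<noteq> 0" by blast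
    then have "\<psi> x \<noteq> 0 \<or> \<psi> y \<noteq> 0" by (auto simp: nb_lift_def)
    then have "(x, y) \<in> S \<or> (y, x) \<in> S" using e E_sym by (auto simp: S_def L_def)
    then show "e \<in> S \<union> prod.swap ` S" using e(1) by force
  qed
  then have "card {(x, y). E x y \<and> nb_lift \<psi> x y \<noteq> 0} \<le> card (S \<union> prod.swap ` S)" by (intro card_mono) auto
  also have "\<dots> \<le> card S + card (prod.swap ` S)" by (rule card_Un_le)
  also have "\<dots> = 2 * card S" by (simp add: card_image)
  finally have 1: "card {(x, y). E x y \<and> nb_lift \<psi> x y \<noteq> 0} \<le> 2 * card S" .
  have "real (card S) = (\<Sum>x\<in>L. real (deg E x))" unfolding S_def by (simp add: deg_def)
  also have "\<dots> \<le> (\<Sum>x\<in>L. D)" by (intro sum_mono D)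
  finally have "real (card S) \<le> D * real (card L)" by (simp add: mult.commute)
  then show ?thesis using of_nat_mono[OF 1, where 'a=real] by (simp add: L_def)
qed

text \<open>The constant is two from the end of the edge plus one from its start. There the bound of
  the squared modulus of \<open>Z x y\<close> by \<open>m x y / (2 * zm)\<close> cancels the weight
  and the factor two.\<close>

lemma sum_nb_lift_sq_le:
  assumes D: "\<And>x. real (deg E x) \<le> D" and \<psi>: "(\<Sum>x\<in>UNIV. (cmod (\<psi> x))\<^sup>2) = 1"
  shows "(\<Sum>y\<in>UNIV. \<Sum>x\<in>{x. E y x}. (cmod (nb_lift \<psi> x y))\<^sup>2 / m x y) \<le> 3 * D / zm"
proof -
  have tm: "(cmod (nb_lift \<psi> x y))\<^sup>2 / m x y \<le> 2 / zm * (cmod (\<psi> y))\<^sup>2 + 1 / zm * (cmod (\<psi> x))\<^sup>2" if xy: "E x y" for x y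
  proof -
    have mp: "m x y > 0" by (rule m_pos[OF xy])
    have "(cmod (nb_lift \<psi> x y))\<^sup>2 \<le> (cmod (\<psi> y) + cmod (Z x y * \<psi> x))\<^sup>2"
      unfolding nb_lift_def by (intro power_mono norm_triangle_ineq4) auto
    also have "\<dots> \<le> 2 * (cmod (\<psi> y))\<^sup>2 + 2 * (cmod (Z x y * \<psi> x))\<^sup>2"
      using sum_squares_bound[of "cmod (\<psi> y)" "cmod (Z x y * \<psi> x)"] by (simp add: power2_sum)
    also have "\<dots> = 2 * (cmod (\<psi> y))\<^sup>2 + 2 * ((cmod (Z x y))\<^sup>2 * (cmod (\<psi> x))\<^sup>2)" by (simp add: norm_mult power_mult_distrib)
    also have "\<dots> \<le> 2 * (cmod (\<psi> y))\<^sup>2 + 2 * (m x y / (2 * zm) * (cmod (\<psi> x))\<^sup>2)"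
      by (intro add_left_mono mult_left_mono mult_right_mono cmod_Z_sq_le xy) auto
    finally have "(cmod (nb_lift \<psi> x y))\<^sup>2 / m x y \<le> (2 * (cmod (\<psi> y))\<^sup>2 + 2 * (m x y / (2 * zm) * (cmod (\<psi> x))\<^sup>2)) / m x y"
      using mp by (intro divide_right_mono) auto
    also have "\<dots> = 2 * (cmod (\<psi> y))\<^sup>2 / m x y + 1 / zm * (cmod (\<psi> x))\<^sup>2"
      using mp by (simp add: add_divide_distrib)
    also have "2 * (cmod (\<psi> y))\<^sup>2 / m x y \<le> 2 * (cmod (\<psi> y))\<^sup>2 / zm"
      using zm_le_m[OF xy] zm_pos mp by (intro divide_left_mono mult_pos_pos) auto
    finally show ?thesis by simp
  qed
  have sumdeg: "(\<Sum>y\<in>UNIV. \<Sum>x\<in>{x. E y x}. (cmod (\<psi> y))\<^sup>2) \<le> D"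
  proof -
    have "(\<Sum>y\<in>UNIV. \<Sum>x\<in>{x. E y x}. (cmod (\<psi> y))\<^sup>2) = (\<Sum>y\<in>UNIV. real (deg E y) * (cmod (\<psi> y))\<^sup>2)"
      by (simp add: deg_def)
    also have "\<dots> \<le> (\<Sum>y\<in>UNIV. D * (cmod (\<psi> y))\<^sup>2)" by (intro sum_mono mult_right_mono D) auto
    also have "\<dots> = D" using \<psi> by (simp add: sum_distrib_left[symmetric])
    finally show ?thesis .
  qed
  have swap: "(\<Sum>y\<in>UNIV. \<Sum>x\<in>{x. E y x}. (cmod (\<psi> x))\<^sup>2) = (\<Sum>y\<in>UNIV. \<Sum>x\<in>{x. E y x}. (cmod (\<psi> y))\<^sup>2)"
    by (rule edge_sum_swap)
  have "(\<Sum>y\<in>UNIV. \<Sum>x\<in>{x. E y x}. (cmod (nb_lift \<psi> x y))\<^sup>2 / m x y) \<le>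
    (\<Sum>y\<in>UNIV. \<Sum>x\<in>{x. E y x}. 2 / zm * (cmod (\<psi> y))\<^sup>2 + 1 / zm * (cmod (\<psi> x))\<^sup>2)"
    using tm E_sym by (intro sum_mono) auto
  also have "\<dots> = 2 / zm * (\<Sum>y\<in>UNIV. \<Sum>x\<in>{x. E y x}. (cmod (\<psi> y))\<^sup>2) + 1 / zm * (\<Sum>y\<in>UNIV. \<Sum>x\<in>{x. E y x}. (cmod (\<psi> x))\<^sup>2)"
    by (simp only: sum.distrib sum_distrib_left)
  also have "\<dots> \<le> 2 / zm * D + 1 / zm * D"
    unfolding swap using sumdeg zm_pos by (intro add_mono mult_left_mono) auto
  also have "\<dots> = 3 * D / zm" by (simp add: add_divide_distrib[symmetric])
  finally show ?thesis .
qed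

text \<open>Since \<open>lam\<close> and \<open>W\<close> are real, \<open>cnj \<circ> \<psi>\<close> is an eigenfunction too; its lift differs from the
  conjugate of the lift of \<open>\<psi>\<close> by \<open>2 * Im (Z x y) * \<psi> x\<close>, which recovers \<open>\<psi>\<close>.\<close>

lemma cmod_le_nb_lift:
  assumes xy: "E x y"
  shows "cmod (\<psi> x) \<le> max (cmod (nb_lift \<psi> x y)) (cmod (nb_lift (cnj \<circ> \<psi>) x y)) / zm"
proof -
  have "cnj (nb_lift (cnj \<circ> \<psi>) x y) - nb_lift \<psi> x y = (Z x y - cnj (Z x y)) * \<psi> x"
    by (simp add: nb_lift_def algebra_simps)
  also have "cmod \<dots> = 2 * m x y * cmod (\<psi> x)"
    using m_pos[OF xy] by (simp add: norm_mult complex_diff_cnj m_def)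
  finally have "2 * m x y * cmod (\<psi> x) \<le> cmod (nb_lift (cnj \<circ> \<psi>) x y) + cmod (nb_lift \<psi> x y)"
    using norm_triangle_ineq4[of "cnj (nb_lift (cnj \<circ> \<psi>) x y)" "nb_lift \<psi> x y"] by simp
  moreover have "zm * cmod (\<psi> x) \<le> m x y * cmod (\<psi> x)" using zm_le_m[OF xy] by (intro mult_right_mono) auto
  ultimately have "zm * cmod (\<psi> x) \<le> max (cmod (nb_lift \<psi> x y)) (cmod (nb_lift (cnj \<circ> \<psi>) x y))" by linarith
  then show ?thesis using zm_pos by (simp add: field_simps)
qed

end

text \<open>The value at \<open>x\<close> is read off from a single edge leaving \<open>x\<close>,
  through the lifts of \<open>\<psi>\<close> and of its conjugate. Both functions satisfy the same
  hypotheses, so both lifts have norm at most \<open>B\<close>.\<close>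

lemma (in zeta_graph_norm) eigenfunction_norm_bound:
  assumes \<psi>: "eigenfunction \<psi>" "(\<Sum>x\<in>UNIV. (cmod (\<psi> x))\<^sup>2) = 1" and l: "l > 0"
  shows "pnorm \<psi> (4 * s) \<le> 8 * D * zm powr (- 5) / (1 - \<rho>) * (1 / sqrt (real l))"
proof -
  define p where "p = 4 * s"
  have p: "p > 4" using s1 by (simp add: p_def)
  define B where "B = sqrt (3 * D / zm) * sqrt (24 * C0 / real l) / (1 - \<rho>)"
  have r1: "1 - \<rho> > 0" using rho_less by simp
  have B0: "B > 0" unfolding B_def using D1 zm_pos C0_pos l r1 by (intro divide_pos_pos mult_pos_pos) auto
  have cnj_eig: "eigenfunction (cnj \<circ> \<psi>)" "(\<Sum>x\<in>UNIV. (cmod ((cnj \<circ> \<psi>) x))\<^sup>2) = 1"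
  proof -
    have "cnj ((\<Sum>y\<in>{y. E x y}. \<psi> y) + complex_of_real (W x) * \<psi> x) = cnj (complex_of_real lam * \<psi> x)" for x
      using \<psi>(1) unfolding eigenfunction_def by simp
    then show "eigenfunction (cnj \<circ> \<psi>)" unfolding eigenfunction_def by simp
    show "(\<Sum>x\<in>UNIV. (cmod ((cnj \<circ> \<psi>) x))\<^sup>2) = 1" using \<psi>(2) by simp
  qed
  have X: "(\<Sum>y\<in>UNIV. \<Sum>x\<in>{x. E y x}. cmod (nb_lift g x y) powr p) \<le> B powr p"
    if g: "eigenfunction g" "(\<Sum>x\<in>UNIV. (cmod (g x))\<^sup>2) = 1" for g
  proof -
    let ?X = "\<Sum>y\<in>UNIV. \<Sum>x\<in>{x. E y x}. cmod (nb_lift g x y) powr p"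
    have "?X powr (1 / p) \<le> sqrt (\<Sum>y\<in>UNIV. \<Sum>x\<in>{x. E y x}. (cmod (nb_lift g x y))\<^sup>2 / m x y) * sqrt (24 * C0 / real l) / (1 - \<rho>)"
      unfolding p_def by (rule nb_eigen_norm_bound[OF nb_eigen_nb_lift[OF g(1)] l])
    also have "\<dots> \<le> B"
      unfolding B_def using r1 C0_pos sum_nb_lift_sq_le[OF D g(2)]
      by (intro divide_right_mono mult_right_mono real_sqrt_le_mono) auto
    finally have "(?X powr (1 / p)) powr p \<le> B powr p" using p by (intro powr_mono2) auto
    moreover have "?X \<ge> 0" by (intro sum_nonneg) auto
    ultimately show ?thesis using p by (simp add: powr_powr)
  qed
  have "(\<Sum>x\<in>UNIV. cmod (\<psi> x) powr p) \<le> (\<Sum>x\<in>UNIV. \<Sum>y\<in>{y. E x y}. zm powr (- p) * (cmod (nb_lift \<psi> x y) powr p + cmod (nb_lift (cnj \<circ> \<psi>) x y) powr p))"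
  proof (rule sum_mono)
    fix x
    obtain y where xy: "E x y" using ex_adj by blast
    let ?a = "cmod (nb_lift \<psi> x y)" and ?b = "cmod (nb_lift (cnj \<circ> \<psi>) x y)"
    have "cmod (\<psi> x) powr p \<le> (max ?a ?b / zm) powr p"
      using cmod_le_nb_lift[OF xy, of \<psi>] p by (intro powr_mono2) auto
    also have "\<dots> = zm powr (- p) * max ?a ?b powr p"
      using zm_pos by (simp add: powr_divide powr_minus_divide)
    also have "\<dots> \<le> zm powr (- p) * (?a powr p + ?b powr p)"
      by (intro mult_left_mono) (auto simp: max_def)
    also have "\<dots> \<le> (\<Sum>y\<in>{y. E x y}. zm powr (- p) * (cmod (nb_lift \<psi> x y) powr p + cmod (nb_lift (cnj \<circ> \<psi>) x y) powr p))"
      using xy by (intro member_le_sum[where f = "\<lambda>y. zm powr (- p) * (cmod (nb_lift \<psi> x y) powr p + cmod (nb_lift (cnj \<circ> \<psi>) x y) powr p)"]) auto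
    finally show "cmod (\<psi> x) powr p \<le> (\<Sum>y\<in>{y. E x y}. zm powr (- p) * (cmod (nb_lift \<psi> x y) powr p + cmod (nb_lift (cnj \<circ> \<psi>) x y) powr p))" .
  qed
  also have "\<dots> = zm powr (- p) * ((\<Sum>x\<in>UNIV. \<Sum>y\<in>{y. E x y}. cmod (nb_lift \<psi> x y) powr p) + (\<Sum>x\<in>UNIV. \<Sum>y\<in>{y. E x y}. cmod (nb_lift (cnj \<circ> \<psi>) x y) powr p))"
    by (simp only: sum_distrib_left[symmetric] sum.distrib)
  also have "\<dots> \<le> zm powr (- p) * (B powr p + B powr p)"
    using X[OF \<psi>] X[OF cnj_eig]
    unfolding edge_sum_swap[of "\<lambda>x y. cmod (nb_lift \<psi> x y) powr p"] edge_sum_swap[of "\<lambda>x y. cmod (nb_lift (cnj \<circ> \<psi>) x y) powr p"]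
    by (intro mult_left_mono add_mono) auto
  also have "\<dots> = 2 * (zm powr (- p) * B powr p)" by simp
  \<comment> \<open>The two lifts give a factor two, enlarged to \<open>2 powr p\<close> so that it
    leaves the \<open>p\<close>-th root as the factor two.\<close>
  also have "\<dots> \<le> 2 powr p * (zm powr (- p) * B powr p)"
    using p powr_mono[of 1 p 2] by (intro mult_right_mono) auto
  also have "\<dots> = (2 * B / zm) powr p"
    using zm_pos B0 by (simp add: powr_divide powr_mult powr_minus_divide)
  finally have "pnorm \<psi> p \<le> ((2 * B / zm) powr p) powr (1 / p)"
    unfolding pnorm_def using p by (intro powr_mono2 sum_nonneg) auto
  also have "\<dots> = 2 * B / zm" using p B0 zm_pos by (simp add: powr_powr)
  also have "\<dots> \<le> 8 * D * zm powr (- 5) / (1 - \<rho>) * (1 / sqrt (real l))"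
  proof -
    have "sqrt (3 * D / zm) * sqrt (24 * C0 / real l) = sqrt (72 * D\<^sup>2 / (zm ^ 3 * real l))"
      unfolding real_sqrt_mult[symmetric] C0_def by (simp add: power2_eq_square power3_eq_cube ac_simps)
    also have "\<dots> \<le> sqrt ((4 * D / (zm ^ 4 * sqrt (real l)))\<^sup>2)"
    proof (rule real_sqrt_le_mono)
      \<comment> \<open>The spare power \<open>zm ^ 5\<close> is at most \<open>3 / 16\<close>, and
        \<open>72 * 3 / 16 = 13.5\<close> lies below 16. The square root 4, doubled and divided by
        \<open>zm\<close>, yields the constant 8 and the power \<open>- 5\<close>.\<close>
      have "zm\<^sup>2 \<le> (3 / 4)\<^sup>2" using zm_sq_le by (simp add: power2_eq_square)
      then have z34: "zm \<le> 3 / 4" by (rule power2_le_imp_le) simp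
      have "zm ^ 4 = (zm\<^sup>2)\<^sup>2" by simp
      also have "\<dots> \<le> (1 / 2)\<^sup>2" using zm_sq_le by (intro power_mono) auto
      finally have "zm ^ 4 * zm \<le> (1 / 2)\<^sup>2 * (3 / 4)" using z34 zm_pos by (intro mult_mono) auto
      then have z5: "72 * zm ^ 5 \<le> 16" by (simp add: power2_eq_square eval_nat_numeral)
      have "72 * D\<^sup>2 / (zm ^ 3 * real l) = 72 * zm ^ 5 * (D\<^sup>2 / (zm ^ 8 * real l))"
        using zm_pos by (simp add: field_simps eval_nat_numeral)
      also have "\<dots> \<le> 16 * (D\<^sup>2 / (zm ^ 8 * real l))" using z5 zm_pos by (intro mult_right_mono) auto
      also have "\<dots> = (4 * D / (zm ^ 4 * sqrt (real l)))\<^sup>2"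
        by (simp add: power_divide power_mult_distrib flip: power_mult)
      finally show "72 * D\<^sup>2 / (zm ^ 3 * real l) \<le> (4 * D / (zm ^ 4 * sqrt (real l)))\<^sup>2" .
    qed
    also have "\<dots> = 4 * D / (zm ^ 4 * sqrt (real l))" using D1 zm_pos by simp
    finally have "2 * B / zm \<le> 2 * (4 * D / (zm ^ 4 * sqrt (real l)) / (1 - \<rho>)) / zm"
      unfolding B_def using r1 zm_pos by (intro divide_right_mono mult_left_mono) auto
    also have "\<dots> = 8 * D * (1 / zm ^ 5) / (1 - \<rho>) * (1 / sqrt (real l))"
      by (simp add: eval_nat_numeral ac_simps)
    also have "1 / zm ^ 5 = zm powr (- 5)" using zm_pos by (simp add: powr_minus powr_numeral divide_inverse)
    finally show ?thesis .
  qed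
  finally show ?thesis by (simp add: p_def)
qed

text \<open>If \<open>4 * D * \<Lambda> < M ^ l\<close>, then three times the edge count is at most
  \<open>6 * D * \<Lambda>\<close>, hence at most \<open>3 / 2 * M ^ l\<close>. As
  \<open>t ^ l\<close> is the inverse fourth power of \<open>M ^ l\<close>, the support estimate
  would give \<open>1 <= (27 / 8) / M ^ l\<close>. But \<open>M ^ l\<close> exceeds 12, since
  \<open>D >= 3\<close> and \<open>\<Lambda> >= 1\<close>.\<close>

lemma (in zeta_graph) eigenfunction_support_bound:
  assumes \<psi>: "eigenfunction \<psi>" "\<psi> x0 \<noteq> 0" and few: "few_cycles E l"
    and D: "\<And>x. real (deg E x) \<le> D" and t0: "t > 0"
    and t: "\<And>x y. E x y \<Longrightarrow> (\<Sum>u\<in>N x y. cmod (Z x y) powr (2 * 2) * m y u powr 2) \<le> t * m x y powr 2"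
  shows "1 / (4 * D) * (t powr (- 1 / 4)) ^ l \<le> real (card {x. \<psi> x \<noteq> 0})"
proof (rule ccontr)
  define M where "M = t powr (- 1 / 4)"
  define \<Lambda> where "\<Lambda> = real (card {x. \<psi> x \<noteq> 0})"
  assume "\<not> ?thesis"
  then have lt: "\<Lambda> < 1 / (4 * D) * M ^ l" by (simp add: M_def \<Lambda>_def)
  have D3: "D \<ge> 3" using D[of x0] of_nat_mono[OF deg3[of x0], where 'a=real] by simp
  have "card {x. \<psi> x \<noteq> 0} > 0" using \<psi>(2) by (auto simp: card_gt_0_iff)
  then have L1: "\<Lambda> \<ge> 1" by (simp add: \<Lambda>_def)
  have X: "4 * D * \<Lambda> < M ^ l" using lt D3 by (simp add: field_simps)
  have "12 * 1 \<le> (4 * D) * \<Lambda>" using D3 L1 by (intro mult_mono) auto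
  then have X12: "M ^ l > 12" using X by simp
  obtain u v where uv: "E u v" "nb_lift \<psi> u v \<noteq> 0" using nb_lift_nonzero[of \<psi> x0, OF \<psi>(2)] by blast
  have "1 \<le> (3 * real (card {(x, y). E x y \<and> nb_lift \<psi> x y \<noteq> 0})) ^ 3 * t ^ l"
    using nb_eigen_support[OF nb_eigen_nb_lift[OF \<psi>(1)] uv few _ t] t0 by simp
  also have "\<dots> \<le> (3 * (2 * D * \<Lambda>)) ^ 3 * t ^ l"
    using card_nb_lift_support[OF D, of \<psi>] t0 by (intro mult_right_mono power_mono mult_left_mono) (auto simp: \<Lambda>_def)
  also have "\<dots> \<le> (3 / 2 * M ^ l) ^ 3 * t ^ l"
    using X D3 L1 t0 by (intro mult_right_mono power_mono) auto
  also have "t ^ l = 1 / (M ^ l) ^ 4"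
  proof -
    have "M ^ 4 = t powr (- 1)" unfolding M_def using t0 by (simp add: powr_powr flip: powr_numeral)
    then have "M ^ 4 * t = 1" using t0 by (simp add: powr_minus)
    then have "(M ^ l) ^ 4 * t ^ l = 1" by (metis mult.commute power_mult power_mult_distrib power_one)
    then show ?thesis by (metis eq_divide_eq mult.commute mult_zero_left zero_neq_one)
  qed
  also have "(3 / 2 * M ^ l) ^ 3 * (1 / (M ^ l) ^ 4) = (27 / 8) / M ^ l"
    using X12 by (simp add: power3_eq_cube power4_eq_xxxx)
  finally show False using X12 by (simp add: field_simps)
qed

theorem theorem1p6:
  fixes E :: "'a::finite \<Rightarrow> 'a \<Rightarrow> bool" and W :: "'a \<Rightarrow> real"
    and \<psi> :: "'a \<Rightarrow> complex" and lam :: real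
  assumes sym: "\<forall>x y. E x y \<longrightarrow> E y x"
    and irrefl: "\<forall>x. \<not> E x x"
    and connected: "\<forall>x y. E\<^sup>*\<^sup>* x y"
    and mindeg: "\<forall>x. deg E x \<ge> 3"
    and eigen: "\<forall>x. (\<Sum>y\<in>{y. E x y}. \<psi> y) + complex_of_real (W x) * \<psi> x
                    = complex_of_real lam * \<psi> x"
    and normalized: "(\<Sum>x\<in>UNIV. (cmod (\<psi> x))\<^sup>2) = 1"
    and bulk: "lam \<in> bulk_spectrum E W"
  shows "(\<forall>p::real. p > 4 \<longrightarrow>
            Zs E W (p / 4) lam < 1 \<and>
            (ellG E > 0 \<longrightarrow>
              pnorm \<psi> p \<le> 8 * real (maxdeg E) * zmin E W lam powr (-5)
                              / (1 - Zs E W (p / 4) lam powr (2 / p))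
                           * (1 / sqrt (real (ellG E)))))
       \<and> (let M = Zs E W 2 lam powr (-1 / 4) in
            M > 1 \<and> real (card {x. \<psi> x \<noteq> 0}) \<ge> 1 / (4 * real (maxdeg E)) * M ^ ellG E)"
proof -
  define Z where "Z = zeta0 E W lam"
  note zrec = zeta0_recursion[of E lam W, folded Z_def]
  have neg: "Im (Z x y) < 0" if "E x y" for x y
    using zrec(1)[OF _ _ bulk that] sym connected by blast
  have Erec: "Z x y * (complex_of_real lam - complex_of_real (W y) - (\<Sum>u\<in>{u. E y u \<and> u \<noteq> x}. Z y u)) = 1" if "E x y" for x y
    using zrec(2)[OF _ _ bulk that] sym connected by blast
  define A where "A = {\<bar>Im (Z x y)\<bar> | x y. E x y}"
  have zA: "zmin E W lam = Min A"
    unfolding zmin_def A_def Z_def using sym by (intro arg_cong[of _ _ Min]) auto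
  have "A = (\<lambda>(x, y). \<bar>Im (Z x y)\<bar>) ` {(x, y). E x y}" by (auto simp: A_def)
  then have finA: "finite A" by simp
  have "{y. E x y} \<noteq> {}" for x using mindeg unfolding deg_def by (metis card.empty not_numeral_le_zero)
  then have neA: "A \<noteq> {}" by (auto simp: A_def)
  have zpos: "zmin E W lam > 0"
    using Min_in[OF finA neA] neg unfolding zA A_def by fastforce
  have zle: "zmin E W lam \<le> - Im (Z x y)" if "E x y" for x y
  proof -
    have "\<bar>Im (Z x y)\<bar> \<in> A" using that by (auto simp: A_def)
    then have "zmin E W lam \<le> \<bar>Im (Z x y)\<bar>" unfolding zA using finA by (rule Min_le[rotated])
    then show ?thesis using neg[OF that] by simp
  qed
  interpret zeta_graph E W lam Z "zmin E W lam"
    using sym irrefl mindeg neg Erec zpos zle by unfold_locales auto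
  have few: "few_cycles E (ellG E)"
    using E_sym E_irrefl deg3 by (intro few_cycles_ellG) auto
  have D: "real (deg E x) \<le> real (maxdeg E)" for x
    unfolding maxdeg_def by (intro of_nat_mono Max_ge) auto
  have eig: "eigenfunction \<psi>" using eigen by (simp add: eigenfunction_def)
  note ZB = Zs_bounds[OF Z_def]
  have part1: "Zs E W (p / 4) lam < 1 \<and> (ellG E > 0 \<longrightarrow> pnorm \<psi> p \<le> 8 * real (maxdeg E) * zmin E W lam powr (-5)
      / (1 - Zs E W (p / 4) lam powr (2 / p)) * (1 / sqrt (real (ellG E))))" if p: "p > 4" for p :: real
  proof (intro conjI impI)
    have s: "p / 4 > 1" using p by simp
    show "Zs E W (p / 4) lam < 1" by (rule ZB(1)[OF s])
    assume l: "ellG E > 0"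
    interpret zeta_graph_norm E W lam Z "zmin E W lam" "p / 4" "Zs E W (p / 4) lam" "real (maxdeg E)" "ellG E"
      using ZB[OF s] s D few by unfold_locales auto
    \<comment> \<open>With \<open>s = p / 4\<close> the exponent \<open>1 / (2 * s)\<close> equals
      \<open>2 / p\<close>.\<close>
    have "\<rho> = Zs E W (p / 4) lam powr (2 / p)" by (simp add: \<rho>_def)
    then show "pnorm \<psi> p \<le> 8 * real (maxdeg E) * zmin E W lam powr (-5)
      / (1 - Zs E W (p / 4) lam powr (2 / p)) * (1 / sqrt (real (ellG E)))"
      using eigenfunction_norm_bound[OF eig normalized l] by simp
  qed
  have "\<exists>x. \<psi> x \<noteq> 0"
  proof (rule ccontr)
    assume "\<not> (\<exists>x. \<psi> x \<noteq> 0)"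
    then show False using normalized by simp
  qed
  then obtain x0 where x0: "\<psi> x0 \<noteq> 0" by blast
  have two: "(2::real) > 1" by simp
  have "1 powr (-1 / 4) < Zs E W 2 lam powr (-1 / 4)"
    using ZB(1,2)[OF two] by (intro powr_less_mono2_neg) auto
  then have "Zs E W 2 lam powr (-1 / 4) > 1" by simp
  moreover have "1 / (4 * real (maxdeg E)) * (Zs E W 2 lam powr (- 1 / 4)) ^ ellG E \<le> real (card {x. \<psi> x \<noteq> 0})"
    by (rule eigenfunction_support_bound[OF eig x0 few D ZB(2)[OF two] ZB(3)[OF two]])
  ultimately show ?thesis using part1 by (simp add: Let_def)
qed

end
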